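(* Let $H$ be a Hopf algebra over a field $k$, $B$ a unital algebra and $B\#_\sigma H$ a cocycle cross product of associative type. Then the map $$\tilde\sigma(b\otimes b'\#h,\ c\otimes c'\#g)=b(h_{(1)}\triangleright c)\,\sigma(h_{(2)},g_{(1)})\,((h_{(3)}g_{(2)})\triangleright c')\,(h_{(4)}\triangleright b')$$ is an invertible normalised 2-cocycle on the left $B$-bialgebroid $B^e\#H$, and $$\phi:(B^e\#H)^{\tilde\sigma}\to B^e\#_\sigma H,\qquad \phi(b\otimes b'\#h)=b\otimes b'\sigma^{-1}(S(h_{(2)}),h_{(3)})\#_\sigma h_{(1)}$$ is an isomorphism of left $B$-bialgebroids.
   Context: Sumless Sweedler notation is used; $S$ is the antipode of $H$; $B^e=B\otimes B^{op}$. Cocycle cross product: a linear map $\triangleright:H\otimes B\to B$ with $h\triangleright(ab)=(h_{(1)}\triangleright a)(h_{(2)}\triangleright b)$, $h\triangleright 1=\epsilon(h)1$ (a measuring), and a convolution-invertible $\sigma:H\otimes H\to B$ (inverse $\sigma^{-1}$) with (1) $1\triangleright b=b$; (2) $h\triangleright(g\triangleright b)=\sigma(h_{(1)},g_{(1)})(h_{(2)}g_{(2)}\triangleright b)\sigma^{-1}(h_{(3)},g_{(3)})$; (3) $\sigma(h,1)=\sigma(1,h)=\epsilon(h)1$; (4) $(h_{(1)}\triangleright\sigma(g_{(1)},f_{(1)}))\sigma(h_{(2)},g_{(2)}f_{(2)})=\sigma(h_{(1)},g_{(1)})\sigma(h_{(2)}g_{(2)},f)$. Then $B\#_\sigma H$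 is $B\otimes H$ with product $(b\#_\sigma h)(c\#_\sigma g)=b(h_{(1)}\triangleright c)\sigma(h_{(2)},g_{(1)})\#_\sigma h_{(3)}g_{(2)}$. It is of associative type if $B$ is an $H$-module algebra under $\triangleright$ (i.e. $\triangleright$ is also an action). $B^e\#_\sigma H$ is the left $B$-bialgebroid on $B^e\otimes H$ with product $(b\otimes b'\#_\sigma h)(c\otimes c'\#_\sigma g)=b(h_{(1)}\triangleright c)\sigma(h_{(2)},g_{(1)})\otimes c'(S(g_{(4)})\triangleright b')\sigma(S(g_{(3)}),S(h_{(4)}))\#_\sigma h_{(3)}g_{(2)}$, $s(b)=b\otimes1\#_\sigma1$, $t(b)=1\otimes b\#_\sigma1$, coproduct $\Delta(b\otimes b'\#_\sigma h)=(b\otimes\sigma^{-1}(S(h_{(2)}),h_{(3)})\#_\sigma h_{(1)})\otimes_B(1\otimes b'\#_\sigma h_{(4)})$, counit $\epsilon(b\otimes b'\#_\sigma h)=b(h_{(1)}\triangleright b')\sigma(h_{(2)},S(h_{(3)}))$. In the associative type case, $B^e\#H$ denotes the same construction with the same $\triangleright$ and trivial cocycle $\sigma(h,g)=\epsilon(h)\epsilon(g)1$. Left $B$-bialgebroid: an algebra $\mathcal{L}$ with algebra maps $s:B\to\mathcal{L}$, $t:B^{op}\to\mathcal{L}$ with commuting images and a $B$-coring structure $(\Delta,\epsilon)$ for the bimodule structure $b.X.c=s(b)t(c)X$, such that $\Delta$ corestricts to an algebra map into $\{\sum_i X_i\otimes_BY_i\mid\sum_i X_it(b)\otimes_BY_i=\sum_i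 X_i\otimes_BY_is(b)\ \forall b\}$ (factorwise product), and $\epsilon(1)=1$, $\epsilon(s(b)X)=b\epsilon(X)$, $\epsilon(Xs(\epsilon(Y)))=\epsilon(XY)=\epsilon(Xt(\epsilon(Y)))$. Morphisms of left $B$-bialgebroids are algebra maps that are $B$-coring maps ($B$-bimodule maps respecting $\Delta,\epsilon$). On a left $B$-bialgebroid $\mathcal{L}$, ${}_B\mathrm{Hom}_B(\mathcal{L}\otimes_{B^e}\mathcal{L},B)$ consists of $B$-bimodule maps, where $\otimes_{B^e}$ is balanced by $\eta(b\otimes c)=s(b)t(c)$ ($X\eta(\cdot)\otimes Y=X\otimes\eta(\cdot)Y$) and $b.(X\otimes Y).c=s(b)t(c)X\otimes Y$; it is an algebra with $(f\star g)(X,Y)=f(X_{(1)},Y_{(1)})g(X_{(2)},Y_{(2)})$ and unit $\epsilon(XY)$. A normalised left 2-cocycle is a convolution-invertible $\varsigma$ in it with $\varsigma(X,s(\varsigma(Y_{(1)},Z_{(1)}))Y_{(2)}Z_{(2)})=\varsigma(s(\varsigma(X_{(1)},Y_{(1)}))X_{(2)}Y_{(2)},Z)$ and $\varsigma(1,X)=\epsilon(X)=\varsigma(X,1)$; a normalised right 2-cocycle is a convolution-invertible $\xi$ with $\xi(X,t(\xi(Y_{(2)},Z_{(2)}))Y_{(1)}Z_{(1)})=\xi(t(\xi(X_{(2)},Y_{(2)}))X_{(1)}Y_{(1)},Z)$ and $\xi(1,X)=\epsilon(X)=\xi(X,1)$. An invertible normalised 2-cocycle is a normalised left 2-cocycle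 whose convolution inverse is a normalised right 2-cocycle. Then $\mathcal{L}^\varsigma$ is the left $B$-bialgebroid with the same $s,t,\Delta,\epsilon$ and product $X\cdot_\varsigma Y=s(\varsigma(X_{(1)},Y_{(1)}))t(\varsigma^{-1}(X_{(3)},Y_{(3)}))X_{(2)}Y_{(2)}$. *)

theory Defs
  imports "HOL-Algebra.Module" "HOL-Algebra.RingHom" "HOL-Algebra.Algebraic_Closure_Type"
begin

section \<open>Tensor products as finite formal sums\<close>

text \<open>
  An element \<open>\<Sum>\<^sub>i x\<^sub>i \<otimes> y\<^sub>i\<close> of a tensor product is represented by the list of the pairs
  \<open>(x\<^sub>i, y\<^sub>i)\<close>; two lists represent the same element iff they are related by the congruence
  of the free commutative monoid on pairs which is generated by additivity in each factor,
  \<open>0 \<otimes> y = 0 = x \<otimes> 0\<close> and the balancing relations. The quotient is the usual tensor product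
  (\<open>(- x) \<otimes> y\<close> is the negative of \<open>x \<otimes> y\<close>). Triple tensor products are treated alike.

  A map into a tensor product, such as a coproduct, is given by a function choosing a representing
  formal sum for each value, and equations between such values are stated modulo the congruence.
  Sumless Sweedler notation thus becomes a sum over a list.
\<close>

inductive fsum_cong :: "('x list \<Rightarrow> 'x list \<Rightarrow> bool) \<Rightarrow> 'x list \<Rightarrow> 'x list \<Rightarrow> bool"
  for R where
  gen: "R xs ys \<Longrightarrow> fsum_cong R xs ys"
| refl: "fsum_cong R xs xs"
| sym: "fsum_cong R xs ys \<Longrightarrow> fsum_cong R ys xs"
| trans: "fsum_cong R xs ys \<Longrightarrow> fsum_cong R ys zs \<Longrightarrow> fsum_cong R xs zs"
| comm: "fsum_cong R (xs @ ys) (ys @ xs)"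
| append: "fsum_cong R xs ys \<Longrightarrow> fsum_cong R (zs @ xs) (zs @ ys)"

text \<open>Generators for tensor products of vector spaces over \<open>'k\<close> (with scalar multiplications
  \<open>sa\<close>, \<open>sb\<close>, \<open>sc\<close>).\<close>

inductive ktens2_rel ::
  "('k \<Rightarrow> 'a::ab_group_add \<Rightarrow> 'a) \<Rightarrow> ('k \<Rightarrow> 'b::ab_group_add \<Rightarrow> 'b) \<Rightarrow>
    ('a \<times> 'b) list \<Rightarrow> ('a \<times> 'b) list \<Rightarrow> bool"
  for sa sb where
  "ktens2_rel sa sb [(a + a', b)] [(a, b), (a', b)]"
| "ktens2_rel sa sb [(a, b + b')] [(a, b), (a, b')]"
| "ktens2_rel sa sb [(0, b)] []"
| "ktens2_rel sa sb [(a, 0)] []"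
| "ktens2_rel sa sb [(sa r a, b)] [(a, sb r b)]"

inductive ktens3_rel ::
  "('k \<Rightarrow> 'a::ab_group_add \<Rightarrow> 'a) \<Rightarrow> ('k \<Rightarrow> 'b::ab_group_add \<Rightarrow> 'b) \<Rightarrow>
    ('k \<Rightarrow> 'c::ab_group_add \<Rightarrow> 'c) \<Rightarrow> ('a \<times> 'b \<times> 'c) list \<Rightarrow> ('a \<times> 'b \<times> 'c) list \<Rightarrow> bool"
  for sa sb sc where
  "ktens3_rel sa sb sc [(a + a', b, c)] [(a, b, c), (a', b, c)]"
| "ktens3_rel sa sb sc [(a, b + b', c)] [(a, b, c), (a, b', c)]"
| "ktens3_rel sa sb sc [(a, b, c + c')] [(a, b, c), (a, b, c')]"
| "ktens3_rel sa sb sc [(0, b, c)] []"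
| "ktens3_rel sa sb sc [(a, 0, c)] []"
| "ktens3_rel sa sb sc [(a, b, 0)] []"
| "ktens3_rel sa sb sc [(sa r a, b, c)] [(a, sb r b, c)]"
| "ktens3_rel sa sb sc [(a, sb r b, c)] [(a, b, sc r c)]"

definition comult3 :: "('x \<Rightarrow> ('x \<times> 'x) list) \<Rightarrow> 'x \<Rightarrow> ('x \<times> 'x \<times> 'x) list" where
  "comult3 \<Delta> h = [(h1, h2, h3). (h1, r) \<leftarrow> \<Delta> h, (h2, h3) \<leftarrow> \<Delta> r]"

definition comult4 :: "('x \<Rightarrow> ('x \<times> 'x) list) \<Rightarrow> 'x \<Rightarrow> ('x \<times> 'x \<times> 'x \<times> 'x) list" where
  "comult4 \<Delta> h = [(h1, h2, h3, h4). (h1, r) \<leftarrow> \<Delta> h, (h2, h3, h4) \<leftarrow> comult3 \<Delta> r]"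


section \<open>Algebras and Hopf algebras over a field\<close>

text \<open>The sort \<open>{ring, monoid_mult}\<close> is that of unital rings in which \<open>0 = 1\<close> is permitted.\<close>

locale k_algebra = vector_space scale
  for scale :: "'k::field \<Rightarrow> 'a::{ring, monoid_mult} \<Rightarrow> 'a" +
  assumes scale_mult_left: "scale r a * b = scale r (a * b)"
    and scale_mult_right: "a * scale r b = scale r (a * b)"

record ('k, 'h) hopf =
  hscale :: "'k \<Rightarrow> 'h \<Rightarrow> 'h"
  hcomult :: "'h \<Rightarrow> ('h \<times> 'h) list"
  hcounit :: "'h \<Rightarrow> 'k"
  antipode :: "'h \<Rightarrow> 'h"

locale hopf_algebra =
  fixes H :: "('k::field, 'h::{ring, monoid_mult}) hopf"
  assumes algebra: "k_algebra (hscale H)"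
    and comult_add: "fsum_cong (ktens2_rel (hscale H) (hscale H))
      (hcomult H (x + y)) (hcomult H x @ hcomult H y)"
    and comult_scale: "fsum_cong (ktens2_rel (hscale H) (hscale H))
      (hcomult H (hscale H r x)) [(hscale H r x1, x2). (x1, x2) \<leftarrow> hcomult H x]"
    and counit_linear: "Vector_Spaces.linear (hscale H) (*) (hcounit H)"
    and coassoc: "fsum_cong (ktens3_rel (hscale H) (hscale H) (hscale H))
      [(x1, x2, x3). (r, x3) \<leftarrow> hcomult H x, (x1, x2) \<leftarrow> hcomult H r]
      [(x1, x2, x3). (x1, r) \<leftarrow> hcomult H x, (x2, x3) \<leftarrow> hcomult H r]"
    and counit_left: "(\<Sum>(x1, x2)\<leftarrow>hcomult H x. hscale H (hcounit H x1) x2) = x"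
    and counit_right: "(\<Sum>(x1, x2)\<leftarrow>hcomult H x. hscale H (hcounit H x2) x1) = x"
    and comult_mult: "fsum_cong (ktens2_rel (hscale H) (hscale H))
      (hcomult H (x * y)) [(x1 * y1, x2 * y2). (x1, x2) \<leftarrow> hcomult H x, (y1, y2) \<leftarrow> hcomult H y]"
    and comult_one: "fsum_cong (ktens2_rel (hscale H) (hscale H)) (hcomult H 1) [(1, 1)]"
    and counit_mult: "hcounit H (x * y) = hcounit H x * hcounit H y"
    and counit_one: "hcounit H 1 = 1"
    and antipode_linear: "Vector_Spaces.linear (hscale H) (hscale H) (antipode H)"
    and antipode_left: "(\<Sum>(x1, x2)\<leftarrow>hcomult H x. antipode H x1 * x2) = hscale H (hcounit H x) 1"
    and antipode_right: "(\<Sum>(x1, x2)\<leftarrow>hcomult H x. x1 * antipode H x2) = hscale H (hcounit H x) 1"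


section \<open>Cocycle cross products\<close>

text \<open>Linear maps on \<open>H \<otimes> B\<close> and \<open>H \<otimes> H\<close> are given as bilinear maps.\<close>

definition bilinear_map ::
  "('k::field \<Rightarrow> 'a::ab_group_add \<Rightarrow> 'a) \<Rightarrow> ('k \<Rightarrow> 'b::ab_group_add \<Rightarrow> 'b) \<Rightarrow>
    ('k \<Rightarrow> 'c::ab_group_add \<Rightarrow> 'c) \<Rightarrow> ('a \<Rightarrow> 'b \<Rightarrow> 'c) \<Rightarrow> bool" where
  "bilinear_map sa sb sc f \<longleftrightarrow>
    (\<forall>b. Vector_Spaces.linear sa sc (\<lambda>a. f a b)) \<and> (\<forall>a. Vector_Spaces.linear sb sc (f a))"

text \<open>The data \<open>(\<triangleright>, \<sigma>)\<close> of a cocycle cross product \<open>B #\<^sub>\<sigma> H\<close>, together with the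
  convolution inverse \<open>\<sigma>i\<close> of \<open>\<sigma>\<close>.\<close>

locale cocycle_cross_product =
  fixes H :: "('k::field, 'h::{ring, monoid_mult}) hopf"
    and sB :: "'k \<Rightarrow> 'b::{ring, monoid_mult} \<Rightarrow> 'b"
    and act :: "'h \<Rightarrow> 'b \<Rightarrow> 'b" (infixr "\<triangleright>" 75)
    and \<sigma> \<sigma>i :: "'h \<Rightarrow> 'h \<Rightarrow> 'b"
  assumes act_bilinear: "bilinear_map (hscale H) sB sB (\<triangleright>)"
    and measuring_mult: "h \<triangleright> (a * b) = (\<Sum>(h1, h2)\<leftarrow>hcomult H h. (h1 \<triangleright> a) * (h2 \<triangleright> b))"
    and measuring_one: "h \<triangleright> 1 = sB (hcounit H h) 1"
    and \<sigma>_bilinear: "bilinear_map (hscale H) (hscale H) sB \<sigma>"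
    and \<sigma>i_bilinear: "bilinear_map (hscale H) (hscale H) sB \<sigma>i"
    and \<sigma>_\<sigma>i: "(\<Sum>(h1, h2)\<leftarrow>hcomult H h. \<Sum>(g1, g2)\<leftarrow>hcomult H g. \<sigma> h1 g1 * \<sigma>i h2 g2)
      = sB (hcounit H h * hcounit H g) 1"
    and \<sigma>i_\<sigma>: "(\<Sum>(h1, h2)\<leftarrow>hcomult H h. \<Sum>(g1, g2)\<leftarrow>hcomult H g. \<sigma>i h1 g1 * \<sigma> h2 g2)
      = sB (hcounit H h * hcounit H g) 1"
    and one_act: "1 \<triangleright> b = b"
    and act_act: "h \<triangleright> (g \<triangleright> b) =
      (\<Sum>(h1, h2, h3)\<leftarrow>comult3 (hcomult H) h. \<Sum>(g1, g2, g3)\<leftarrow>comult3 (hcomult H) g.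
        \<sigma> h1 g1 * ((h2 * g2) \<triangleright> b) * \<sigma>i h3 g3)"
    and \<sigma>_one_right: "\<sigma> h 1 = sB (hcounit H h) 1"
    and \<sigma>_one_left: "\<sigma> 1 h = sB (hcounit H h) 1"
    and cocycle:
      "(\<Sum>(h1, h2)\<leftarrow>hcomult H h. \<Sum>(g1, g2)\<leftarrow>hcomult H g. \<Sum>(f1, f2)\<leftarrow>hcomult H f.
          (h1 \<triangleright> \<sigma> g1 f1) * \<sigma> h2 (g2 * f2)) =
       (\<Sum>(h1, h2)\<leftarrow>hcomult H h. \<Sum>(g1, g2)\<leftarrow>hcomult H g. \<sigma> h1 g1 * \<sigma> (h2 * g2) f)"

text \<open>Together with the measuring property and \<open>1 \<triangleright> b = b\<close> this makes \<open>B\<close> an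
  \<open>H\<close>-module algebra.\<close>

definition associative_type :: "('h::times \<Rightarrow> 'b \<Rightarrow> 'b) \<Rightarrow> bool" where
  "associative_type act \<longleftrightarrow> (\<forall>h g b. act h (act g b) = act (h * g) b)"

definition trivial_cocycle ::
  "('k::field, 'h) hopf \<Rightarrow> ('k \<Rightarrow> 'b::{ring, monoid_mult} \<Rightarrow> 'b) \<Rightarrow> 'h \<Rightarrow> 'h \<Rightarrow> 'b" where
  "trivial_cocycle H sB h g = sB (hcounit H h * hcounit H g) 1"


section \<open>Left bialgebroids\<close>

record ('k, 'b, 'l) bialgebroid = "('k, 'l) module" +
  src :: "'b \<Rightarrow> 'l"
  tgt :: "'b \<Rightarrow> 'l"
  comult :: "'l \<Rightarrow> ('l \<times> 'l) list"
  counit :: "'l \<Rightarrow> 'b"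

definition lsum :: "('l, 'm) ring_scheme \<Rightarrow> 'l list \<Rightarrow> 'l" where
  "lsum L xs = foldr (\<lambda>x y. x \<oplus>\<^bsub>L\<^esub> y) xs \<zero>\<^bsub>L\<^esub>"

text \<open>Generators for \<open>\<L> \<otimes>\<^sub>B \<L>\<close> and \<open>\<L> \<otimes>\<^sub>B \<L> \<otimes>\<^sub>B \<L>\<close> for the bimodule structure
  \<open>b.U.c = s(b) t(c) U\<close>.\<close>

inductive btens2_rel ::
  "('k, 'b, 'l) bialgebroid \<Rightarrow> ('l \<times> 'l) list \<Rightarrow> ('l \<times> 'l) list \<Rightarrow> bool"
  for L where
  "\<lbrakk>U \<in> carrier L; U' \<in> carrier L; V \<in> carrier L\<rbrakk> \<Longrightarrow>
    btens2_rel L [(U \<oplus>\<^bsub>L\<^esub> U', V)] [(U, V), (U', V)]"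
| "\<lbrakk>U \<in> carrier L; V \<in> carrier L; V' \<in> carrier L\<rbrakk> \<Longrightarrow>
    btens2_rel L [(U, V \<oplus>\<^bsub>L\<^esub> V')] [(U, V), (U, V')]"
| "V \<in> carrier L \<Longrightarrow> btens2_rel L [(\<zero>\<^bsub>L\<^esub>, V)] []"
| "U \<in> carrier L \<Longrightarrow> btens2_rel L [(U, \<zero>\<^bsub>L\<^esub>)] []"
| "\<lbrakk>U \<in> carrier L; V \<in> carrier L\<rbrakk> \<Longrightarrow>
    btens2_rel L [(tgt L b \<otimes>\<^bsub>L\<^esub> U, V)] [(U, src L b \<otimes>\<^bsub>L\<^esub> V)]"

inductive btens3_rel ::
  "('k, 'b, 'l) bialgebroid \<Rightarrow> ('l \<times> 'l \<times> 'l) list \<Rightarrow> ('l \<times> 'l \<times> 'l) list \<Rightarrow> bool"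
  for L where
  "\<lbrakk>U \<in> carrier L; U' \<in> carrier L; V \<in> carrier L; W \<in> carrier L\<rbrakk> \<Longrightarrow>
    btens3_rel L [(U \<oplus>\<^bsub>L\<^esub> U', V, W)] [(U, V, W), (U', V, W)]"
| "\<lbrakk>U \<in> carrier L; V \<in> carrier L; V' \<in> carrier L; W \<in> carrier L\<rbrakk> \<Longrightarrow>
    btens3_rel L [(U, V \<oplus>\<^bsub>L\<^esub> V', W)] [(U, V, W), (U, V', W)]"
| "\<lbrakk>U \<in> carrier L; V \<in> carrier L; W \<in> carrier L; W' \<in> carrier L\<rbrakk> \<Longrightarrow>
    btens3_rel L [(U, V, W \<oplus>\<^bsub>L\<^esub> W')] [(U, V, W), (U, V, W')]"
| "\<lbrakk>V \<in> carrier L; W \<in> carrier L\<rbrakk> \<Longrightarrow> btens3_rel L [(\<zero>\<^bsub>L\<^esub>, V, W)] []"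
| "\<lbrakk>U \<in> carrier L; W \<in> carrier L\<rbrakk> \<Longrightarrow> btens3_rel L [(U, \<zero>\<^bsub>L\<^esub>, W)] []"
| "\<lbrakk>U \<in> carrier L; V \<in> carrier L\<rbrakk> \<Longrightarrow> btens3_rel L [(U, V, \<zero>\<^bsub>L\<^esub>)] []"
| "\<lbrakk>U \<in> carrier L; V \<in> carrier L; W \<in> carrier L\<rbrakk> \<Longrightarrow>
    btens3_rel L [(tgt L b \<otimes>\<^bsub>L\<^esub> U, V, W)] [(U, src L b \<otimes>\<^bsub>L\<^esub> V, W)]"
| "\<lbrakk>U \<in> carrier L; V \<in> carrier L; W \<in> carrier L\<rbrakk> \<Longrightarrow>
    btens3_rel L [(U, tgt L b \<otimes>\<^bsub>L\<^esub> V, W)] [(U, V, src L b \<otimes>\<^bsub>L\<^esub> W)]"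

locale left_bialgebroid =
  fixes sB :: "'k::field \<Rightarrow> 'b::{ring, monoid_mult} \<Rightarrow> 'b"
    and L :: "('k, 'b, 'l) bialgebroid" (structure)
  assumes base_algebra: "k_algebra sB"
    (* a k-algebra; HOL-Algebra's locale algebra is restricted to commutative ones *)
    and ring: "ring L"
    and module: "Module.module (ring_of_type_algebra :: 'k ring) L"
    and smult_mult_left: "\<lbrakk>U \<in> carrier L; V \<in> carrier L\<rbrakk> \<Longrightarrow> (r \<odot> U) \<otimes> V = r \<odot> (U \<otimes> V)"
    and smult_mult_right: "\<lbrakk>U \<in> carrier L; V \<in> carrier L\<rbrakk> \<Longrightarrow> U \<otimes> (r \<odot> V) = r \<odot> (U \<otimes> V)"
    and src_closed: "src L b \<in> carrier L"
    and src_add: "src L (b + c) = src L b \<oplus> src L c"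
    and src_scale: "src L (sB r b) = r \<odot> src L b"
    and src_mult: "src L (b * c) = src L b \<otimes> src L c"
    and src_one: "src L 1 = \<one>"
    and tgt_closed: "tgt L b \<in> carrier L"
    and tgt_add: "tgt L (b + c) = tgt L b \<oplus> tgt L c"
    and tgt_scale: "tgt L (sB r b) = r \<odot> tgt L b"
    and tgt_mult: "tgt L (b * c) = tgt L c \<otimes> tgt L b"
    and tgt_one: "tgt L 1 = \<one>"
    and src_tgt_commute: "src L b \<otimes> tgt L c = tgt L c \<otimes> src L b"
    and comult_closed: "U \<in> carrier L \<Longrightarrow> set (comult L U) \<subseteq> carrier L \<times> carrier L"
    and comult_add: "\<lbrakk>U \<in> carrier L; V \<in> carrier L\<rbrakk> \<Longrightarrow>
      fsum_cong (btens2_rel L) (comult L (U \<oplus> V)) (comult L U @ comult L V)"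
    and comult_bimodule: "U \<in> carrier L \<Longrightarrow>
      fsum_cong (btens2_rel L) (comult L (src L b \<otimes> tgt L c \<otimes> U))
        [(src L b \<otimes> U1, tgt L c \<otimes> U2). (U1, U2) \<leftarrow> comult L U]"
    and counit_add: "\<lbrakk>U \<in> carrier L; V \<in> carrier L\<rbrakk> \<Longrightarrow>
      counit L (U \<oplus> V) = counit L U + counit L V"
    and counit_bimodule: "U \<in> carrier L \<Longrightarrow>
      counit L (src L b \<otimes> tgt L c \<otimes> U) = b * counit L U * c"
    and coassoc: "U \<in> carrier L \<Longrightarrow> fsum_cong (btens3_rel L)
      [(U1, U2, U3). (Q, U3) \<leftarrow> comult L U, (U1, U2) \<leftarrow> comult L Q]
      [(U1, U2, U3). (U1, Q) \<leftarrow> comult L U, (U2, U3) \<leftarrow> comult L Q]"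
    and counit_left: "U \<in> carrier L \<Longrightarrow>
      lsum L [src L (counit L U1) \<otimes> U2. (U1, U2) \<leftarrow> comult L U] = U"
    and counit_right: "U \<in> carrier L \<Longrightarrow>
      lsum L [tgt L (counit L U2) \<otimes> U1. (U1, U2) \<leftarrow> comult L U] = U"
    (* the coproduct corestricts to an algebra map into the Takeuchi product *)
    and takeuchi: "U \<in> carrier L \<Longrightarrow> fsum_cong (btens2_rel L)
      [(U1 \<otimes> tgt L b, U2). (U1, U2) \<leftarrow> comult L U]
      [(U1, U2 \<otimes> src L b). (U1, U2) \<leftarrow> comult L U]"
    and comult_mult: "\<lbrakk>U \<in> carrier L; V \<in> carrier L\<rbrakk> \<Longrightarrow> fsum_cong (btens2_rel L)
      (comult L (U \<otimes> V))
      [(U1 \<otimes> V1, U2 \<otimes> V2). (U1, U2) \<leftarrow> comult L U, (V1, V2) \<leftarrow> comult L V]"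
    and comult_one: "fsum_cong (btens2_rel L) (comult L \<one>) [(\<one>, \<one>)]"
    and counit_one: "counit L \<one> = 1"
    and counit_src: "U \<in> carrier L \<Longrightarrow> counit L (src L b \<otimes> U) = b * counit L U"
    and counit_mult_src: "\<lbrakk>U \<in> carrier L; V \<in> carrier L\<rbrakk> \<Longrightarrow>
      counit L (U \<otimes> src L (counit L V)) = counit L (U \<otimes> V)"
    and counit_mult_tgt: "\<lbrakk>U \<in> carrier L; V \<in> carrier L\<rbrakk> \<Longrightarrow>
      counit L (U \<otimes> tgt L (counit L V)) = counit L (U \<otimes> V)"

definition bialgebroid_hom ::
  "('k::field \<Rightarrow> 'b::{ring, monoid_mult} \<Rightarrow> 'b) \<Rightarrow> ('k, 'b, 'l) bialgebroid \<Rightarrow>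
    ('k, 'b, 'l2) bialgebroid \<Rightarrow> ('l \<Rightarrow> 'l2) \<Rightarrow> bool" where
  "bialgebroid_hom sB L M \<phi> \<longleftrightarrow>
    left_bialgebroid sB L \<and> left_bialgebroid sB M \<and> \<phi> \<in> ring_hom L M \<and>
    (\<forall>U \<in> carrier L. \<forall>r. \<phi> (r \<odot>\<^bsub>L\<^esub> U) = r \<odot>\<^bsub>M\<^esub> \<phi> U) \<and>
    (\<forall>U \<in> carrier L. \<forall>b c. \<phi> (src L b \<otimes>\<^bsub>L\<^esub> tgt L c \<otimes>\<^bsub>L\<^esub> U)
      = src M b \<otimes>\<^bsub>M\<^esub> tgt M c \<otimes>\<^bsub>M\<^esub> \<phi> U) \<and>
    (\<forall>U \<in> carrier L. fsum_cong (btens2_rel M)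
      (comult M (\<phi> U)) [(\<phi> U1, \<phi> U2). (U1, U2) \<leftarrow> comult L U]) \<and>
    (\<forall>U \<in> carrier L. counit M (\<phi> U) = counit L U)"

definition bialgebroid_iso ::
  "('k::field \<Rightarrow> 'b::{ring, monoid_mult} \<Rightarrow> 'b) \<Rightarrow> ('k, 'b, 'l) bialgebroid \<Rightarrow>
    ('k, 'b, 'l2) bialgebroid \<Rightarrow> ('l \<Rightarrow> 'l2) \<Rightarrow> bool" where
  "bialgebroid_iso sB L M \<phi> \<longleftrightarrow> bialgebroid_hom sB L M \<phi> \<and>
    (\<exists>\<psi>. bialgebroid_hom sB M L \<psi> \<and>
      (\<forall>U \<in> carrier L. \<psi> (\<phi> U) = U) \<and> (\<forall>V \<in> carrier M. \<phi> (\<psi> V) = V))"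


section \<open>Two-cocycles on a left bialgebroid\<close>

text \<open>Bimodule maps \<open>\<L> \<otimes>\<^bsub>B\<^sup>e\<^esub> \<L> \<rightarrow> B\<close>, as balanced biadditive maps; only the values on
  the carrier matter.\<close>

definition bimodule_forms :: "('k, 'b::{ring, monoid_mult}, 'l) bialgebroid \<Rightarrow> ('l \<Rightarrow> 'l \<Rightarrow> 'b) set"
  where
  "bimodule_forms L = {f. \<forall>U \<in> carrier L. \<forall>V \<in> carrier L.
    (\<forall>U' \<in> carrier L. f (U \<oplus>\<^bsub>L\<^esub> U') V = f U V + f U' V) \<and>
    (\<forall>V' \<in> carrier L. f U (V \<oplus>\<^bsub>L\<^esub> V') = f U V + f U V') \<and>
    (\<forall>b c. f (U \<otimes>\<^bsub>L\<^esub> (src L b \<otimes>\<^bsub>L\<^esub> tgt L c)) V = f U ((src L b \<otimes>\<^bsub>L\<^esub> tgt L c) \<otimes>\<^bsub>L\<^esub> V)) \<and>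
    (\<forall>b c. f (src L b \<otimes>\<^bsub>L\<^esub> tgt L c \<otimes>\<^bsub>L\<^esub> U) V = b * f U V * c)}"

definition convolution ::
  "('k, 'b::{ring, monoid_mult}, 'l) bialgebroid \<Rightarrow> ('l \<Rightarrow> 'l \<Rightarrow> 'b) \<Rightarrow> ('l \<Rightarrow> 'l \<Rightarrow> 'b) \<Rightarrow>
    'l \<Rightarrow> 'l \<Rightarrow> 'b" where
  "convolution L f g U V =
    (\<Sum>(U1, U2)\<leftarrow>comult L U. \<Sum>(V1, V2)\<leftarrow>comult L V. f U1 V1 * g U2 V2)"

definition is_conv_inverse ::
  "('k, 'b::{ring, monoid_mult}, 'l) bialgebroid \<Rightarrow> ('l \<Rightarrow> 'l \<Rightarrow> 'b) \<Rightarrow> ('l \<Rightarrow> 'l \<Rightarrow> 'b) \<Rightarrow> bool"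
  where
  "is_conv_inverse L f g \<longleftrightarrow> f \<in> bimodule_forms L \<and> g \<in> bimodule_forms L \<and>
    (\<forall>U \<in> carrier L. \<forall>V \<in> carrier L.
      convolution L f g U V = counit L (U \<otimes>\<^bsub>L\<^esub> V) \<and>
      convolution L g f U V = counit L (U \<otimes>\<^bsub>L\<^esub> V))"

definition conv_invertible ::
  "('k, 'b::{ring, monoid_mult}, 'l) bialgebroid \<Rightarrow> ('l \<Rightarrow> 'l \<Rightarrow> 'b) \<Rightarrow> bool" where
  "conv_invertible L f \<longleftrightarrow> (\<exists>g. is_conv_inverse L f g)"

text \<open>On the carrier the convolution inverse is unique.\<close>

definition conv_inverse ::
  "('k, 'b::{ring, monoid_mult}, 'l) bialgebroid \<Rightarrow> ('l \<Rightarrow> 'l \<Rightarrow> 'b) \<Rightarrow> 'l \<Rightarrow> 'l \<Rightarrow> 'b" where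
  "conv_inverse L f = (SOME g. is_conv_inverse L f g)"

definition normalised_left_2cocycle ::
  "('k, 'b::{ring, monoid_mult}, 'l) bialgebroid \<Rightarrow> ('l \<Rightarrow> 'l \<Rightarrow> 'b) \<Rightarrow> bool" where
  "normalised_left_2cocycle L \<zeta> \<longleftrightarrow> conv_invertible L \<zeta> \<and>
    (\<forall>U \<in> carrier L. \<forall>V \<in> carrier L. \<forall>W \<in> carrier L.
      \<zeta> U (lsum L [src L (\<zeta> V1 W1) \<otimes>\<^bsub>L\<^esub> V2 \<otimes>\<^bsub>L\<^esub> W2. (V1, V2) \<leftarrow> comult L V, (W1, W2) \<leftarrow> comult L W])
      = \<zeta> (lsum L [src L (\<zeta> U1 V1) \<otimes>\<^bsub>L\<^esub> U2 \<otimes>\<^bsub>L\<^esub> V2. (U1, U2) \<leftarrow> comult L U, (V1, V2) \<leftarrow> comult L V]) W) \<and>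
    (\<forall>U \<in> carrier L. \<zeta> \<one>\<^bsub>L\<^esub> U = counit L U \<and> \<zeta> U \<one>\<^bsub>L\<^esub> = counit L U)"

definition normalised_right_2cocycle ::
  "('k, 'b::{ring, monoid_mult}, 'l) bialgebroid \<Rightarrow> ('l \<Rightarrow> 'l \<Rightarrow> 'b) \<Rightarrow> bool" where
  "normalised_right_2cocycle L \<xi> \<longleftrightarrow> conv_invertible L \<xi> \<and>
    (\<forall>U \<in> carrier L. \<forall>V \<in> carrier L. \<forall>W \<in> carrier L.
      \<xi> U (lsum L [tgt L (\<xi> V2 W2) \<otimes>\<^bsub>L\<^esub> V1 \<otimes>\<^bsub>L\<^esub> W1. (V1, V2) \<leftarrow> comult L V, (W1, W2) \<leftarrow> comult L W])
      = \<xi> (lsum L [tgt L (\<xi> U2 V2) \<otimes>\<^bsub>L\<^esub> U1 \<otimes>\<^bsub>L\<^esub> V1. (U1, U2) \<leftarrow> comult L U, (V1, V2) \<leftarrow> comult L V]) W) \<and>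
    (\<forall>U \<in> carrier L. \<xi> \<one>\<^bsub>L\<^esub> U = counit L U \<and> \<xi> U \<one>\<^bsub>L\<^esub> = counit L U)"

definition invertible_normalised_2cocycle ::
  "('k::field \<Rightarrow> 'b::{ring, monoid_mult} \<Rightarrow> 'b) \<Rightarrow> ('k, 'b, 'l) bialgebroid \<Rightarrow>
    ('l \<Rightarrow> 'l \<Rightarrow> 'b) \<Rightarrow> bool" where
  "invertible_normalised_2cocycle sB L \<zeta> \<longleftrightarrow> left_bialgebroid sB L \<and>
    normalised_left_2cocycle L \<zeta> \<and> normalised_right_2cocycle L (conv_inverse L \<zeta>)"

definition cocycle_twist ::
  "('k, 'b::{ring, monoid_mult}, 'l) bialgebroid \<Rightarrow> ('l \<Rightarrow> 'l \<Rightarrow> 'b) \<Rightarrow> ('k, 'b, 'l) bialgebroid"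
  where
  "cocycle_twist L \<zeta> = L \<lparr> monoid.mult := \<lambda>U V.
    lsum L [src L (\<zeta> U1 V1) \<otimes>\<^bsub>L\<^esub> tgt L (conv_inverse L \<zeta> U3 V3) \<otimes>\<^bsub>L\<^esub> U2 \<otimes>\<^bsub>L\<^esub> V2.
      (U1, U2, U3) \<leftarrow> comult3 (comult L) U, (V1, V2, V3) \<leftarrow> comult3 (comult L) V] \<rparr>"


section \<open>The bialgebroids \<open>B\<^sup>e #\<^sub>\<sigma> H\<close> and \<open>B\<^sup>e # H\<close>\<close>

text \<open>Elements of \<open>B\<^sup>e \<otimes> H = B \<otimes> B \<otimes> H\<close> are the classes of formal sums of triples. All maps
  on it are given by multilinear formulas on elementary tensors \<open>b \<otimes> b' # h\<close>, extended additively
  and evaluated on a chosen representative of the class; by multilinearity the choice is immaterial.\<close>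

definition tens_class ::
  "('k, 'h::ab_group_add) hopf \<Rightarrow> ('k \<Rightarrow> 'b::ab_group_add \<Rightarrow> 'b) \<Rightarrow> ('b \<times> 'b \<times> 'h) list \<Rightarrow>
    ('b \<times> 'b \<times> 'h) list set" where
  "tens_class H sB xs = {ys. fsum_cong (ktens3_rel sB sB (hscale H)) xs ys}"

definition rep :: "'x set \<Rightarrow> 'x" where
  "rep U = (SOME x. x \<in> U)"

definition Be_cross_mult ::
  "('k, 'h::{ring, monoid_mult}) hopf \<Rightarrow> ('h \<Rightarrow> 'b::{ring, monoid_mult} \<Rightarrow> 'b) \<Rightarrow>
    ('h \<Rightarrow> 'h \<Rightarrow> 'b) \<Rightarrow> 'b \<times> 'b \<times> 'h \<Rightarrow> 'b \<times> 'b \<times> 'h \<Rightarrow> ('b \<times> 'b \<times> 'h) list" where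
  "Be_cross_mult H act \<sigma> = (\<lambda>(b, b', h) (c, c', g).
    [(b * act h1 c * \<sigma> h2 g1,
      c' * act (antipode H g4) b' * \<sigma> (antipode H g3) (antipode H h4),
      h3 * g2).
     (h1, h2, h3, h4) \<leftarrow> comult4 (hcomult H) h, (g1, g2, g3, g4) \<leftarrow> comult4 (hcomult H) g])"

definition Be_cross ::
  "('k, 'h::{ring, monoid_mult}) hopf \<Rightarrow> ('k \<Rightarrow> 'b::{ring, monoid_mult} \<Rightarrow> 'b) \<Rightarrow>
    ('h \<Rightarrow> 'b \<Rightarrow> 'b) \<Rightarrow> ('h \<Rightarrow> 'h \<Rightarrow> 'b) \<Rightarrow> ('h \<Rightarrow> 'h \<Rightarrow> 'b) \<Rightarrow>
    ('k, 'b, ('b \<times> 'b \<times> 'h) list set) bialgebroid" where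
  "Be_cross H sB act \<sigma> \<sigma>i =
    \<lparr> carrier = range (tens_class H sB),
      monoid.mult = (\<lambda>U V. tens_class H sB
        (concat [Be_cross_mult H act \<sigma> x y. x \<leftarrow> rep U, y \<leftarrow> rep V])),
      one = tens_class H sB [(1, 1, 1)],
      zero = tens_class H sB [],
      add = (\<lambda>U V. tens_class H sB (rep U @ rep V)),
      module.smult = (\<lambda>r U. tens_class H sB [(sB r b, b', h). (b, b', h) \<leftarrow> rep U]),
      src = (\<lambda>b. tens_class H sB [(b, 1, 1)]),
      tgt = (\<lambda>b. tens_class H sB [(1, b, 1)]),
      comult = (\<lambda>U.
        [(tens_class H sB [(b, \<sigma>i (antipode H h2) h3, h1)], tens_class H sB [(1, b', h4)]).
         (b, b', h) \<leftarrow> rep U, (h1, h2, h3, h4) \<leftarrow> comult4 (hcomult H) h]),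
      counit = (\<lambda>U. \<Sum>(b, b', h)\<leftarrow>rep U. \<Sum>(h1, h2, h3)\<leftarrow>comult3 (hcomult H) h.
        b * act h1 b' * \<sigma> h2 (antipode H h3)) \<rparr>"

definition Be_smash ::
  "('k::field, 'h::{ring, monoid_mult}) hopf \<Rightarrow> ('k \<Rightarrow> 'b::{ring, monoid_mult} \<Rightarrow> 'b) \<Rightarrow>
    ('h \<Rightarrow> 'b \<Rightarrow> 'b) \<Rightarrow> ('k, 'b, ('b \<times> 'b \<times> 'h) list set) bialgebroid" where
  "Be_smash H sB act = Be_cross H sB act (trivial_cocycle H sB) (trivial_cocycle H sB)"

definition sigma_tilde ::
  "('k, 'h::{ring, monoid_mult}) hopf \<Rightarrow> ('h \<Rightarrow> 'b::{ring, monoid_mult} \<Rightarrow> 'b) \<Rightarrow>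
    ('h \<Rightarrow> 'h \<Rightarrow> 'b) \<Rightarrow> ('b \<times> 'b \<times> 'h) list set \<Rightarrow> ('b \<times> 'b \<times> 'h) list set \<Rightarrow> 'b" where
  "sigma_tilde H act \<sigma> U V =
    (\<Sum>(b, b', h)\<leftarrow>rep U. \<Sum>(c, c', g)\<leftarrow>rep V.
     \<Sum>(h1, h2, h3, h4)\<leftarrow>comult4 (hcomult H) h. \<Sum>(g1, g2)\<leftarrow>hcomult H g.
       b * act h1 c * \<sigma> h2 g1 * act (h3 * g2) c' * act h4 b')"

definition phi_map ::
  "('k, 'h::{ring, monoid_mult}) hopf \<Rightarrow> ('k \<Rightarrow> 'b::{ring, monoid_mult} \<Rightarrow> 'b) \<Rightarrow>
    ('h \<Rightarrow> 'h \<Rightarrow> 'b) \<Rightarrow> ('b \<times> 'b \<times> 'h) list set \<Rightarrow> ('b \<times> 'b \<times> 'h) list set" where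
  "phi_map H sB \<sigma>i U = tens_class H sB
    [(b, b' * \<sigma>i (antipode H h2) h3, h1).
     (b, b', h) \<leftarrow> rep U, (h1, h2, h3) \<leftarrow> comult3 (hcomult H) h]"

end

theory Submission
  imports Defs "HOL-Library.Function_Algebras"
begin

text \<open>
  In the coordinates \<open>E b h x = s(b) t(x) E 1 h 1\<close> on \<open>B \<otimes> H \<otimes> B\<close> the structure of
  \<open>B\<^sup>e #\<^sub>\<sigma> H\<close> does not involve the antipode:
  \<open>E b h x \<cdot> E c g y = E (b (h\<^sub>1 \<triangleright> c) \<sigma>(h\<^sub>2, g\<^sub>1)) (h\<^sub>3 g\<^sub>2) (\<sigma>\<^sup>-\<^sup>1(h\<^sub>4, g\<^sub>3) (h\<^sub>5 \<triangleright> y) x)\<close>,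
  \<open>\<Delta>(E b h x) = E b h\<^sub>1 1 \<otimes> E 1 h\<^sub>2 x\<close> and \<open>\<epsilon>(E b h x) = \<epsilon>(h) b x\<close>, where
  \<open>E b h x = b \<otimes> \<sigma>\<^sup>-\<^sup>1(S(h\<^sub>3), h\<^sub>4) (S(h\<^sub>2) \<triangleright> x) #\<^sub>\<sigma> h\<^sub>1\<close>. The bialgebroid axioms follow from two
  identities, one for each outer factor, which are the cocycle conditions for \<open>\<sigma>\<close> and for
  \<open>\<sigma>\<^sup>-\<^sup>1\<close> combined with the fact that \<open>\<sigma>\<close> commutes with values of the action up to the
  order of Sweedler legs.
  In the coordinates of \<open>B\<^sup>e # H\<close>, where \<open>\<sigma>\<close> is trivial, the form of the theorem is
  \<open>(E b h x, E c g y) \<mapsto> b (h\<^sub>1 \<triangleright> c) \<sigma>(h\<^sub>2, g) (h\<^sub>3 \<triangleright> y) x\<close>. The same two identities say that it is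
  a left 2-cocycle and its inverse a right one, twisting by it turns the product for the trivial
  cocycle into the one for \<open>\<sigma>\<close>, and \<open>\<phi>\<close> matches the two systems of coordinates.
  Equations in tensor products are tested on \<open>k\<close>-linear functionals, so that all Sweedler
  computations take place in \<open>k\<close> or \<open>B\<close>.
\<close>

section \<open>Linear functionals\<close>

text \<open>B^e # H is the case of the trivial cocycle, so both bialgebroids are instances of one
  locale \<open>presented\<close>, which records how the structure maps look on E b h x. These
  formulas determine a bialgebroid up to isomorphism; it then suffices that the twist of B^e # H
  obeys the formulas of \<sigma> and that \<phi> sends coordinates to coordinates. Bijectivity of
  the coordinates is expressed without a type for B \<otimes> H \<otimes> B: \<open>E_span\<close>
  is surjectivity and \<open>E_lift\<close> is injectivity. In the concrete model both rest on
  \<open>mu\<close> and \<open>nu\<close> being inverse to each other, and the antipode is confined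
  to that model.

  The obstacle is that coproducts are lists and elements are classes with a chosen representative.
  Neither choice need be additive, so identities between lists are out of reach, while multilinear
  functions of them do not depend on the choices. Hence structure maps are met only under
  functionals. Moreover the congruence of formal sums is one of commutative monoids; before
  functionals can separate its classes, the vector space structure has to be recovered from scalars
  acting on the generators.\<close>

abbreviation lin :: "('k::field \<Rightarrow> 'a::ab_group_add \<Rightarrow> 'a) \<Rightarrow> ('k \<Rightarrow> 'c::ab_group_add \<Rightarrow> 'c) \<Rightarrow>
    ('a \<Rightarrow> 'c) \<Rightarrow> bool" where
  "lin \<equiv> Vector_Spaces.linear"

abbreviation kmul :: "'k::field \<Rightarrow> 'k \<Rightarrow> 'k" where
  "kmul \<equiv> (*)"

text \<open>A maximal independent subset of G stays independent when v is adjoined, and a functional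
  may be prescribed freely on an independent set.\<close>

lemma functional_separates_span:
  fixes s :: "'k::field \<Rightarrow> 'a::ab_group_add \<Rightarrow> 'a"
  assumes "vector_space s" and v: "v \<notin> module.span s G"
  obtains f where "lin s (*) f" "\<And>g. g \<in> G \<Longrightarrow> f g = 0" "f v = 1"
proof -
  interpret V: vector_space s by fact
  interpret VP: vector_space_pair s "(*) :: 'k \<Rightarrow> 'k \<Rightarrow> 'k"
    by unfold_locales (auto simp: algebra_simps)
  obtain B where B: "B \<subseteq> G" "V.independent B" "G \<subseteq> V.span B"
    by (rule V.maximal_independent_subset)
  have vB: "v \<notin> V.span B"
    using v V.span_mono[OF B(1)] by blast
  then have "V.independent (insert v B)"
    by (rule V.independent_insertI) (rule B(2))
  from VP.linear_independent_extend[OF this, of "\<lambda>x. if x = v then 1 else 0"]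
  obtain f where f: "lin s (*) f" "\<forall>x\<in>insert v B. f x = (if x = v then 1 else 0)" by blast
  interpret f: Vector_Spaces.linear s "(*)" f by fact
  have "f g = 0" if "g \<in> V.span B" for g
    using that
  proof (rule V.span_induct)
    show "V.subspace {x. f x = 0}"
      by (auto simp: V.subspace_def f.add f.scale)
    fix x assume "x \<in> B"
    with f(2) vB show "f x = 0" by (auto simp: V.span_base)
  qed
  with B(3) f show thesis by (intro that[of f]) auto
qed

text \<open>The case of the zero subspace. It transfers identities proved for k-valued maps to maps
  into an arbitrary vector space.\<close>

lemma functional_ext:
  fixes s :: "'k::field \<Rightarrow> 'a::ab_group_add \<Rightarrow> 'a"
  assumes "vector_space s" and eq: "\<And>f. lin s (*) f \<Longrightarrow> f x = f y"
  shows "x = y"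
proof (rule ccontr)
  interpret V: vector_space s by fact
  assume "x \<noteq> y"
  then have "x - y \<notin> V.span {}" by simp
  from functional_separates_span[OF assms(1) this]
  obtain f where f: "lin s (*) f" "f (x - y) = 1" by blast
  interpret f: Vector_Spaces.linear s "(*)" f by fact
  show False using eq[OF f(1)] f(2) by (simp add: f.diff)
qed

declare fsum_cong.trans [trans]

section \<open>Formal sums are separated by functionals\<close>

text \<open>The easy half of the separation: summation in a commutative monoid respects every
  closure rule of the congruence, so only the generators have to be checked.\<close>

lemma fsum_cong_sum_list:
  fixes F :: "'x \<Rightarrow> 'a::comm_monoid_add"
  assumes "fsum_cong R xs ys"
    and "\<And>xs ys. R xs ys \<Longrightarrow> (\<Sum>x\<leftarrow>xs. F x) = (\<Sum>x\<leftarrow>ys. F x)"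
  shows "(\<Sum>x\<leftarrow>xs. F x) = (\<Sum>x\<leftarrow>ys. F x)"
  using assms(1) by induction (auto simp: assms(2) add.commute)

lemma fsum_cong_append:
  assumes "fsum_cong R xs xs'" "fsum_cong R ys ys'"
  shows "fsum_cong R (xs @ ys) (xs' @ ys')"
proof -
  have "fsum_cong R (xs @ ys) (ys @ xs)" by (rule fsum_cong.comm)
  also have "fsum_cong R (ys @ xs) (ys @ xs')"
    by (rule fsum_cong.append) fact
  also have "fsum_cong R (ys @ xs') (xs' @ ys)" by (rule fsum_cong.comm)
  also have "fsum_cong R (xs' @ ys) (xs' @ ys')"
    by (rule fsum_cong.append) fact
  finally show ?thesis .
qed

lemma fsum_cong_interchange:
  "fsum_cong R ((a @ b) @ (c @ d)) ((a @ c) @ (b @ d))"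
proof -
  have "fsum_cong R (b @ c @ d) (c @ b @ d)"
    using fsum_cong_append[OF fsum_cong.comm[of R b c] fsum_cong.refl[of R d]] by simp
  from fsum_cong.append[OF this, of a] show ?thesis by simp
qed

text \<open>The congruence knows only the laws of a commutative monoid. An action of k on the
  generators that is compatible with it makes the quotient over A a vector space. In the tensor
  products below, k acts on the first factor.\<close>

locale scaled_fsum =
  fixes R :: "'x list \<Rightarrow> 'x list \<Rightarrow> bool" and A :: "'x set" and sc :: "'k::field \<Rightarrow> 'x \<Rightarrow> 'x"
  assumes R_closed: "R xs ys \<Longrightarrow> set xs \<subseteq> A \<and> set ys \<subseteq> A"
    and sc_closed: "x \<in> A \<Longrightarrow> sc r x \<in> A"
    and sc_add: "x \<in> A \<Longrightarrow> fsum_cong R [sc (r + r') x] [sc r x, sc r' x]"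
    and sc_zero: "x \<in> A \<Longrightarrow> fsum_cong R [sc 0 x] []"
    and sc_one: "x \<in> A \<Longrightarrow> fsum_cong R [sc 1 x] [x]"
    and sc_sc: "x \<in> A \<Longrightarrow> fsum_cong R [sc r (sc r' x)] [sc (r * r') x]"
    and sc_R: "R xs ys \<Longrightarrow> fsum_cong R (map (sc r) xs) (map (sc r) ys)"
begin

lemma sc_cong: "fsum_cong R xs ys \<Longrightarrow> fsum_cong R (map (sc r) xs) (map (sc r) ys)"
  by (induction rule: fsum_cong.induct)
    (auto intro: sc_R fsum_cong.refl fsum_cong.sym fsum_cong.trans fsum_cong.comm fsum_cong.append)

text \<open>The functions \<open>w\<close> all of whose formal sums vanish form a subspace which contains the
  relations. Hence a formal sum that does not vanish is detected by a functional which kills the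
  relations.\<close>

definition comb :: "('x \<Rightarrow> 'k) \<Rightarrow> 'x list \<Rightarrow> 'x list" where
  "comb w is = map (\<lambda>x. sc (w x) x) is"

text \<open>Quantifying over every enumeration of a superset of the support leaves the freedom to
  pass to a common enumeration of several supports.\<close>

definition null :: "('x \<Rightarrow> 'k) \<Rightarrow> bool" where
  "null w \<longleftrightarrow> finite {x. w x \<noteq> 0} \<and> {x. w x \<noteq> 0} \<subseteq> A \<and>
    (\<forall>is. distinct is \<longrightarrow> set is \<subseteq> A \<longrightarrow> {x. w x \<noteq> 0} \<subseteq> set is \<longrightarrow> fsum_cong R (comb w is) [])"

lemma comb_add:
  "set is \<subseteq> A \<Longrightarrow> fsum_cong R (comb (\<lambda>x. w x + w' x) is) (comb w is @ comb w' is)"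
proof (induction "is")
  case (Cons x xs)
  have "fsum_cong R ([sc (w x + w' x) x] @ comb (\<lambda>x. w x + w' x) xs)
      (([sc (w x) x] @ [sc (w' x) x]) @ (comb w xs @ comb w' xs))"
    using Cons by (intro fsum_cong_append) (auto simp: sc_add)
  from fsum_cong.trans[OF this fsum_cong_interchange] show ?case
    by (simp add: comb_def)
qed (simp add: comb_def fsum_cong.refl)

lemma comb_scale:
  "set is \<subseteq> A \<Longrightarrow> fsum_cong R (comb (\<lambda>x. r * w x) is) (map (sc r) (comb w is))"
proof (induction "is")
  case (Cons x xs)
  have "fsum_cong R ([sc (r * w x) x] @ comb (\<lambda>x. r * w x) xs)
      ([sc r (sc (w x) x)] @ map (sc r) (comb w xs))"
    using Cons by (intro fsum_cong_append) (auto intro: sc_sc fsum_cong.sym)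
  then show ?case by (simp add: comb_def)
qed (simp add: comb_def fsum_cong.refl)

lemma comb_zero: "set is \<subseteq> A \<Longrightarrow> (\<And>x. x \<in> set is \<Longrightarrow> w x = 0) \<Longrightarrow> fsum_cong R (comb w is) []"
proof (induction "is")
  case (Cons x xs)
  have "fsum_cong R ([sc (w x) x] @ comb w xs) ([] @ [])"
    using Cons sc_zero[of x] by (intro fsum_cong_append) auto
  then show ?case by (simp add: comb_def)
qed (simp add: comb_def fsum_cong.refl)

lemma comb_delta:
  assumes "distinct is" "set is \<subseteq> A" "x \<in> set is"
  shows "fsum_cong R (comb (\<lambda>y. if y = x then r else 0) is) [sc r x]"
  using assms
proof (induction "is")
  case (Cons y ys)
  show ?case
  proof (cases "y = x")
    case True
    have "fsum_cong R ([sc r x] @ comb (\<lambda>y. if y = x then r else 0) ys) ([sc r x] @ [])"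
      using Cons True by (intro fsum_cong_append fsum_cong.refl comb_zero) auto
    then show ?thesis using True by (simp add: comb_def)
  next
    case False
    have "fsum_cong R ([sc 0 y] @ comb (\<lambda>y. if y = x then r else 0) ys) ([] @ [sc r x])"
      using Cons False by (intro fsum_cong_append) (auto simp: sc_zero)
    then show ?thesis using False by (simp add: comb_def)
  qed
qed simp

definition point :: "'x \<Rightarrow> 'x \<Rightarrow> 'k" where
  "point x = (\<lambda>y. if y = x then 1 else 0)"

text \<open>The image of a formal sum in the free vector space on the generators. Multiplicities
  become scalars and may vanish in positive characteristic; \<open>comb_points\<close> shows that
  the class can still be recovered.\<close>

definition points :: "'x list \<Rightarrow> 'x \<Rightarrow> 'k" where
  "points xs = (\<Sum>x\<leftarrow>xs. point x)"

lemma comb_points: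
  assumes "distinct is" "set is \<subseteq> A" "set xs \<subseteq> set is"
  shows "fsum_cong R (comb (points xs) is) xs"
  using assms(3)
proof (induction xs)
  case Nil
  show ?case unfolding points_def by (rule comb_zero) (use assms in auto)
next
  case (Cons x xs)
  have "points (x # xs) = (\<lambda>y. (if y = x then 1 else 0) + points xs y)"
    by (auto simp: points_def point_def)
  then have "fsum_cong R (comb (points (x # xs)) is)
      (comb (\<lambda>y. if y = x then 1 else 0) is @ comb (points xs) is)"
    by (simp only: comb_add[OF assms(2)])
  also have "fsum_cong R (comb (\<lambda>y. if y = x then 1 else 0) is @ comb (points xs) is) ([x] @ xs)"
    using assms Cons
    by (intro fsum_cong_append fsum_cong.trans[OF comb_delta sc_one]) auto
  finally show ?case by simp
qed

lemma points_outside: "y \<notin> set xs \<Longrightarrow> points xs y = 0"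
  by (induction xs) (auto simp: points_def point_def)

lemma points_diff_nonzero: "{y. (points xs - points ys) y \<noteq> 0} \<subseteq> set xs \<union> set ys"
  using points_outside by fastforce

lemma null_add: "null w \<Longrightarrow> null w' \<Longrightarrow> null (w + w')"
proof -
  assume w: "null w" "null w'"
  have sub: "{x. (w + w') x \<noteq> 0} \<subseteq> {x. w x \<noteq> 0} \<union> {x. w' x \<noteq> 0}" by auto
  have "fsum_cong R (comb (w + w') is) []"
    if "is": "distinct is" "set is \<subseteq> A" "{x. (w + w') x \<noteq> 0} \<subseteq> set is" for "is"
  proof -
    \<comment> \<open>\<open>is\<close> covers only the support of w + w'. Cancellation can leave
      support points of w and w' outside it; they are adjoined, with coefficient zero in the
      sum.\<close>
    obtain js where js: "distinct js" "set js = ({x. w x \<noteq> 0} \<union> {x. w' x \<noteq> 0}) - set is"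
      using w finite_distinct_list[of "({x. w x \<noteq> 0} \<union> {x. w' x \<noteq> 0}) - set is"]
      unfolding null_def by auto
    let ?ks = "is @ js"
    have ks: "distinct ?ks" "set ?ks \<subseteq> A" "{x. w x \<noteq> 0} \<subseteq> set ?ks" "{x. w' x \<noteq> 0} \<subseteq> set ?ks"
      using "is" js w by (auto simp: null_def)
    have "fsum_cong R (comb (w + w') is @ []) (comb (w + w') is @ comb (w + w') js)"
      by (intro fsum_cong_append fsum_cong.refl fsum_cong.sym[OF comb_zero])
        (use js ks that in auto)
    also have "fsum_cong R \<dots> (comb w ?ks @ comb w' ?ks)"
      using comb_add[OF ks(2), of w w'] by (simp add: comb_def)
    also have "fsum_cong R \<dots> ([] @ [])"
      using w ks unfolding null_def by (intro fsum_cong_append) auto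
    finally show ?thesis by simp
  qed
  with w sub show "null (w + w')"
    unfolding null_def using finite_subset[OF sub] by (auto simp: subset_iff)
qed

lemma null_scale: "null w \<Longrightarrow> null (\<lambda>x. r * w x)"
proof -
  assume w: "null w"
  have "fsum_cong R (comb (\<lambda>x. r * w x) is) []"
    if "is": "distinct is" "set is \<subseteq> A" "{x. r * w x \<noteq> 0} \<subseteq> set is" for "is"
  proof (cases "r = 0")
    case True
    then show ?thesis using "is" by (intro comb_zero) auto
  next
    case False
    have "fsum_cong R (comb w is) []"
      using w "is" False unfolding null_def by auto
    from fsum_cong.trans[OF comb_scale[OF "is"(2)] sc_cong[OF this]] show ?thesis by simp
  qed
  moreover have "{x. r * w x \<noteq> 0} \<subseteq> {x. w x \<noteq> 0}" by auto
  ultimately show ?thesis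
    using w finite_subset unfolding null_def by blast
qed

lemma null_zero: "null 0"
  unfolding null_def by (auto intro!: comb_zero)

lemma comb_diff_null:
  assumes "set xs \<subseteq> A" "distinct is" "set is \<subseteq> A" "set xs \<subseteq> set is" "set ys \<subseteq> set is"
  shows "fsum_cong R (comb (points xs - points ys) is @ ys) xs"
proof -
  have "fsum_cong R (comb (points xs - points ys) is @ ys)
      (comb (points xs - points ys) is @ comb (points ys) is)"
    using assms by (intro fsum_cong.append fsum_cong.sym[OF comb_points])
  also have "fsum_cong R \<dots> (comb (points xs) is)"
    using fsum_cong.sym[OF comb_add[OF assms(3), of "points xs - points ys" "points ys"]] by simp
  also have "fsum_cong R \<dots> xs" using assms by (intro comb_points)
  finally show ?thesis .
qed

text \<open>Inverses are not built into the congruence; they come from the scalars by 1 + (-1) = 0.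
  Cancellation follows.\<close>

lemma fsum_cong_negatives:
  assumes "set xs \<subseteq> A"
  shows "fsum_cong R (xs @ map (sc (-1)) xs) []"
  using assms
proof (induction xs)
  case (Cons x xs)
  have x: "fsum_cong R ([x] @ [sc (-1) x]) []"
  proof -
    have "fsum_cong R ([x] @ [sc (-1) x]) ([sc 1 x] @ [sc (-1) x])"
      using Cons by (intro fsum_cong_append fsum_cong.refl fsum_cong.sym[OF sc_one]) auto
    also have "fsum_cong R \<dots> [sc (1 + -1) x]"
      using Cons fsum_cong.sym[OF sc_add[of x 1 "-1"]] by simp
    also have "fsum_cong R \<dots> []" using Cons sc_zero[of x] by simp
    finally show ?thesis .
  qed
  have "fsum_cong R (([x] @ xs) @ ([sc (-1) x] @ map (sc (-1)) xs))
      (([x] @ [sc (-1) x]) @ (xs @ map (sc (-1)) xs))"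
    by (rule fsum_cong_interchange)
  also have "fsum_cong R \<dots> ([] @ [])"
    using Cons by (intro fsum_cong_append x) auto
  finally show ?case by simp
qed (simp add: fsum_cong.refl)

lemma fsum_cong_cancel:
  assumes "fsum_cong R (xs @ zs) (ys @ zs)" "set zs \<subseteq> A"
  shows "fsum_cong R xs ys"
proof -
  have *: "fsum_cong R (us @ zs @ map (sc (-1)) zs) us" for us
    using fsum_cong.append[OF fsum_cong_negatives[OF assms(2)], of us] by simp
  have "fsum_cong R (xs @ zs @ map (sc (-1)) zs) (ys @ zs @ map (sc (-1)) zs)"
    using fsum_cong_append[OF assms(1) fsum_cong.refl] by simp
  then show ?thesis
    by (rule fsum_cong.trans[OF fsum_cong.sym[OF *] fsum_cong.trans[OF _ *]])
qed

text \<open>A test function F is the restriction to generators of a linear functional on the free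
  vector space that kills \<open>?G\<close>. If all of them agree on xs and ys, the difference of
  \<open>points\<close> lies in the span of \<open>?G\<close>. Since \<open>null\<close> is a
  subspace containing \<open>?G\<close>, this membership turns into a congruence.\<close>

theorem fsum_cong_by_functionals:
  assumes sub: "set xs \<subseteq> A" "set ys \<subseteq> A"
    and test: "\<And>F :: 'x \<Rightarrow> 'k. (\<And>r x. x \<in> A \<Longrightarrow> F (sc r x) = r * F x) \<Longrightarrow>
      (\<And>xs ys. R xs ys \<Longrightarrow> (\<Sum>x\<leftarrow>xs. F x) = (\<Sum>x\<leftarrow>ys. F x)) \<Longrightarrow>
      (\<Sum>x\<leftarrow>xs. F x) = (\<Sum>x\<leftarrow>ys. F x)"
  shows "fsum_cong R xs ys"
proof -
  let ?s = "\<lambda>(r::'k) (w::'x \<Rightarrow> 'k) x. r * w x"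
  interpret W: vector_space ?s
    by unfold_locales (auto simp: fun_eq_iff algebra_simps)
  let ?G = "{points xs - points ys |xs ys. R xs ys} \<union>
    {point (sc r x) - ?s r (point x) |r x. x \<in> A}"
  have "points xs - points ys \<in> W.span ?G"
  proof (rule ccontr)
    assume "points xs - points ys \<notin> W.span ?G"
    from functional_separates_span[OF W.vector_space_axioms this] obtain f where
      f: "lin ?s (*) f" "\<And>g. g \<in> ?G \<Longrightarrow> f g = 0" "f (points xs - points ys) = 1"
      by blast
    interpret f: Vector_Spaces.linear ?s "(*)" f by fact
    have f_points: "f (points zs) = (\<Sum>z\<leftarrow>zs. f (point z))" for zs
      unfolding points_def by (induction zs) (simp_all only: list.map sum_list.Nil sum_list.Cons
        f.zero f.add)
    have "(\<Sum>x\<leftarrow>xs. f (point x)) = (\<Sum>x\<leftarrow>ys. f (point x))"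
    proof (rule test)
      fix r x assume "x \<in> A"
      then have "f (point (sc r x) - ?s r (point x)) = 0" by (intro f(2)) auto
      then show "f (point (sc r x)) = r * f (point x)"
        using f.diff f.scale by (metis eq_iff_diff_eq_0)
    next
      fix xs ys assume "R xs ys"
      then have "f (points xs - points ys) = 0" by (intro f(2)) auto
      then show "(\<Sum>x\<leftarrow>xs. f (point x)) = (\<Sum>x\<leftarrow>ys. f (point x))"
        by (simp add: f.diff f_points)
    qed
    with f(3) show False by (simp add: f.diff f_points)
  qed
  then have "null (points xs - points ys)"
  proof (rule W.span_induct)
    show "W.subspace {w. null w}"
      by (auto simp: W.subspace_def null_zero null_add null_scale)
  next
    fix w assume "w \<in> ?G"
    then consider (rel) xs ys where "R xs ys" "w = points xs - points ys"
      | (scal) r x where "x \<in> A" "w = point (sc r x) - ?s r (point x)" by auto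
    then show "null w"
    proof cases
      case rel
      have sub: "set xs \<subseteq> A" "set ys \<subseteq> A" using R_closed[OF rel(1)] by auto
      have fin: "{y. w y \<noteq> 0} \<subseteq> set xs \<union> set ys"
        unfolding rel(2) by (rule points_diff_nonzero)
      have "fsum_cong R (comb w is) []"
        if "is": "distinct is" "set is \<subseteq> A" "{x. w x \<noteq> 0} \<subseteq> set is" for "is"
      proof -
        \<comment> \<open>Terms common to both sides of a relation can drop out of \<open>w\<close>.
          The missing generators are adjoined with coefficient zero, so that xs and ys lie inside
          the list.\<close>
        obtain js where js: "distinct js" "set js = (set xs \<union> set ys) - set is"
          using finite_distinct_list[of "(set xs \<union> set ys) - set is"] by auto
        have "fsum_cong R (comb w (is @ js) @ ys) xs"
          unfolding rel(2) by (rule comb_diff_null) (use js "is" sub in auto)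
        then have "fsum_cong R (comb w (is @ js) @ ys) ([] @ ys)"
          using fsum_cong.sym[OF fsum_cong.gen[of R xs ys]] rel(1)
          by (simp add: fsum_cong.trans[of R _ xs ys] fsum_cong.gen)
        then have 1: "fsum_cong R (comb w is @ comb w js) []"
          using fsum_cong_cancel sub(2) by (simp add: comb_def)
        have "fsum_cong R (comb w is @ []) (comb w is @ comb w js)"
          by (intro fsum_cong.append fsum_cong.sym[OF comb_zero]) (use js sub "is" in auto)
        from fsum_cong.trans[OF this 1] show ?thesis by simp
      qed
      then show ?thesis
        unfolding null_def using fin sub by (auto intro: finite_subset)
    next
      case scal
      have w: "w = (\<lambda>y. (if y = sc r x then 1 else 0) + (if y = x then - r else 0))"
        using scal by (auto simp: point_def)
      have fin: "{y. w y \<noteq> 0} \<subseteq> {x, sc r x}" by (auto simp: w)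
      have "fsum_cong R (comb w is) []"
        if "is": "distinct is" "set is \<subseteq> A" "{x. w x \<noteq> 0} \<subseteq> set is" for "is"
      proof -
        obtain js where js: "distinct js" "set js = {x, sc r x} - set is"
          using finite_distinct_list[of "{x, sc r x} - set is"] by auto
        let ?ks = "is @ js"
        have ks: "distinct ?ks" "set ?ks \<subseteq> A" "{x, sc r x} \<subseteq> set ?ks"
          using js "is" scal sc_closed by auto
        have "fsum_cong R (comb w ?ks) ([sc 1 (sc r x)] @ [sc (- r) x])"
          unfolding w using ks
          by (intro fsum_cong.trans[OF comb_add] fsum_cong_append comb_delta) auto
        also have "fsum_cong R \<dots> ([sc r x] @ [sc (- r) x])"
          using scal sc_closed by (intro fsum_cong_append fsum_cong.refl sc_one) auto
        also have "fsum_cong R \<dots> []"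
          using fsum_cong.trans[OF fsum_cong.sym[OF sc_add[of x r "-r"]]] sc_zero[of x] scal by simp
        finally have 1: "fsum_cong R (comb w is @ comb w js) []"
          by (simp add: comb_def)
        have "fsum_cong R (comb w is @ []) (comb w is @ comb w js)"
          by (intro fsum_cong.append fsum_cong.sym[OF comb_zero]) (use js ks "is" in auto)
        from fsum_cong.trans[OF this 1] show ?thesis by simp
      qed
      then show ?thesis
        unfolding null_def using fin scal sc_closed by (auto intro: finite_subset)
    qed
  qed
  moreover obtain "is" where "is": "distinct is" "set is = set xs \<union> set ys"
    using finite_distinct_list[of "set xs \<union> set ys"] by auto
  moreover have "{x. (points xs - points ys) x \<noteq> 0} \<subseteq> set xs \<union> set ys"
    by (rule points_diff_nonzero)
  ultimately have "fsum_cong R (comb (points xs - points ys) is) []"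
    using sub unfolding null_def by auto
  then have "fsum_cong R ys (comb (points xs - points ys) is @ ys)"
    using fsum_cong.sym[OF fsum_cong_append[OF _ fsum_cong.refl[of R ys]]] by fastforce
  also have "fsum_cong R \<dots> xs"
    using sub "is" by (intro comb_diff_null) auto
  finally show ?thesis by (rule fsum_cong.sym)
qed

end

section \<open>Sweedler calculus\<close>

lemma linD:
  assumes "lin s t f"
  shows "f (x + y) = f x + f y" "f (s r x) = t r (f x)" "f 0 = 0" "f (- x) = - f x"
    "f (x - y) = f x - f y"
proof -
  interpret f: Vector_Spaces.linear s t f by fact
  show "f (x + y) = f x + f y" "f (s r x) = t r (f x)" "f 0 = 0" "f (- x) = - f x"
    "f (x - y) = f x - f y"
    by (auto simp: f.add f.scale f.neg f.diff)
qed

lemma linI: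
  assumes "vector_space s" "vector_space t" "\<And>x y. f (x + y) = f x + f y"
    "\<And>r x. f (s r x) = t r (f x)"
  shows "lin s t f"
  using assms by (auto simp: Vector_Spaces.linear_iff)

lemma lin_vs: "lin s t f \<Longrightarrow> vector_space s" "lin s t f \<Longrightarrow> vector_space t"
  by (auto simp: Vector_Spaces.linear_iff)

lemma lin_id: "vector_space s \<Longrightarrow> lin s s (\<lambda>x. x)"
  by (rule linI) auto

lemma lin_comp: "lin t u f \<Longrightarrow> lin s t g \<Longrightarrow> lin s u (\<lambda>x. f (g x))"
  by (rule linI) (auto simp: linD lin_vs)

lemma lin_zero: "vector_space s \<Longrightarrow> vector_space t \<Longrightarrow> lin s t (\<lambda>x. 0)"
  by (rule linI) (auto simp: vector_space.vector_space_assms module.scale_zero_right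
    module_iff_vector_space[symmetric])

lemma lin_plus: "lin s t f \<Longrightarrow> lin s t g \<Longrightarrow> lin s t (\<lambda>x. f x + g x)"
  by (rule linI) (auto simp: linD lin_vs vector_space.vector_space_assms algebra_simps)

lemma lin_sum_list:
  assumes "vector_space s" "vector_space t" "\<And>a. a \<in> set xs \<Longrightarrow> lin s t (\<lambda>x. K x a)"
  shows "lin s t (\<lambda>x. \<Sum>a\<leftarrow>xs. K x a)"
  using assms(3) by (induction xs) (auto intro: lin_plus lin_zero assms(1,2))

lemma lin_apply_sum_list: "lin s t f \<Longrightarrow> f (\<Sum>a\<leftarrow>xs. g a) = (\<Sum>a\<leftarrow>xs. f (g a))"
  by (induction xs) (auto simp: linD)

lemma vs_kmul: "vector_space (kmul :: 'k::field \<Rightarrow> 'k \<Rightarrow> 'k)"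
  by unfold_locales (auto simp: algebra_simps)

lemma lin_scale_right: "lin s t f \<Longrightarrow> lin s t (\<lambda>x. t c (f x))"
  by (rule linI) (auto simp: linD lin_vs vector_space.vector_space_assms
      algebra_simps)

lemma lin_scale_left: "lin s kmul f \<Longrightarrow> vector_space t \<Longrightarrow> lin s t (\<lambda>x. t (f x) v)"
  by (rule linI) (auto simp: linD lin_vs vector_space.vector_space_assms)

lemma lin_kmul:
  "lin s kmul f \<Longrightarrow> lin s kmul (\<lambda>x. c * f x)"
  "lin s kmul f \<Longrightarrow> lin s kmul (\<lambda>x. f x * c)"
  using lin_scale_right[of s kmul f c] lin_scale_left[of s f kmul c] by (auto simp: vs_kmul)

lemma bilinear_mapD:
  assumes "bilinear_map sa sb sc f"
  shows "lin s sa g \<Longrightarrow> lin s sc (\<lambda>x. f (g x) b)" "lin s sb g' \<Longrightarrow> lin s sc (\<lambda>x. f a (g' x))"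
  using assms lin_comp[of sa sc "\<lambda>a. f a b" s g] lin_comp[of sb sc "f a" s g']
  by (auto simp: bilinear_map_def)

definition trilinear_map ::
  "('k::field \<Rightarrow> 'a::ab_group_add \<Rightarrow> 'a) \<Rightarrow> ('k \<Rightarrow> 'b::ab_group_add \<Rightarrow> 'b) \<Rightarrow>
    ('k \<Rightarrow> 'c::ab_group_add \<Rightarrow> 'c) \<Rightarrow> ('k \<Rightarrow> 'd::ab_group_add \<Rightarrow> 'd) \<Rightarrow> ('a \<Rightarrow> 'b \<Rightarrow> 'c \<Rightarrow> 'd) \<Rightarrow> bool"
  where "trilinear_map sa sb sc sd f \<longleftrightarrow> (\<forall>b c. lin sa sd (\<lambda>a. f a b c)) \<and>
    (\<forall>a c. lin sb sd (\<lambda>b. f a b c)) \<and> (\<forall>a b. lin sc sd (\<lambda>c. f a b c))"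

lemma trilinear_mapD:
  assumes "trilinear_map sa sb sc sd f"
  shows "lin s sa g1 \<Longrightarrow> lin s sd (\<lambda>x. f (g1 x) b c)"
    "lin s sb g2 \<Longrightarrow> lin s sd (\<lambda>x. f a (g2 x) c)"
    "lin s sc g3 \<Longrightarrow> lin s sd (\<lambda>x. f a b (g3 x))"
  using assms lin_comp[of sa sd "\<lambda>a. f a b c" s g1] lin_comp[of sb sd "\<lambda>b. f a b c" s g2]
    lin_comp[of sc sd "\<lambda>c. f a b c" s g3]
  by (auto simp: trilinear_map_def)

text \<open>The universal property of the tensor product: a bilinear map takes the same value on all
  representatives of a tensor.\<close>

lemma sum_list_ktens2:
  assumes "fsum_cong (ktens2_rel sa sb) xs ys" and "\<And>b. lin sa t (\<lambda>a. F a b)" "\<And>a. lin sb t (\<lambda>b. F a b)"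
  shows "(\<Sum>(a, b)\<leftarrow>xs. F a b) = (\<Sum>(a, b)\<leftarrow>ys. F a b)"
  using assms(1)
  by (rule fsum_cong_sum_list)
    (auto elim!: ktens2_rel.cases simp: linD[OF assms(2)] linD[OF assms(3)])

lemma sum_list_ktens3:
  assumes "fsum_cong (ktens3_rel sa sb sc) xs ys" and F: "trilinear_map sa sb sc t F"
  shows "(\<Sum>(a, b, c)\<leftarrow>xs. F a b c) = (\<Sum>(a, b, c)\<leftarrow>ys. F a b c)"
proof -
  have F1: "lin sa t (\<lambda>a. F a b c)" and F2: "lin sb t (\<lambda>b. F a b c)" and F3: "lin sc t (\<lambda>c. F a b c)"
    for a b c using F by (auto simp: trilinear_map_def)
  show ?thesis using assms(1)
    by (rule fsum_cong_sum_list)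
      (auto elim!: ktens3_rel.cases simp: linD[OF F1] linD[OF F2] linD[OF F3])
qed

lemma sum_list_map_concat: "(\<Sum>z\<leftarrow>concat zss. g z) = (\<Sum>zs\<leftarrow>zss. \<Sum>z\<leftarrow>zs. g z)"
  by (induction zss) auto

lemma sum_list_concat_map: "(\<Sum>z\<leftarrow>concat (map f xs). g z) = (\<Sum>x\<leftarrow>xs. \<Sum>z\<leftarrow>f x. g z)"
  by (induction xs) auto

lemma sum_list_swap:
  "(\<Sum>x\<leftarrow>xs. \<Sum>y\<leftarrow>ys. F x y) = (\<Sum>y\<leftarrow>ys. \<Sum>x\<leftarrow>xs. (F x y :: 'a::comm_monoid_add))"
  by (induction xs) (auto simp: sum_list_addf)

context hopf_algebra
begin

abbreviation "hs \<equiv> hscale H"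
abbreviation "eps \<equiv> hcounit H"
abbreviation "S \<equiv> antipode H"

sublocale A: k_algebra "hscale H" by (rule algebra)

text \<open>The scalar multiplication \<open>s\<close> of the target and the label
  \<open>n\<close> do not enter the value. They steer the simplifier: \<open>s\<close> determines the linearity conditions
  for coassociativity, and sums over coproducts of different variables are sorted by label.\<close>

definition sw :: "('k \<Rightarrow> 'w \<Rightarrow> 'w) \<Rightarrow> nat \<Rightarrow> 'h \<Rightarrow> ('h \<Rightarrow> 'h \<Rightarrow> 'w::ab_group_add) \<Rightarrow> 'w" where
  "sw s n h G = (\<Sum>(a, b)\<leftarrow>hcomult H h. G a b)"

lemma comult3_sw:
  "(\<Sum>(a, b, c)\<leftarrow>comult3 (hcomult H) h. G a b c) = sw s n h (\<lambda>a r. sw s n r (\<lambda>b c. G a b c))"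
  by (simp add: comult3_def sw_def sum_list_concat_map case_prod_unfold o_def)

lemma comult4_sw:
  "(\<Sum>(a, b, c, d)\<leftarrow>comult4 (hcomult H) h. G a b c d) =
    sw s n h (\<lambda>a r. sw s n r (\<lambda>b r. sw s n r (\<lambda>c d. G a b c d)))"
  by (simp add: comult4_def comult3_def sw_def sum_list_concat_map case_prod_unfold o_def)

lemma vs_hs: "vector_space hs" by unfold_locales

lemma sw_pull: "lin s t f \<Longrightarrow> f (sw s n h G) = sw t n h (\<lambda>a b. f (G a b))"
  by (simp add: sw_def lin_apply_sum_list case_prod_unfold)

lemma sw_mult:
  fixes G :: "'h \<Rightarrow> 'h \<Rightarrow> 'w::ring"
  shows "sw s n h G * c = sw s n h (\<lambda>a b. G a b * c)" "c * sw s n h G = sw s n h (\<lambda>a b. c * G a b)"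
  by (simp_all add: sw_def case_prod_unfold sum_list_const_mult sum_list_mult_const)

lemma lin_sw_body: "(\<And>a b. lin s t (\<lambda>x. K x a b)) \<Longrightarrow> lin s t (\<lambda>x. sw t n h (\<lambda>a b. K x a b))"
  unfolding sw_def case_prod_unfold by (intro lin_sum_list) (auto dest: lin_vs)

text \<open>The list \<open>hcomult H (x + y)\<close> bears no literal relation to those of x and y.
  A bilinear body sees only its class, and on classes the coproduct is additive.\<close>

lemma sw_add: "(\<And>b. lin hs t (\<lambda>a. K a b)) \<Longrightarrow> (\<And>a. lin hs t (\<lambda>b. K a b)) \<Longrightarrow>
    sw t n (x + y) K = sw t n x K + sw t n y K"
  unfolding sw_def by (subst sum_list_ktens2[OF comult_add]) (auto simp: map_append)

lemma sw_scale: "(\<And>b. lin hs t (\<lambda>a. K a b)) \<Longrightarrow> (\<And>a. lin hs t (\<lambda>b. K a b)) \<Longrightarrow>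
    sw t n (hs r x) K = t r (sw t n x K)"
proof -
  assume K: "\<And>b. lin hs t (\<lambda>a. K a b)" "\<And>a. lin hs t (\<lambda>b. K a b)"
  have "sw t n (hs r x) K = (\<Sum>(a, b)\<leftarrow>hcomult H x. t r (K a b))"
    unfolding sw_def by (subst sum_list_ktens2[OF comult_scale K])
      (auto simp: o_def case_prod_unfold linD(2)[OF K(1)])
  also have "\<dots> = t r (sw t n x K)"
    using lin_apply_sum_list[OF lin_scale_right[OF lin_id[OF lin_vs(2)[OF K(1)]]],
        of r "\<lambda>(a, b). K a b" "hcomult H x"]
    by (simp add: sw_def case_prod_unfold)
  finally show ?thesis .
qed

lemma lin_sw_arg: "lin s hs g \<Longrightarrow> (\<And>b. lin hs t (\<lambda>a. K a b)) \<Longrightarrow> (\<And>a. lin hs t (\<lambda>b. K a b)) \<Longrightarrow>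
    lin s t (\<lambda>x. sw t n (g x) (\<lambda>a b. K a b))"
proof -
  assume K: "\<And>b. lin hs t (\<lambda>a. K a b)" "\<And>a. lin hs t (\<lambda>b. K a b)" and g: "lin s hs g"
  have "lin hs t (\<lambda>x. sw t n x K)"
    by (rule linI) (auto simp: sw_add sw_scale K dest: lin_vs intro: vs_hs lin_vs(2)[OF K(1)])
  from lin_comp[OF this g] show ?thesis .
qed

lemma lin_mult:
  "lin s hs f \<Longrightarrow> lin s hs (\<lambda>x. f x * c)"
  "lin s hs f \<Longrightarrow> lin s hs (\<lambda>x. c * f x)"
  by (rule linI; auto simp: linD lin_vs algebra_simps A.scale_mult_left A.scale_mult_right)+

lemmas lin_S = lin_comp[OF antipode_linear]
lemmas lin_counit = lin_comp[OF counit_linear]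

lemmas lin_hopf = lin_id[OF vs_hs] lin_id[OF vs_kmul] lin_sw_body lin_sw_arg lin_mult lin_S
  lin_counit antipode_linear counit_linear lin_kmul lin_scale_right[where t = hs]
  lin_scale_left[where t = hs, OF _ vs_hs]

lemma sw_swap: "m < n \<Longrightarrow> sw t n g (\<lambda>u v. sw t m r (\<lambda>x y. G u v x y)) =
    sw t m r (\<lambda>x y. sw t n g (\<lambda>u v. G u v x y))"
  unfolding sw_def case_prod_unfold by (rule sum_list_swap)

lemma sw_coassoc:
  assumes "\<And>y z. lin hs t (\<lambda>x. G x y z)" "\<And>x z. lin hs t (\<lambda>y. G x y z)" "\<And>x y. lin hs t (\<lambda>z. G x y z)"
  shows "sw t n h (\<lambda>r z. sw t n r (\<lambda>x y. G x y z)) = sw t n h (\<lambda>x r. sw t n r (\<lambda>y z. G x y z))"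
proof -
  have "trilinear_map hs hs hs t G" using assms by (simp add: trilinear_map_def)
  from sum_list_ktens3[OF coassoc this, of h] show ?thesis
    by (simp add: sw_def sum_list_concat_map case_prod_unfold o_def)
qed

text \<open>Between the two sums to be regrouped there may stand a sum over another leg of the same
  variable. It carries the same label, so sorting by label does not move it; this form and its
  longer versions reach the right-nested normal form in that case.\<close>

lemma sw_coassoc_skip:
  assumes "\<And>y u v. lin hs t (\<lambda>x. G x y u v)" "\<And>x u v. lin hs t (\<lambda>y. G x y u v)"
    "\<And>x y v. lin hs t (\<lambda>u. G x y u v)" "\<And>x y u. lin hs t (\<lambda>v. G x y u v)"
  shows "sw t n h (\<lambda>r z. sw t n z (\<lambda>u v. sw t n r (\<lambda>x y. G x y u v))) =
    sw t n h (\<lambda>x r. sw t n r (\<lambda>y z. sw t n z (\<lambda>u v. G x y u v)))"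
proof -
  have "sw t n h (\<lambda>r z. sw t n z (\<lambda>u v. sw t n r (\<lambda>x y. G x y u v))) =
      sw t n h (\<lambda>r z. sw t n r (\<lambda>x y. sw t n z (\<lambda>u v. G x y u v)))"
    unfolding sw_def case_prod_unfold by (subst sum_list_swap) simp
  also have "\<dots> = sw t n h (\<lambda>x r. sw t n r (\<lambda>y z. sw t n z (\<lambda>u v. G x y u v)))"
    by (rule sw_coassoc) (simp_all add: lin_hopf assms)
  finally show ?thesis .
qed

lemma sw_coassoc_skip2:
  assumes "\<And>y u v w. lin hs t (\<lambda>x. G x y u v w)" "\<And>x u v w. lin hs t (\<lambda>y. G x y u v w)"
    "\<And>x y v w. lin hs t (\<lambda>u. G x y u v w)" "\<And>x y u w. lin hs t (\<lambda>v. G x y u v w)"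
    "\<And>x y u v. lin hs t (\<lambda>w. G x y u v w)"
  shows "sw t n h (\<lambda>r z. sw t n z (\<lambda>u z. sw t n z (\<lambda>v w. sw t n r (\<lambda>x y. G x y u v w)))) =
    sw t n h (\<lambda>x r. sw t n r (\<lambda>y z. sw t n z (\<lambda>u z. sw t n z (\<lambda>v w. G x y u v w))))"
proof -
  have "sw t n z (\<lambda>v w. sw t n r (\<lambda>x y. G x y u v w)) = sw t n r (\<lambda>x y. sw t n z (\<lambda>v w. G x y u v w))"
    for z u r
    unfolding sw_def case_prod_unfold by (rule sum_list_swap)
  then show ?thesis
    by (simp add: sw_coassoc_skip lin_hopf assms)
qed

lemma sw_coassoc_skip3:
  assumes "\<And>y u v w a. lin hs t (\<lambda>x. G x y u v w a)" "\<And>x u v w a. lin hs t (\<lambda>y. G x y u v w a)"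
    "\<And>x y v w a. lin hs t (\<lambda>u. G x y u v w a)" "\<And>x y u w a. lin hs t (\<lambda>v. G x y u v w a)"
    "\<And>x y u v a. lin hs t (\<lambda>w. G x y u v w a)" "\<And>x y u v w. lin hs t (\<lambda>a. G x y u v w a)"
  shows "sw t n h (\<lambda>r z. sw t n z (\<lambda>u z. sw t n z (\<lambda>v z. sw t n z (\<lambda>w a. sw t n r (\<lambda>x y. G x y u v
    w a))))) =
    sw t n h (\<lambda>x r. sw t n r (\<lambda>y z. sw t n z (\<lambda>u z. sw t n z (\<lambda>v z. sw t n z (\<lambda>w a. G x y u v w a)))))"
proof -
  have "sw t n z (\<lambda>w a. sw t n r (\<lambda>x y. G x y u v w a)) = sw t n r (\<lambda>x y. sw t n z (\<lambda>w a. G x y u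
    v w a))"
    for z u v r
    unfolding sw_def case_prod_unfold by (rule sum_list_swap)
  then show ?thesis
    by (simp add: sw_coassoc_skip2 lin_hopf assms)
qed

lemmas sw_skip = sw_coassoc_skip2 sw_coassoc_skip3

lemma sw_prod:
  assumes "\<And>b. lin hs t (\<lambda>a. G a b)" "\<And>a. lin hs t (\<lambda>b. G a b)"
  shows "sw t n (x * y) (\<lambda>a b. G a b) = sw t m x (\<lambda>x1 x2. sw t l y (\<lambda>y1 y2. G (x1 * y1) (x2 * y2)))"
  unfolding sw_def
  by (subst sum_list_ktens2[OF comult_mult assms])
    (simp add: sum_list_concat_map case_prod_unfold o_def)

lemma sw_one:
  assumes "\<And>b. lin hs t (\<lambda>a. G a b)" "\<And>a. lin hs t (\<lambda>b. G a b)"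
  shows "sw t n 1 (\<lambda>a b. G a b) = G 1 1"
  unfolding sw_def by (subst sum_list_ktens2[OF comult_one assms]) simp

lemma sw_counit_left:
  assumes "lin hs t K" shows "sw t n h (\<lambda>a b. t (eps a) (K b)) = K h"
proof -
  have "K h = K (\<Sum>(a, b)\<leftarrow>hcomult H h. hs (eps a) b)" by (simp add: counit_left)
  also have "\<dots> = sw t n h (\<lambda>a b. t (eps a) (K b))"
    by (simp add: lin_apply_sum_list[OF assms] sw_def case_prod_unfold linD[OF assms])
  finally show ?thesis by simp
qed

lemma sw_counit_right:
  assumes "lin hs t K" shows "sw t n h (\<lambda>a b. t (eps b) (K a)) = K h"
proof -
  have "K h = K (\<Sum>(a, b)\<leftarrow>hcomult H h. hs (eps b) a)" by (simp add: counit_right)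
  also have "\<dots> = sw t n h (\<lambda>a b. t (eps b) (K a))"
    by (simp add: lin_apply_sum_list[OF assms] sw_def case_prod_unfold linD[OF assms])
  finally show ?thesis by simp
qed

lemmas sw_eps_k = sw_mult(2)[where s = kmul, symmetric] sw_counit_left[where t = kmul]
  sw_counit_right[where t = kmul]

lemma sw_S_left:
  assumes "lin hs t K" shows "sw t n h (\<lambda>a b. K (S a * b)) = t (eps h) (K 1)"
proof -
  have "t (eps h) (K 1) = K (hs (eps h) 1)" by (simp add: linD[OF assms])
  also have "\<dots> = sw t n h (\<lambda>a b. K (S a * b))"
    unfolding antipode_left[symmetric]
    by (simp add: lin_apply_sum_list[OF assms] sw_def case_prod_unfold)
  finally show ?thesis by simp
qed

lemma sw_S_right:
  assumes "lin hs t K" shows "sw t n h (\<lambda>a b. K (a * S b)) = t (eps h) (K 1)"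
proof -
  have "t (eps h) (K 1) = K (hs (eps h) 1)" by (simp add: linD[OF assms])
  also have "\<dots> = sw t n h (\<lambda>a b. K (a * S b))"
    unfolding antipode_right[symmetric]
    by (simp add: lin_apply_sum_list[OF assms] sw_def case_prod_unfold)
  finally show ?thesis by simp
qed

text \<open>An antipode next to its neighbouring leg collapses inside a longer sum, and the
  remaining leg receives all of h. A leading pair has to be isolated by coassociativity first; a
  trailing pair is isolated already.\<close>

lemma sw_cancel:
  assumes "\<And>b. lin hs t (\<lambda>a. K a b)" "\<And>a. lin hs t (\<lambda>b. K a b)"
  shows "sw t n h (\<lambda>a r. sw t n r (\<lambda>b c. K (S a * b) c)) = K 1 h"
    "sw t n h (\<lambda>a r. sw t n r (\<lambda>b c. K (a * S b) c)) = K 1 h"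
    "sw t n h (\<lambda>a r. sw t n r (\<lambda>b c. K a (S b * c))) = K h 1"
    "sw t n h (\<lambda>a r. sw t n r (\<lambda>b c. K a (b * S c))) = K h 1"
proof -
  \<comment> \<open>The second entry restates the hypotheses as linearity of \<open>K\<close> after
    composition with a linear map.\<close>
  note K = assms bilinear_mapD[of hs hs t K, unfolded bilinear_map_def, OF conjI, OF allI allI,
    OF assms]
  have "sw t n h (\<lambda>a r. sw t n r (\<lambda>b c. K (S a * b) c)) =
      sw t n h (\<lambda>r c. sw t n r (\<lambda>a b. K (S a * b) c))"
    by (rule sw_coassoc[symmetric]) (simp_all add: K lin_hopf)
  then show "sw t n h (\<lambda>a r. sw t n r (\<lambda>b c. K (S a * b) c)) = K 1 h"
    by (simp add: sw_S_left[of t "\<lambda>u. K u _"] assms sw_counit_left)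
  have "sw t n h (\<lambda>a r. sw t n r (\<lambda>b c. K (a * S b) c)) =
      sw t n h (\<lambda>r c. sw t n r (\<lambda>a b. K (a * S b) c))"
    by (rule sw_coassoc[symmetric]) (simp_all add: K lin_hopf)
  then show "sw t n h (\<lambda>a r. sw t n r (\<lambda>b c. K (a * S b) c)) = K 1 h"
    by (simp add: sw_S_right[of t "\<lambda>u. K u _"] assms sw_counit_left)
  show "sw t n h (\<lambda>a r. sw t n r (\<lambda>b c. K a (S b * c))) = K h 1"
    by (simp add: sw_S_left[of t "\<lambda>u. K _ u"] assms sw_counit_right[of t])
  show "sw t n h (\<lambda>a r. sw t n r (\<lambda>b c. K a (b * S c))) = K h 1"
    by (simp add: sw_S_right[of t "\<lambda>u. K _ u"] assms sw_counit_right[of t])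
qed

section \<open>The antipode reverses products and coproducts\<close>

lemma S_one: "S 1 = 1"
proof -
  have "sw hs 0 1 (\<lambda>a b. S a * b) = 1"
    using sw_S_left[of hs "\<lambda>x. x" 0 1] by (simp add: lin_hopf counit_one)
  then show ?thesis by (simp add: sw_one lin_hopf)
qed

lemma counit_S: "eps (S h) = eps h"
proof -
  have "eps (S h) = sw kmul 0 h (\<lambda>a b. eps b * eps (S a))"
    using sw_counit_right[of kmul "\<lambda>a. eps (S a)" 0 h] by (simp add: lin_hopf)
  also have "\<dots> = sw kmul 0 h (\<lambda>a b. eps (S a * b))"
    by (simp add: counit_mult mult.commute)
  also have "\<dots> = eps h"
    by (subst sw_S_left) (simp_all add: lin_hopf counit_one)
  finally show ?thesis .
qed

text \<open>Both sides are convolution inverses of the multiplication on H \<otimes> H.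
  \<open>?T\<close> is the triple convolution of S(x y), x y and S(y) S(x), evaluated from either
  end.\<close>

lemma S_mult: "S (x * y) = S y * S x"
proof -
  let ?T = "sw hs 0 x (\<lambda>x1 r. sw hs 0 r (\<lambda>x2 x3. sw hs 2 y (\<lambda>y1 q. sw hs 2 q (\<lambda>y2 y3.
    S (x1 * y1) * (x2 * (y2 * S y3) * S x3)))))"
  have 1: "sw hs 2 y (\<lambda>y1 q. sw hs 2 q (\<lambda>y2 y3. S (x1 * y1) * (x2 * (y2 * S y3) * S x3))) =
      S (x1 * y) * (x2 * S x3)" for x1 x2 x3
    by (subst sw_cancel(4)[where K = "\<lambda>y1 u. S (x1 * y1) * (x2 * u * S x3)"])
      (simp_all add: lin_hopf)
  have 2: "?T = S (x * y)"
    unfolding 1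
    by (subst sw_cancel(4)[where K = "\<lambda>x1 u. S (x1 * y) * u"]) (simp_all add: lin_hopf)
  have "?T = sw hs 0 x (\<lambda>x' x3. sw hs 2 y (\<lambda>y' y3. sw hs 0 x' (\<lambda>x1 x2. sw hs 2 y' (\<lambda>y1 y2.
      S (x1 * y1) * (x2 * y2) * (S y3 * S x3)))))"
    by (simp add: sw_coassoc sw_swap lin_hopf mult.assoc)
  also have "\<dots> = sw hs 0 x (\<lambda>x' x3. sw hs 2 y (\<lambda>y' y3. hs (eps x' * eps y') (S y3 * S x3)))"
    by (simp add: sw_prod[of hs "\<lambda>a b. S a * b * _" 0 _ _ 0 2, symmetric] lin_hopf counit_mult
      sw_S_left[of hs "\<lambda>u. u * _"] A.scale_mult_left)
  also have "\<dots> = S y * S x"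
    by (simp add: A.scale_scale[symmetric] sw_counit_left[of hs]
        sw_pull[OF lin_scale_right[OF lin_id[OF vs_hs]], symmetric] lin_hopf del: A.scale_scale)
  finally show ?thesis using 2 by simp
qed

lemma sw_label: "sw s n h G = sw s m h G"
  by (simp add: sw_def)

text \<open>Uniqueness of inverses again: \<Delta>(S h) and S h2 \<otimes> S h1 are both convolution
  inverses of \<Delta>. The first two steps insert trivial factors b S(e) and c S(d) into the two
  legs; after regrouping b and c into the coproduct of z, S(a) meets z and cancels.\<close>

lemma sw_S:
  assumes "\<And>b. lin hs t (\<lambda>a. G a b)" "\<And>a. lin hs t (\<lambda>b. G a b)"
  shows "sw t n (S h) (\<lambda>a b. G a b) = sw t m h (\<lambda>a b. G (S b) (S a))"
proof -
  note G = assms bilinear_mapD[of hs hs t G, unfolded bilinear_map_def, OF conjI, OF allI allI,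
    OF assms]
  have "sw t 2 (S h) G = sw t 0 h (\<lambda>a r. sw t 0 r (\<lambda>b q. sw t 2 (S a) (\<lambda>x y. G (x * (b * S q)) y)))"
    by (subst sw_cancel(4)[where K = "\<lambda>a u. sw t 2 (S a) (\<lambda>x y. G (x * u) y)"])
      (simp_all add: lin_hopf G)
  also have "\<dots> = sw t 0 h (\<lambda>a r. sw t 0 r (\<lambda>b q. sw t 0 q (\<lambda>c r. sw t 0 r (\<lambda>d e.
      sw t 2 (S a) (\<lambda>x y. G (x * (b * S e)) (y * (c * S d)))))))"
    by (subst sw_cancel(2)[where K = "\<lambda>u e. sw t 2 (S _) (\<lambda>x y. G (x * (_ * S e)) (y * u))"])
      (simp_all add: lin_hopf G)
  also have "\<dots> = sw t 0 h (\<lambda>a r. sw t 0 r (\<lambda>z q. sw t 0 q (\<lambda>d e. sw t 2 (S a) (\<lambda>x y.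
      sw t 0 z (\<lambda>b c. G ((x * b) * S e) ((y * c) * S d))))))"
    by (simp add: sw_swap sw_coassoc sw_coassoc_skip lin_hopf G mult.assoc)
  also have "\<dots> = sw t 0 h (\<lambda>a r. sw t 0 r (\<lambda>z q. sw t 0 q (\<lambda>d e.
      sw t 2 (S a * z) (\<lambda>x y. G (x * S e) (y * S d)))))"
    by (simp add: sw_prod[of t _ 2 _ _ 2 0] lin_hopf G)
  also have "\<dots> = sw t 0 h (\<lambda>d e. G (S e) (S d))"
    by (subst sw_cancel(1)[where K = "\<lambda>u q. sw t 0 q (\<lambda>d e. sw t 2 u (\<lambda>x y. G (x * S e) (y * S d)))"])
      (simp_all add: lin_hopf G sw_one)
  finally show ?thesis by (simp add: sw_def)
qed

end

section \<open>Identities in cocycle cross products of associative type\<close>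

locale crossed = hopf_algebra H + B: k_algebra sB + cocycle_cross_product H sB act \<sigma> \<sigma>i
  for H :: "('k::field, 'h::{ring, monoid_mult}) hopf"
    and sB :: "'k \<Rightarrow> 'b::{ring, monoid_mult} \<Rightarrow> 'b"
    and act :: "'h \<Rightarrow> 'b \<Rightarrow> 'b" (infixr "\<triangleright>" 75)
    and \<sigma> \<sigma>i :: "'h \<Rightarrow> 'h \<Rightarrow> 'b" +
  assumes assoc_type: "associative_type (\<triangleright>)"
begin

lemma vs_sB: "vector_space sB" by unfold_locales

lemma lin_B_mult:
  "lin s sB f \<Longrightarrow> lin s sB (\<lambda>x. f x * c)"
  "lin s sB f \<Longrightarrow> lin s sB (\<lambda>x. c * f x)"
  by (rule linI; auto simp: linD lin_vs algebra_simps B.scale_mult_left B.scale_mult_right)+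

lemmas lin_act = bilinear_mapD[OF act_bilinear]
lemmas lin_\<sigma> = bilinear_mapD[OF \<sigma>_bilinear] bilinear_mapD[OF \<sigma>i_bilinear]

lemmas lin_cross = lin_hopf lin_id[OF vs_sB] lin_B_mult lin_act lin_\<sigma>
  lin_scale_right[where t = sB] lin_scale_left[where t = sB, OF _ vs_sB]

lemmas sw_sB_pull = sw_mult[where s = sB] sw_pull[OF lin_act(2)[OF lin_id[OF vs_sB]]]
  sw_pull[OF lin_scale_right[OF lin_id[OF vs_sB]], symmetric]

text \<open>The normal form for Sweedler expressions with values in B: sums are drawn out of
  products and actions, those over one variable are nested to the right, different variables are
  sorted by label, and products are bracketed to the right.\<close>

lemmas sw_norm = sw_coassoc sw_coassoc_skip sw_swap sw_sB_pull lin_cross mult.assoc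

lemma act_mult: "h \<triangleright> (g \<triangleright> b) = (h * g) \<triangleright> b"
  using assoc_type by (simp add: associative_type_def)

lemma measuring: "h \<triangleright> (a * b) = sw sB n h (\<lambda>h1 h2. (h1 \<triangleright> a) * (h2 \<triangleright> b))"
  by (simp add: measuring_mult sw_def)

lemma act_one: "h \<triangleright> 1 = sB (eps h) 1" by (rule measuring_one)

lemma act_sB: "h \<triangleright> sB r b = sB r (h \<triangleright> b)"
  by (simp add: linD[OF lin_act(2)[OF lin_id[OF vs_sB]]])

lemma sw_\<sigma>_\<sigma>i: "sw sB n h (\<lambda>h1 h2. sw sB m g (\<lambda>g1 g2. \<sigma> h1 g1 * \<sigma>i h2 g2)) = sB (eps h * eps g) 1"
  by (simp add: sw_def \<sigma>_\<sigma>i)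

lemma sw_\<sigma>i_\<sigma>: "sw sB n h (\<lambda>h1 h2. sw sB m g (\<lambda>g1 g2. \<sigma>i h1 g1 * \<sigma> h2 g2)) = sB (eps h * eps g) 1"
  by (simp add: sw_def \<sigma>i_\<sigma>)

lemmas sB_simps = B.scale_mult_left B.scale_mult_right B.scale_scale[symmetric]
lemmas sw_eps = sw_counit_left[where t = sB] sw_counit_right[where t = sB]

lemma act_expand:
  "(h * g) \<triangleright> b = sw sB 2 h (\<lambda>h1 r. sw sB 2 r (\<lambda>h2 h3. sw sB 3 g (\<lambda>g1 q. sw sB 3 q (\<lambda>g2 g3.
    \<sigma> h1 g1 * ((h2 * g2) \<triangleright> b) * \<sigma>i h3 g3))))"
  using act_act[of h g b] by (simp add: act_mult comult3_sw[where s = sB and n = 2] sw_def)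

text \<open>Since \<open>\<triangleright>\<close> is an action, condition (2) says that \<open>\<sigma>\<close> commutes with values of the action up to
  the order of the Sweedler legs.\<close>

lemma act_\<sigma>:
  "sw sB 2 h (\<lambda>h1 h2. sw sB 3 g (\<lambda>g1 g2. ((h1 * g1) \<triangleright> b) * \<sigma> h2 g2)) =
    sw sB 2 h (\<lambda>h1 h2. sw sB 3 g (\<lambda>g1 g2. \<sigma> h1 g1 * ((h2 * g2) \<triangleright> b)))" (is "?L = ?R")
proof -
  have "?L = sw sB 2 h (\<lambda>h1 r. sw sB 2 r (\<lambda>h2 r. sw sB 3 g (\<lambda>g1 q. sw sB 3 q (\<lambda>g2 q.
      \<sigma> h1 g1 * ((h2 * g2) \<triangleright> b) * sw sB 2 r (\<lambda>h3 h4. sw sB 3 q (\<lambda>g3 g4. \<sigma>i h3 g3 * \<sigma> h4 g4))))))"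
    by (subst act_expand) (simp add: sw_norm)
  also have "\<dots> = ?R"
    by (simp add: sw_\<sigma>i_\<sigma> sB_simps sw_eps sw_norm del: B.scale_scale)
  finally show ?thesis .
qed

lemma \<sigma>i_act:
  "sw sB 2 h (\<lambda>h1 h2. sw sB 3 g (\<lambda>g1 g2. \<sigma>i h1 g1 * ((h2 * g2) \<triangleright> b))) =
    sw sB 2 h (\<lambda>h1 h2. sw sB 3 g (\<lambda>g1 g2. ((h1 * g1) \<triangleright> b) * \<sigma>i h2 g2))" (is "?L = ?R")
proof -
  have "?L = sw sB 2 h (\<lambda>r r'. sw sB 2 r' (\<lambda>h2 h3. sw sB 3 g (\<lambda>q q'. sw sB 3 q' (\<lambda>g2 g3.
      sw sB 2 r (\<lambda>h1 h2. sw sB 3 q (\<lambda>g1 g2. \<sigma>i h1 g1 * \<sigma> h2 g2)) * (((h2 * g2) \<triangleright> b) * \<sigma>i h3 g3)))))"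
    by (subst act_expand) (simp add: sw_norm)
  also have "\<dots> = ?R"
    by (simp add: sw_\<sigma>i_\<sigma> sB_simps sw_eps sw_norm del: B.scale_scale)
  finally show ?thesis .
qed

section \<open>The convolution algebra on H \<otimes> H \<otimes> H and the variants of the cocycle
  condition\<close>

definition conv3 :: "('h \<Rightarrow> 'h \<Rightarrow> 'h \<Rightarrow> 'b) \<Rightarrow> ('h \<Rightarrow> 'h \<Rightarrow> 'h \<Rightarrow> 'b) \<Rightarrow> 'h \<Rightarrow> 'h \<Rightarrow> 'h \<Rightarrow> 'b" where
  "conv3 f g x y z = sw sB 2 x (\<lambda>x1 x2. sw sB 3 y (\<lambda>y1 y2. sw sB 4 z (\<lambda>z1 z2.
    f x1 y1 z1 * g x2 y2 z2)))"

abbreviation "tri \<equiv> trilinear_map hs hs hs sB"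

definition unit3 :: "'h \<Rightarrow> 'h \<Rightarrow> 'h \<Rightarrow> 'b" where
  "unit3 x y z = sB (eps x) (sB (eps y) (sB (eps z) 1))"

lemma conv3_assoc:
  assumes "tri f" "tri g" "tri k"
  shows "conv3 (conv3 f g) k = conv3 f (conv3 g k)"
  by (intro ext) (simp add: conv3_def sw_norm assms[THEN trilinear_mapD(1)]
    assms[THEN trilinear_mapD(2)] assms[THEN trilinear_mapD(3)])

lemma conv3_unit:
  assumes "tri f"
  shows "conv3 f unit3 = f" "conv3 unit3 f = f"
  by (intro ext; simp add: conv3_def unit3_def sB_simps sw_eps sw_norm trilinear_mapD[OF assms]
    del: B.scale_scale)+

lemma conv3_tri:
  assumes "tri f" "tri g"
  shows "tri (conv3 f g)"
  by (simp add: trilinear_map_def conv3_def lin_cross trilinear_mapD[OF assms(1)]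
    trilinear_mapD[OF assms(2)])

text \<open>The cocycle condition (4) has the form \<open>a * b = c * d\<close> with invertible factors on
  \<open>H \<otimes> H \<otimes> H\<close>. Solving it for other factors gives its versions for \<open>\<sigma>\<^sup>-\<^sup>1\<close>.\<close>

lemma conv3_solve:
  assumes tri: "tri a" "tri b" "tri c" "tri d" "tri a'" "tri b'" "tri c'" "tri d'"
    and inv: "conv3 a' a = unit3" "conv3 a a' = unit3" "conv3 b b' = unit3" "conv3 b' b = unit3"
      "conv3 c' c = unit3" "conv3 c c' = unit3" "conv3 d d' = unit3" "conv3 d' d = unit3"
    and eq: "conv3 a b = conv3 c d"
  shows "conv3 b' a' = conv3 d' c'" "conv3 a' c = conv3 b d'" "conv3 c' a = conv3 d b'"
proof -
  note simps = conv3_tri conv3_unit tri inv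
  have 1: "conv3 (conv3 c d) b' = a" unfolding eq[symmetric] by (simp add: simps conv3_assoc)
  have 2: "conv3 a' (conv3 c d) = b"
    unfolding eq[symmetric] by (simp add: simps flip: conv3_assoc)
  show "conv3 c' a = conv3 d b'"
    unfolding 1[symmetric] by (simp add: simps flip: conv3_assoc)
  show "conv3 a' c = conv3 b d'"
    unfolding 2[symmetric] by (simp add: simps conv3_assoc)
  have 3: "conv3 (conv3 d' c') (conv3 a b) = unit3"
  proof -
    have "conv3 (conv3 d' c') (conv3 c d) = conv3 d' (conv3 (conv3 c' c) d)"
      by (simp only: conv3_assoc conv3_tri tri)
    then show ?thesis by (simp add: simps eq)
  qed
  have 4: "conv3 (conv3 a b) (conv3 b' a') = unit3"
  proof -
    have "conv3 (conv3 a b) (conv3 b' a') = conv3 a (conv3 (conv3 b b') a')"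
      by (simp only: conv3_assoc conv3_tri tri)
    then show ?thesis by (simp add: simps)
  qed
  have "conv3 (conv3 (conv3 d' c') (conv3 a b)) (conv3 b' a') =
      conv3 (conv3 d' c') (conv3 (conv3 a b) (conv3 b' a'))"
    by (simp only: conv3_assoc conv3_tri tri)
  then show "conv3 b' a' = conv3 d' c'"
    unfolding 3 4 by (simp add: simps)
qed

lemma tri_cocycle:
  "tri (\<lambda>x y z. x \<triangleright> \<sigma> y z)" "tri (\<lambda>x y z. \<sigma> x (y * z))" "tri (\<lambda>x y z. sB (eps z) (\<sigma> x y))"
  "tri (\<lambda>x y z. \<sigma> (x * y) z)"
  "tri (\<lambda>x y z. x \<triangleright> \<sigma>i y z)" "tri (\<lambda>x y z. \<sigma>i x (y * z))" "tri (\<lambda>x y z. sB (eps z) (\<sigma>i x y))"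
  "tri (\<lambda>x y z. \<sigma>i (x * y) z)"
  by (simp_all add: trilinear_map_def lin_cross)

text \<open>Each factor of the cocycle condition arises from \<sigma> by an operation that preserves
  convolution: acting by x (a measuring), pulling back along the multiplication of two arguments (a
  coalgebra map), or adjoining a counit. Hence the same operation on \<sigma>^-1 gives the
  inverse.\<close>

lemma inverse_cocycle:
  "conv3 (\<lambda>x y z. x \<triangleright> \<sigma>i y z) (\<lambda>x y z. x \<triangleright> \<sigma> y z) = unit3"
  "conv3 (\<lambda>x y z. x \<triangleright> \<sigma> y z) (\<lambda>x y z. x \<triangleright> \<sigma>i y z) = unit3"
  "conv3 (\<lambda>x y z. \<sigma> x (y * z)) (\<lambda>x y z. \<sigma>i x (y * z)) = unit3"
  "conv3 (\<lambda>x y z. \<sigma>i x (y * z)) (\<lambda>x y z. \<sigma> x (y * z)) = unit3"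
  "conv3 (\<lambda>x y z. sB (eps z) (\<sigma>i x y)) (\<lambda>x y z. sB (eps z) (\<sigma> x y)) = unit3"
  "conv3 (\<lambda>x y z. sB (eps z) (\<sigma> x y)) (\<lambda>x y z. sB (eps z) (\<sigma>i x y)) = unit3"
  "conv3 (\<lambda>x y z. \<sigma> (x * y) z) (\<lambda>x y z. \<sigma>i (x * y) z) = unit3"
  "conv3 (\<lambda>x y z. \<sigma>i (x * y) z) (\<lambda>x y z. \<sigma> (x * y) z) = unit3"
proof -
  have 1: "sw sB 2 x (\<lambda>x1 x2. sw sB 3 y (\<lambda>y1 y2. sw sB 4 z (\<lambda>z1 z2. (x1 \<triangleright> f y1 z1) * (x2 \<triangleright> g y2 z2)))) =
      x \<triangleright> sw sB 3 y (\<lambda>y1 y2. sw sB 4 z (\<lambda>z1 z2. f y1 z1 * g y2 z2))" for x y z f g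
    by (simp add: sw_norm measuring[where n = 2])
  have p: "sw sB 3 y (\<lambda>y1 y2. sw sB 4 z (\<lambda>z1 z2. f (y1 * z1) * g (y2 * z2))) =
      sw sB 3 (y * z) (\<lambda>u v. f u * g v)"
    if "lin hs sB f" "lin hs sB g" for f g :: "'h \<Rightarrow> 'b" and y z
    by (subst sw_prod[where m = 3 and l = 4]) (simp_all add: lin_cross that)
  have p': "sw sB 2 x (\<lambda>x1 x2. sw sB 3 y (\<lambda>y1 y2. sw sB 4 z (\<lambda>z1 z2. f (x1 * y1) z1 * g (x2 * y2)
    z2))) =
      sw sB 2 (x * y) (\<lambda>u v. sw sB 4 z (\<lambda>z1 z2. f u z1 * g v z2))"
    if "bilinear_map hs hs sB f" "bilinear_map hs hs sB g" for f g :: "'h \<Rightarrow> 'h \<Rightarrow> 'b" and x y z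
    by (subst sw_prod[where m = 2 and l = 3]) (simp_all add: lin_cross bilinear_mapD[OF that(1)]
      bilinear_mapD[OF that(2)])
  have q: "sw sB 4 z (\<lambda>z1 z2. sB (eps z2) (sB (eps z1) b)) = sB (eps z) b" for z b
    by (simp add: sw_eps lin_cross del: B.scale_scale)
  have q2: "sw sB 2 x (\<lambda>x1 x2. sw sB 3 y (\<lambda>y1 y2. sw sB 4 z (\<lambda>z1 z2.
      sB (eps z1) (f x1 y1) * sB (eps z2) (g x2 y2)))) =
      sB (eps z) (sw sB 2 x (\<lambda>x1 x2. sw sB 3 y (\<lambda>y1 y2. f x1 y1 * g x2 y2)))" for x y z f g
    by (simp add: sB_simps q sw_sB_pull del: B.scale_scale)
  note [simp] = sw_\<sigma>_\<sigma>i sw_\<sigma>i_\<sigma>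
  note [simp del] = B.scale_scale
  show
    "conv3 (\<lambda>x y z. x \<triangleright> \<sigma>i y z) (\<lambda>x y z. x \<triangleright> \<sigma> y z) = unit3"
    "conv3 (\<lambda>x y z. x \<triangleright> \<sigma> y z) (\<lambda>x y z. x \<triangleright> \<sigma>i y z) = unit3"
    by (intro ext; simp add: conv3_def 1 unit3_def act_one act_sB sB_simps;
      simp add: B.scale_scale ac_simps)+
  show
    "conv3 (\<lambda>x y z. \<sigma> x (y * z)) (\<lambda>x y z. \<sigma>i x (y * z)) = unit3"
    "conv3 (\<lambda>x y z. \<sigma>i x (y * z)) (\<lambda>x y z. \<sigma> x (y * z)) = unit3"
    by (intro ext; simp add: conv3_def p lin_cross unit3_def counit_mult sB_simps)+
  show
    "conv3 (\<lambda>x y z. sB (eps z) (\<sigma>i x y)) (\<lambda>x y z. sB (eps z) (\<sigma> x y)) = unit3"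
    "conv3 (\<lambda>x y z. sB (eps z) (\<sigma> x y)) (\<lambda>x y z. sB (eps z) (\<sigma>i x y)) = unit3"
    by (intro ext; simp add: conv3_def q2 unit3_def; simp add: B.scale_scale ac_simps)+
  show
    "conv3 (\<lambda>x y z. \<sigma> (x * y) z) (\<lambda>x y z. \<sigma>i (x * y) z) = unit3"
    "conv3 (\<lambda>x y z. \<sigma>i (x * y) z) (\<lambda>x y z. \<sigma> (x * y) z) = unit3"
    by (intro ext; simp add: conv3_def p' \<sigma>_bilinear \<sigma>i_bilinear unit3_def counit_mult sB_simps)+
qed

lemma cocycle_sw:
  "sw sB 2 x (\<lambda>x1 x2. sw sB 3 y (\<lambda>y1 y2. sw sB 4 z (\<lambda>z1 z2. (x1 \<triangleright> \<sigma> y1 z1) * \<sigma> x2 (y2 * z2)))) =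
    sw sB 2 x (\<lambda>x1 x2. sw sB 3 y (\<lambda>y1 y2. \<sigma> x1 y1 * \<sigma> (x2 * y2) z))"
  using cocycle by (simp add: sw_def)

text \<open>In condition (4) the last argument is not split on the right. The counit factor makes
  \<sigma>(x, y) a function of three arguments, so that both sides are convolution products of two
  invertible elements.\<close>

lemma cocycle_conv3:
  "conv3 (\<lambda>x y z. x \<triangleright> \<sigma> y z) (\<lambda>x y z. \<sigma> x (y * z)) =
    conv3 (\<lambda>x y z. sB (eps z) (\<sigma> x y)) (\<lambda>x y z. \<sigma> (x * y) z)"
  by (intro ext) (simp add: conv3_def cocycle_sw sB_simps sw_eps lin_cross del: B.scale_scale)

lemmas cocycle_variants = conv3_solve[OF tri_cocycle inverse_cocycle cocycle_conv3]

lemma \<sigma>i_cocycle: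
  "sw sB 2 x (\<lambda>x1 x2. sw sB 3 y (\<lambda>y1 y2. sw sB 4 z (\<lambda>z1 z2. \<sigma>i x1 (y1 * z1) * (x2 \<triangleright> \<sigma>i y2 z2)))) =
    sw sB 2 x (\<lambda>x1 x2. sw sB 3 y (\<lambda>y1 y2. \<sigma>i (x1 * y1) z * \<sigma>i x2 y2))"
  using fun_cong[OF fun_cong[OF fun_cong[OF cocycle_variants(1)]], of x y z]
  by (simp add: conv3_def sB_simps sw_eps lin_cross del: B.scale_scale)

lemma act_\<sigma>i_\<sigma>:
  "sw sB 2 x (\<lambda>x1 x2. sw sB 3 y (\<lambda>y1 y2. (x1 \<triangleright> \<sigma>i y1 z) * \<sigma> x2 y2)) =
    sw sB 2 x (\<lambda>x1 x2. sw sB 3 y (\<lambda>y1 y2. sw sB 4 z (\<lambda>z1 z2. \<sigma> x1 (y1 * z1) * \<sigma>i (x2 * y2) z2)))"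
  using fun_cong[OF fun_cong[OF fun_cong[OF cocycle_variants(2)]], of x y z]
  by (simp add: conv3_def sB_simps sw_eps lin_cross del: B.scale_scale)

lemma \<sigma>i_act_\<sigma>:
  "sw sB 2 x (\<lambda>x1 x2. sw sB 3 y (\<lambda>y1 y2. \<sigma>i x1 y1 * (x2 \<triangleright> \<sigma> y2 z))) =
    sw sB 2 x (\<lambda>x1 x2. sw sB 3 y (\<lambda>y1 y2. sw sB 4 z (\<lambda>z1 z2. \<sigma> (x1 * y1) z1 * \<sigma>i x2 (y2 * z2))))"
  using fun_cong[OF fun_cong[OF fun_cong[OF cocycle_variants(3)]], of x y z]
  by (simp add: conv3_def sB_simps sw_eps lin_cross del: B.scale_scale)

text \<open>Evaluate the convolution of \<sigma> and \<sigma>^-1 where one argument is 1: there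
  \<sigma> already reduces to the counit.\<close>

lemma \<sigma>i_one: "\<sigma>i h 1 = sB (eps h) 1" "\<sigma>i 1 h = sB (eps h) 1"
proof -
  have "\<sigma>i h 1 = sw sB 2 h (\<lambda>h1 h2. sw sB 3 1 (\<lambda>g1 g2. \<sigma> h1 g1 * \<sigma>i h2 g2))"
    by (simp add: sw_one lin_cross \<sigma>_one_right sB_simps sw_eps del: B.scale_scale)
  then show "\<sigma>i h 1 = sB (eps h) 1" by (simp add: sw_\<sigma>_\<sigma>i counit_one)
  have "\<sigma>i 1 h = sw sB 2 1 (\<lambda>h1 h2. sw sB 3 h (\<lambda>g1 g2. \<sigma> h1 g1 * \<sigma>i h2 g2))"
    by (simp add: sw_one lin_cross \<sigma>_one_left sB_simps sw_eps del: B.scale_scale)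
  then show "\<sigma>i 1 h = sB (eps h) 1" by (simp add: sw_\<sigma>_\<sigma>i counit_one)
qed

section \<open>Coefficients of the product and their associativity\<close>

definition lam :: "'h \<Rightarrow> 'b \<Rightarrow> 'h \<Rightarrow> 'b" where
  "lam h c g = sw sB 2 h (\<lambda>h1 h2. (h1 \<triangleright> c) * \<sigma> h2 g)"

text \<open>In B #_\<sigma> H one has (1 # h)(c # g) = \<open>lam h1 c g1\<close> # h2 g2. The
  mirror image \<open>rho\<close>, with \<sigma>^-1 and the factors in reversed order, is what the
  product puts into the t-coordinate.\<close>

definition rho :: "'h \<Rightarrow> 'b \<Rightarrow> 'h \<Rightarrow> 'b" where
  "rho h c g = sw sB 2 h (\<lambda>h1 h2. \<sigma>i h1 g * (h2 \<triangleright> c))"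

lemma lam_3: "lam h c g = sw sB 3 h (\<lambda>h1 h2. (h1 \<triangleright> c) * \<sigma> h2 g)"
  and rho_3: "rho h c g = sw sB 3 h (\<lambda>h1 h2. \<sigma>i h1 g * (h2 \<triangleright> c))"
  by (simp_all add: lam_def rho_def sw_def)

lemma tri_lam: "trilinear_map hs sB hs sB lam" and tri_rho: "trilinear_map hs sB hs sB rho"
  by (simp_all add: trilinear_map_def lam_def rho_def lin_cross)

lemmas lin_lam_rho = lin_cross trilinear_mapD[OF tri_lam] trilinear_mapD[OF tri_rho]

lemma lam_one: "lam h c 1 = h \<triangleright> c" "lam 1 c g = sB (eps g) c" "lam h 1 g = \<sigma> h g"
  by (simp_all add: lam_def \<sigma>_one_right \<sigma>_one_left act_one one_act sw_one sB_simps sw_eps lin_cross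
    del: B.scale_scale)

lemma rho_one: "rho h c 1 = h \<triangleright> c" "rho 1 c g = sB (eps g) c" "rho h 1 g = \<sigma>i h g"
  by (simp_all add: rho_def \<sigma>i_one act_one one_act sw_one sB_simps sw_eps lin_cross
    del: B.scale_scale)

lemmas sw_prod_23 = sw_prod[where n = 2 and m = 2 and l = 3]

text \<open>Associativity of (1 # h)(c # g)(d # f) in B #_\<sigma> H, read off from the B-part.
  \<open>act_\<sigma>\<close> moves the cocycle past the value of the action; then two cocycles
  stand side by side and condition (4) applies.\<close>

lemma lam_lam:
  "sw sB 2 h (\<lambda>h1 h2. sw sB 3 g (\<lambda>g1 g2. lam h1 c g1 * lam (h2 * g2) d f)) =
    sw sB 3 g (\<lambda>g1 g2. sw sB 4 f (\<lambda>f1 f2. lam h (c * lam g1 d f1) (g2 * f2)))"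
  (is "?L = ?R")
proof -
  have "?L = sw sB 2 h (\<lambda>h1 r. sw sB 2 r (\<lambda>p q. sw sB 3 g (\<lambda>p' q'.
      (h1 \<triangleright> c) * (sw sB 2 p (\<lambda>h2 h3. sw sB 3 p' (\<lambda>g1 g2. \<sigma> h2 g1 * ((h3 * g2) \<triangleright> d)))) * \<sigma> (q * q') f)))"
    by (simp add: lam_def sw_norm sw_prod_23)
  also have "\<dots> = sw sB 2 h (\<lambda>h1 r. sw sB 2 r (\<lambda>h2 q. sw sB 3 g (\<lambda>g1 q'. (h1 \<triangleright> c) * (((h2 * g1) \<triangleright> d) *
      sw sB 2 q (\<lambda>h3 h4. sw sB 3 q' (\<lambda>g2 g3. \<sigma> h3 g2 * \<sigma> (h4 * g3) f))))))"
    unfolding act_\<sigma>[symmetric] by (simp add: sw_norm)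
  also have "\<dots> = ?R"
    unfolding cocycle_sw[symmetric] lam_def[of h] lam_3[of _ d]
    by (simp add: sw_norm measuring[where n = 2] act_mult)
  finally show ?thesis .
qed

text \<open>The mirror image of \<open>lam_lam\<close>: \<open>\<sigma>i_act\<close> collects the
  two inverse cocycles on the left, where condition (4) for \<sigma>^-1 applies.\<close>

lemma rho_rho:
  "sw sB 2 h (\<lambda>h1 h2. sw sB 3 g (\<lambda>g1 g2. rho (h1 * g1) d f * rho h2 c g2)) =
    sw sB 3 g (\<lambda>g1 g2. sw sB 4 f (\<lambda>f1 f2. rho h (rho g2 d f2 * c) (g1 * f1)))"
  (is "?L = ?R")
proof -
  have "?L = sw sB 2 h (\<lambda>p r. sw sB 2 r (\<lambda>q h4. sw sB 3 g (\<lambda>p' q'. \<sigma>i (p * p') f *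
      (sw sB 2 q (\<lambda>h2 h3. sw sB 3 q' (\<lambda>g2 g3. ((h2 * g2) \<triangleright> d) * \<sigma>i h3 g3)) * (h4 \<triangleright> c)))))"
    by (simp add: rho_def sw_norm sw_prod_23)
  also have "\<dots> = sw sB 2 h (\<lambda>p r. sw sB 2 r (\<lambda>h3 h4. sw sB 3 g (\<lambda>p' g3.
      sw sB 2 p (\<lambda>h1 h2. sw sB 3 p' (\<lambda>g1 g2. \<sigma>i (h1 * g1) f * \<sigma>i h2 g2)) *
      (((h3 * g3) \<triangleright> d) * (h4 \<triangleright> c)))))"
    unfolding \<sigma>i_act[symmetric] by (simp add: sw_norm)
  also have "\<dots> = ?R"
    unfolding \<sigma>i_cocycle[symmetric] rho_def[of h] rho_3[of _ d]
    by (simp add: sw_norm measuring[where n = 2] act_mult)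
  finally show ?thesis .
qed

text \<open>In \<open>B #\<^sub>\<sigma> H\<close> the map \<open>h \<mapsto> 1 # h\<close> has the convolution inverse
  \<open>h \<mapsto> invS h\<^sub>(\<^sub>2\<^sub>) # S h\<^sub>(\<^sub>1\<^sub>)\<close>; \<open>mu\<close> is the coefficient in \<open>(invS h\<^sub>(\<^sub>2\<^sub>) # S h\<^sub>(\<^sub>1\<^sub>)) (x # 1)\<close> and \<open>nu\<close> the one
  in \<open>(1 # h\<^sub>(\<^sub>1\<^sub>)) (y # S h\<^sub>(\<^sub>2\<^sub>))\<close>.\<close>

definition invS :: "'h \<Rightarrow> 'b" where
  "invS h = sw sB 2 h (\<lambda>a b. \<sigma>i (S a) b)"

definition mu :: "'h \<Rightarrow> 'b \<Rightarrow> 'b" where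
  "mu h x = sw sB 2 h (\<lambda>a b. invS b * (S a \<triangleright> x))"

definition nuS :: "'h \<Rightarrow> 'b" where
  "nuS h = sw sB 2 h (\<lambda>a b. \<sigma> a (S b))"

definition nu :: "'h \<Rightarrow> 'b \<Rightarrow> 'b" where
  "nu h y = sw sB 2 h (\<lambda>a b. (a \<triangleright> y) * nuS b)"

lemma lin_invS: "lin s hs f \<Longrightarrow> lin s sB (\<lambda>x. invS (f x))" "lin hs sB invS"
  and lin_nuS: "lin s hs f \<Longrightarrow> lin s sB (\<lambda>x. nuS (f x))" "lin hs sB nuS"
  by (simp_all add: invS_def[abs_def] nuS_def[abs_def] lin_cross)

lemma bilin_mu: "bilinear_map hs sB sB mu" and bilin_nu: "bilinear_map hs sB sB nu"
  by (simp_all add: bilinear_map_def mu_def[abs_def] nu_def[abs_def] lin_cross lin_invS lin_nuS)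

lemmas lin_mu = lin_invS lin_nuS bilinear_mapD[OF bilin_mu] bilinear_mapD[OF bilin_nu]

lemmas sw_S_3 = sw_S[where n = 3 and m = 3] and sw_S_2 = sw_S[where n = 2 and m = 2]

lemmas relabel = sw_label[where n = 3 and m = 2] sw_label[where n = 4 and m = 2]

text \<open>The case x = 1 of \<open>nu_mu\<close>. \<open>act_\<sigma>i_\<sigma>\<close> replaces
  the action on \<sigma>^-1 by values of \<sigma> and \<sigma>^-1 with arguments S(h4) h5 and h2
  S(h3), and both of these collapse.\<close>

lemma sw_invS_\<sigma>: "sw sB 2 h (\<lambda>h1 r. sw sB 2 r (\<lambda>h2 r. sw sB 2 r (\<lambda>h3 h4. (h1 \<triangleright> invS h4) *
  \<sigma> h2 (S h3)))) =
    sB (eps h) 1" (is "?L = _")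
proof -
  have "?L = sw sB 2 h (\<lambda>p r. sw sB 2 r (\<lambda>q z. sw sB 2 p (\<lambda>x1 x2. sw sB 3 (S q) (\<lambda>y1 y2.
      (x1 \<triangleright> \<sigma>i y1 z) * \<sigma> x2 y2))))"
    by (simp add: relabel invS_def sw_norm sw_S_2 sw_skip)
  also have "\<dots> = sw sB 2 h (\<lambda>h1 r. sw sB 2 r (\<lambda>h2 r. sw sB 2 r (\<lambda>h3 r. sw sB 2 r (\<lambda>h4 r. sw sB 2 r
    (\<lambda>h5 h6.
      \<sigma> h1 (S h4 * h5) * \<sigma>i (h2 * S h3) h6)))))"
    unfolding act_\<sigma>i_\<sigma> by (simp add: relabel sw_norm sw_S_2 sw_skip)
  also have "\<dots> = sw sB 2 h (\<lambda>h2 r. sw sB 2 r (\<lambda>h3 h4. \<sigma>i (h2 * S h3) h4))"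
    by (subst sw_cancel(1)[where K = "\<lambda>a r. \<sigma> _ a * \<sigma>i (_ * S _) r"])
      (simp_all add: lin_cross \<sigma>_one_right sB_simps sw_eps sw_sB_pull del: B.scale_scale)
  also have "\<dots> = sB (eps h) 1"
    by (subst sw_cancel(2)[where K = "\<lambda>a r. \<sigma>i a r"]) (simp_all add: lin_cross \<sigma>i_one)
  finally show ?thesis .
qed

text \<open>Together with \<open>mu_nu\<close> this makes the passage between b \<otimes> b' # h and
  the coordinates E invertible. Once \<open>act_\<sigma>\<close> has carried \<sigma> to the left,
  the legs h3 and S(q1) acting on x are neighbours and cancel; x splits off and the case x = 1
  remains.\<close>

lemma nu_mu: "sw sB 2 h (\<lambda>a b. nu a (mu b x)) = sB (eps h) x" (is "?L = _")
proof -
  have "?L = sw sB 2 h (\<lambda>h1 r. sw sB 2 r (\<lambda>p r. sw sB 2 r (\<lambda>q w.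
      (h1 \<triangleright> invS w) * sw sB 2 p (\<lambda>h2 h3. sw sB 3 (S q) (\<lambda>g1 g2. ((h2 * g1) \<triangleright> x) * \<sigma> h3 g2)))))"
    by (simp add: nu_def mu_def nuS_def lin_mu relabel sw_norm sw_S_2 sw_skip
      measuring[where n = 2] act_mult)
  also have "\<dots> = sw sB 2 h (\<lambda>h1 r. sw sB 2 r (\<lambda>h2 r. sw sB 2 r (\<lambda>h3 r. sw sB 2 r (\<lambda>q1 r. sw sB 2 r
    (\<lambda>q2 w.
      (h1 \<triangleright> invS w) * (\<sigma> h2 (S q2) * ((h3 * S q1) \<triangleright> x)))))))"
    unfolding act_\<sigma> by (simp add: lin_mu relabel sw_norm sw_S_2 sw_skip)
  also have "\<dots> = sw sB 2 h (\<lambda>h1 r. sw sB 2 r (\<lambda>h2 r. sw sB 2 r (\<lambda>h3 h4. (h1 \<triangleright> invS h4) *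
    \<sigma> h2 (S h3)))) * x"
    by (subst sw_cancel(2)[where K = "\<lambda>a r. sw sB 2 r (\<lambda>q w. (_ \<triangleright> invS w) * (\<sigma> _ (S q) * (a \<triangleright> x)))"])
      (simp_all add: lin_mu sw_norm one_act)
  finally show ?thesis by (simp add: sw_invS_\<sigma> sB_simps)
qed

text \<open>The case y = 1 of \<open>mu_nu\<close>, obtained in the same way from
  \<open>\<sigma>i_act_\<sigma>\<close>.\<close>

lemma sw_\<sigma>i_nuS: "sw sB 2 h (\<lambda>h1 r. sw sB 2 r (\<lambda>h2 r. sw sB 2 r (\<lambda>h3 h4. \<sigma>i (S h2) h3 *
  (S h1 \<triangleright> nuS h4)))) =
    sB (eps h) 1" (is "?L = _")
proof -
  have "?L = sw sB 2 h (\<lambda>p r. sw sB 2 r (\<lambda>q z. sw sB 2 (S p) (\<lambda>x1 x2. sw sB 3 q (\<lambda>y1 y2.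
      \<sigma>i x1 y1 * (x2 \<triangleright> \<sigma> y2 (S z))))))"
    by (simp add: relabel nuS_def sw_norm sw_S_2 sw_skip)
  also have "\<dots> = sw sB 2 h (\<lambda>h1 r. sw sB 2 r (\<lambda>h2 r. sw sB 2 r (\<lambda>h3 r. sw sB 2 r (\<lambda>h4 r. sw sB 2 r
    (\<lambda>h5 h6.
      \<sigma> (S h2 * h3) (S h6) * \<sigma>i (S h1) (h4 * S h5))))))"
    unfolding \<sigma>i_act_\<sigma> by (simp add: relabel sw_norm sw_S_2 sw_skip)
  also have "\<dots> = sw sB 2 h (\<lambda>h2 r. sw sB 2 r (\<lambda>h3 h4. \<sigma> (S h2 * h3) (S h4)))"
    by (subst sw_cancel(2)[where K = "\<lambda>a r. \<sigma> (S _ * _) (S r) * \<sigma>i (S _) a"])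
      (simp_all add: lin_cross \<sigma>i_one counit_S sB_simps sw_eps sw_sB_pull del: B.scale_scale)
  also have "\<dots> = sB (eps h) 1"
    by (subst sw_cancel(1)[where K = "\<lambda>a r. \<sigma> a (S r)"]) (simp_all add: lin_cross \<sigma>_one_left counit_S)
  finally show ?thesis .
qed

lemma mu_nu: "sw sB 2 h (\<lambda>a b. mu a (nu b y)) = sB (eps h) y" (is "?L = _")
proof -
  have "?L = sw sB 2 h (\<lambda>h1 r. sw sB 2 r (\<lambda>p r. sw sB 2 r (\<lambda>q w.
      sw sB 2 (S p) (\<lambda>x1 x2. sw sB 3 q (\<lambda>y1 y2. \<sigma>i x1 y1 * ((x2 * y2) \<triangleright> y))) * (S h1 \<triangleright> nuS w))))"
    by (simp add: nu_def mu_def invS_def lin_mu relabel sw_norm sw_S_2 sw_skip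
      measuring[where n = 2] act_mult)
  also have "\<dots> = sw sB 2 h (\<lambda>h1 r. sw sB 2 r (\<lambda>h2 r. sw sB 2 r (\<lambda>h3 r. sw sB 2 r (\<lambda>h4 r. sw sB 2 r
    (\<lambda>h5 w.
      ((S h3 * h4) \<triangleright> y) * (\<sigma>i (S h2) h5 * (S h1 \<triangleright> nuS w)))))))"
    unfolding \<sigma>i_act by (simp add: lin_mu relabel sw_norm sw_S_2 sw_skip)
  also have "\<dots> = y * sw sB 2 h (\<lambda>h1 r. sw sB 2 r (\<lambda>h2 r. sw sB 2 r (\<lambda>h3 h4. \<sigma>i (S h2) h3 *
    (S h1 \<triangleright> nuS h4))))"
    by (subst sw_cancel(1)[where K = "\<lambda>a r. sw sB 2 r (\<lambda>q w. (a \<triangleright> y) * (\<sigma>i (S _) q * (S _ \<triangleright> nuS w)))"])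
      (simp_all add: lin_mu sw_norm one_act)
  finally show ?thesis by (simp add: sw_\<sigma>i_nuS sB_simps)
qed

text \<open>Moving x to the left of \<sigma>^-1 by \<open>\<sigma>i_act\<close> makes the legs S(h2)
  and h3 that act on it neighbours. The result leads to the second form \<open>mu_alt\<close> of
  \<open>mu\<close>, the one in which \<phi> is written.\<close>

lemma mu_act: "sw sB 2 h (\<lambda>a b. mu a (b \<triangleright> x)) = x * invS h" (is "?L = _")
proof -
  have "?L = sw sB 2 h (\<lambda>p q. sw sB 2 (S p) (\<lambda>x1 x2. sw sB 3 q (\<lambda>y1 y2. \<sigma>i x1 y1 * ((x2 * y2) \<triangleright> x))))"
    by (simp add: mu_def invS_def lin_mu relabel sw_norm sw_S_2 sw_skip act_mult)
  also have "\<dots> = sw sB 2 h (\<lambda>h1 r. sw sB 2 r (\<lambda>h2 r. sw sB 2 r (\<lambda>h3 h4.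
      ((S h2 * h3) \<triangleright> x) * \<sigma>i (S h1) h4)))"
    unfolding \<sigma>i_act by (simp add: lin_mu relabel sw_norm sw_S_2 sw_skip)
  also have "\<dots> = x * invS h"
    by (subst sw_cancel(1)[where K = "\<lambda>a r. (a \<triangleright> x) * \<sigma>i (S _) r"])
      (simp_all add: lin_mu sw_norm one_act invS_def)
  finally show ?thesis .
qed

lemma invS_one: "invS 1 = 1"
  by (simp add: invS_def sw_one lin_cross S_one \<sigma>i_one counit_one)

lemma mu_one: "mu 1 x = x" "mu h 1 = invS h"
  by (simp_all add: mu_def sw_one lin_mu lin_cross S_one one_act invS_one act_one counit_S sB_simps
    sw_eps del: B.scale_scale)

lemma mu_mult: "mu h (x * y) = sw sB 2 h (\<lambda>a b. mu b x * (S a \<triangleright> y))"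
  by (simp add: mu_def measuring[where n = 2] lin_mu sw_norm sw_S_2 sw_skip)

lemmas lin_all = lin_lam_rho lin_mu

lemmas sw_mu_pull = sw_pull[OF bilinear_mapD(2)[OF bilin_mu lin_id[OF vs_sB]]]
  sw_pull[OF bilinear_mapD(2)[OF bilin_nu lin_id[OF vs_sB]]]

lemma invS_3: "invS h = sw sB 3 h (\<lambda>a b. \<sigma>i (S a) b)"
  and mu_3: "mu h x = sw sB 3 h (\<lambda>a b. invS b * (S a \<triangleright> x))"
  by (simp_all add: invS_def mu_def sw_def)

lemmas sw_prod_53 = sw_prod[where n = 5 and m = 3 and l = 2]

text \<open>The case c = 1 of \<open>sw_mu_rho\<close>: condition (4) for \<sigma>^-1 in the
  arguments S(h1 g1), h2, g2, where a pair S(h) h then cancels.\<close>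

lemma sw_mu_\<sigma>i:
  "sw sB 2 h (\<lambda>h1 h2. sw sB 3 g (\<lambda>g1 g2. mu (h1 * g1) (\<sigma>i h2 g2))) =
    sw sB 2 h (\<lambda>h1 h2. sw sB 3 g (\<lambda>g1 g2. invS g2 * \<sigma>i (S g1 * S h1) h2))" (is "?L = ?R")
proof -
  \<comment> \<open>Label 5 marks the product S(g) S(h), which counts as a variable of its own until
    \<open>sw_prod_53\<close> splits it into a part for g (label 3) and a part for h (label
    2).\<close>
  have coc: "sw sB 5 x (\<lambda>x1 x2. sw sB 2 y (\<lambda>y1 y2. sw sB 3 z (\<lambda>z1 z2. \<sigma>i x1 (y1 * z1) *
    (x2 \<triangleright> \<sigma>i y2 z2)))) =
      sw sB 5 x (\<lambda>x1 x2. sw sB 2 y (\<lambda>y1 y2. \<sigma>i (x1 * y1) z * \<sigma>i x2 y2))" for x y z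
    using \<sigma>i_cocycle[of x y z] by (simp add: sw_def)
  have "?L = sw sB 2 h (\<lambda>p q. sw sB 3 g (\<lambda>p' q'. sw sB 5 (S p' * S p) (\<lambda>x1 x2. sw sB 2 q (\<lambda>y1 y2.
      sw sB 3 q' (\<lambda>z1 z2. \<sigma>i x1 (y1 * z1) * (x2 \<triangleright> \<sigma>i y2 z2))))))"
    by (simp add: mu_def invS_def lin_all sw_norm sw_skip sw_prod_23 sw_prod_53 sw_S_2 sw_S_3 S_mult)
  also have "\<dots> = sw sB 2 h (\<lambda>h1 r. sw sB 2 r (\<lambda>h2 r. sw sB 2 r (\<lambda>h3 h4. sw sB 3 g (\<lambda>g1 r. sw sB 3
    r (\<lambda>g2 g3.
      \<sigma>i (S g2 * (S h2 * h3)) g3 * \<sigma>i (S g1 * S h1) h4)))))"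
    unfolding coc
    by (simp add: lin_all sw_norm sw_skip sw_prod_23 sw_prod_53 sw_S_2 sw_S_3)
  also have "\<dots> = ?R"
    by (subst sw_cancel(1)[where K = "\<lambda>a r. sw sB 3 g (\<lambda>g1 q. sw sB 3 q (\<lambda>g2 g3.
          \<sigma>i (S g2 * a) g3 * \<sigma>i (S g1 * S _) r))"])
      (simp_all add: lin_all invS_3 sw_norm)
  finally show ?thesis .
qed

text \<open>\<open>mu_mult\<close> splits the value of the action off from \<sigma>^-1, which
  reduces the claim to c = 1. Then \<open>\<sigma>i_act\<close> returns it to the left of the
  remaining \<sigma>^-1, where a pair S(h2) h3 cancels.\<close>

lemma sw_mu_rho:
  "sw sB 2 h (\<lambda>h1 h2. sw sB 3 g (\<lambda>g1 g2. mu (h1 * g1) (rho h2 c g2))) =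
    sw sB 2 h (\<lambda>h1 h2. sw sB 3 g (\<lambda>g1 g2. mu g2 c * \<sigma>i (S g1 * S h1) h2))" (is "?L = ?R")
proof -
  have comm: "sw sB 5 h (\<lambda>h1 h2. sw sB 2 g (\<lambda>g1 g2. \<sigma>i h1 g1 * ((h2 * g2) \<triangleright> b))) =
      sw sB 5 h (\<lambda>h1 h2. sw sB 2 g (\<lambda>g1 g2. ((h1 * g1) \<triangleright> b) * \<sigma>i h2 g2))" for h g b
    using \<sigma>i_act[of h g b] by (simp add: sw_def)
  have "?L = sw sB 2 h (\<lambda>h1 r. sw sB 2 r (\<lambda>p q. sw sB 3 g (\<lambda>g1 p'.
      sw sB 2 p (\<lambda>h2 h3. sw sB 3 p' (\<lambda>g2 g3. mu (h2 * g2) (\<sigma>i h3 g3))) * ((S g1 * (S h1 * q)) \<triangleright> c))))"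
    by (simp add: rho_def lin_all sw_norm sw_skip sw_prod_23 sw_mu_pull mu_mult S_mult act_mult)
  also have "\<dots> = sw sB 2 h (\<lambda>p q. sw sB 3 g (\<lambda>p' q'. invS q' *
      (sw sB 5 (S p' * S p) (\<lambda>x1 x2. sw sB 2 q (\<lambda>y1 y2. \<sigma>i x1 y1 * ((x2 * y2) \<triangleright> c))))))"
    unfolding sw_mu_\<sigma>i
    by (simp add: lin_all sw_norm sw_skip sw_prod_53 sw_S_2 sw_S_3)
  also have "\<dots> = sw sB 2 h (\<lambda>h1 r. sw sB 2 r (\<lambda>h2 r. sw sB 2 r (\<lambda>h3 h4. sw sB 3 g (\<lambda>g1 r. sw sB 3
    r (\<lambda>g2 g3.
      invS g3 * (((S g2 * (S h2 * h3)) \<triangleright> c) * \<sigma>i (S g1 * S h1) h4))))))"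
    unfolding comm
    by (simp add: lin_all sw_norm sw_skip sw_prod_53 sw_S_2 sw_S_3)
  also have "\<dots> = ?R"
    by (subst sw_cancel(1)[where K = "\<lambda>a r. sw sB 3 g (\<lambda>g1 q. sw sB 3 q (\<lambda>g2 g3.
          invS g3 * (((S g2 * a) \<triangleright> c) * \<sigma>i (S g1 * S _) r)))"])
      (simp_all add: lin_all mu_3 sw_norm)
  finally show ?thesis .
qed

text \<open>With \<open>j h = 1 # h\<close> this is
  \<open>j\<^sup>-\<^sup>1(g) c j\<^sup>-\<^sup>1(h) b = j\<^sup>-\<^sup>1(h\<^sub>1 g\<^sub>1) rho h\<^sub>2 c g\<^sub>2 b\<close> in \<open>B #\<^sub>\<sigma> H\<close>.\<close>

lemma mu_cross:
  "sw sB 2 h (\<lambda>h1 h2. sw sB 3 g (\<lambda>g1 r. sw sB 3 r (\<lambda>g2 g3.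
      mu g3 c * ((S g2 \<triangleright> mu h2 b) * \<sigma> (S g1) (S h1))))) =
    sw sB 2 h (\<lambda>h1 h2. sw sB 3 g (\<lambda>g1 g2. mu (h1 * g1) (rho h2 c g2 * b)))" (is "?L = ?R")
proof -
  have comm: "sw sB 3 h (\<lambda>h1 h2. sw sB 2 g (\<lambda>g1 g2. ((h1 * g1) \<triangleright> b) * \<sigma> h2 g2)) =
      sw sB 3 h (\<lambda>h1 h2. sw sB 2 g (\<lambda>g1 g2. \<sigma> h1 g1 * ((h2 * g2) \<triangleright> b)))" for h g b
    using act_\<sigma>[of h g b] by (simp add: sw_def)
  have coc: "sw sB 3 x (\<lambda>x1 x2. sw sB 2 y (\<lambda>y1 y2. (x1 \<triangleright> \<sigma>i y1 z) * \<sigma> x2 y2)) =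
      sw sB 3 x (\<lambda>x1 x2. sw sB 2 y (\<lambda>y1 y2. sw sB 2 z (\<lambda>z1 z2. \<sigma> x1 (y1 * z1) * \<sigma>i (x2 * y2)
        z2)))" for x y z
    using act_\<sigma>i_\<sigma>[of x y z] by (simp add: sw_def)
  \<comment> \<open>First b crosses \<sigma> to the right (\<open>comm\<close>). The action on the
    \<sigma>^-1 inside \<open>invS\<close> is then adjacent to \<sigma> and is resolved by
    \<open>coc\<close>; after one cancellation the right side of \<open>sw_mu_rho\<close>
    appears.\<close>
  have "?L = sw sB 2 h (\<lambda>p q. sw sB 3 g (\<lambda>p' r. sw sB 3 r (\<lambda>g3 g4. mu g4 c * ((S g3 \<triangleright> invS q) *
      (sw sB 3 (S p') (\<lambda>x1 x2. sw sB 2 (S p) (\<lambda>y1 y2. ((x1 * y1) \<triangleright> b) * \<sigma> x2 y2)))))))"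
    by (simp add: mu_def[of _ b] lin_all sw_norm sw_skip sw_S_2 sw_S_3 measuring[where n = 3] act_mult)
  also have "\<dots> = sw sB 2 h (\<lambda>h1 r. sw sB 2 r (\<lambda>p z. sw sB 3 g (\<lambda>g1 r. sw sB 3 r (\<lambda>p' g4. mu g4 c *
      ((sw sB 3 (S p') (\<lambda>x1 x2. sw sB 2 (S p) (\<lambda>y1 y2. (x1 \<triangleright> \<sigma>i y1 z) * \<sigma> x2 y2))) * ((S g1 *
        S h1) \<triangleright> b))))))"
    unfolding comm
    by (simp add: invS_def lin_all sw_norm sw_skip sw_S_2 sw_S_3)
  also have "\<dots> = sw sB 2 h (\<lambda>h1 r. sw sB 2 r (\<lambda>h2 r. sw sB 2 r (\<lambda>h3 r. sw sB 2 r (\<lambda>h4 h5.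
      sw sB 3 g (\<lambda>g1 r. sw sB 3 r (\<lambda>g2 r. sw sB 3 r (\<lambda>g3 g4.
      mu g4 c * (\<sigma> (S g3) (S h3 * h4) * (\<sigma>i (S g2 * S h2) h5 * ((S g1 * S h1) \<triangleright> b))))))))))"
    unfolding coc
    by (simp add: lin_all sw_norm sw_skip sw_S_2 sw_S_3)
  also have "\<dots> = sw sB 2 h (\<lambda>h1 r. sw sB 2 r (\<lambda>h2 h3. sw sB 3 g (\<lambda>g1 r. sw sB 3 r (\<lambda>g2 g3.
      mu g3 c * (\<sigma>i (S g2 * S h2) h3 * ((S g1 * S h1) \<triangleright> b))))))"
    by (subst sw_cancel(1)[where K = "\<lambda>a r. sw sB 3 g (\<lambda>g1 q. sw sB 3 q (\<lambda>g2 q. sw sB 3 q (\<lambda>g3 g4.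
      mu g4 c * (\<sigma> (S g3) a * (\<sigma>i (S g2 * S _) r * ((S g1 * S _) \<triangleright> b))))))"])
      (simp_all add: lin_all sw_norm \<sigma>_one_right counit_S sB_simps sw_eps del: B.scale_scale)
  also have "\<dots> = sw sB 2 h (\<lambda>h1 p. sw sB 3 g (\<lambda>g1 p'.
      sw sB 2 p (\<lambda>h1 h2. sw sB 3 p' (\<lambda>g1 g2. mu g2 c * \<sigma>i (S g1 * S h1) h2)) * ((S g1 * S h1) \<triangleright> b)))"
    by (simp add: lin_all sw_norm sw_skip)
  also have "\<dots> = ?R"
    unfolding sw_mu_rho[symmetric]
    by (simp add: lin_all sw_norm sw_skip sw_prod_23 mu_mult S_mult)
  finally show ?thesis .
qed

end

section \<open>Bialgebroids in antipode-free coordinates\<close>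

definition lmap :: "('k::field, 'l, 'z) module_scheme \<Rightarrow> ('k \<Rightarrow> 'w::ab_group_add \<Rightarrow> 'w) \<Rightarrow> ('l \<Rightarrow> 'w) \<Rightarrow>
  bool" where
  "lmap L s f \<longleftrightarrow> (\<forall>U\<in>carrier L. (\<forall>V\<in>carrier L. f (U \<oplus>\<^bsub>L\<^esub> V) = f U + f V) \<and>
    (\<forall>r. f (r \<odot>\<^bsub>L\<^esub> U) = s r (f U)))"

definition bilmap :: "('k::field, 'l, 'z) module_scheme \<Rightarrow> ('k \<Rightarrow> 'w::ab_group_add \<Rightarrow> 'w) \<Rightarrow>
    ('l \<Rightarrow> 'l \<Rightarrow> 'w) \<Rightarrow> bool" where
  "bilmap L s \<Psi> \<longleftrightarrow> (\<forall>V\<in>carrier L. lmap L s (\<lambda>U. \<Psi> U V)) \<and> (\<forall>U\<in>carrier L. lmap L s (\<lambda>V. \<Psi> U V))"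

lemma lmap_comp: "lmap L t f \<Longrightarrow> lin t u \<beta> \<Longrightarrow> lmap L u (\<lambda>U. \<beta> (f U))"
  by (auto simp: lmap_def linD)

locale k_module =
  fixes L :: "('k::field, 'l, 'z) module_scheme" (structure)
  assumes L_module: "Module.module (ring_of_type_algebra :: 'k ring) L"
begin

sublocale LM: Module.module "ring_of_type_algebra :: 'k ring" L by (rule L_module)

lemma smult_closed [simp]: "U \<in> carrier L \<Longrightarrow> r \<odot> U \<in> carrier L"
  by (rule LM.smult_closed) (simp_all add: ring_of_type_algebra_def)

lemma lmapD:
  assumes "lmap L t f"
  shows "U \<in> carrier L \<Longrightarrow> V \<in> carrier L \<Longrightarrow> f (U \<oplus> V) = f U + f V"
    "U \<in> carrier L \<Longrightarrow> f (r \<odot> U) = t r (f U)" "f \<zero> = 0"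
proof -
  show 1: "\<And>U V. U \<in> carrier L \<Longrightarrow> V \<in> carrier L \<Longrightarrow> f (U \<oplus> V) = f U + f V"
    and "\<And>U r. U \<in> carrier L \<Longrightarrow> f (r \<odot> U) = t r (f U)"
    using assms by (auto simp: lmap_def)
  show "f \<zero> = 0" using 1[of \<zero> \<zero>] by simp
qed

lemma lsum_closed: "set Us \<subseteq> carrier L \<Longrightarrow> lsum L Us \<in> carrier L"
  by (induction Us) (auto simp: lsum_def)

lemma lmap_lsum: "lmap L t f \<Longrightarrow> set Us \<subseteq> carrier L \<Longrightarrow> f (lsum L Us) = (\<Sum>U\<leftarrow>Us. f U)"
proof (induction Us)
  case (Cons U Us)
  moreover have "lsum L Us \<in> carrier L" using Cons.prems by (intro lsum_closed) auto
  ultimately show ?case by (auto simp: lsum_def lmapD)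
qed (simp add: lsum_def lmapD)

end

text \<open>\<open>E b h x\<close> stands for \<open>s(b) t(x) E 1 h 1\<close> and identifies \<open>B \<otimes> H \<otimes> B\<close> with the
  bialgebroid.\<close>

locale presented_module = crossed H sB act \<sigma> \<sigma>i + k_module L
  for H :: "('k::field, 'h::{ring, monoid_mult}) hopf"
    and sB :: "'k \<Rightarrow> 'b::{ring, monoid_mult} \<Rightarrow> 'b"
    and act :: "'h \<Rightarrow> 'b \<Rightarrow> 'b" (infixr "\<triangleright>" 75)
    and \<sigma> \<sigma>i :: "'h \<Rightarrow> 'h \<Rightarrow> 'b"
    and L :: "('k, 'b, 'l) bialgebroid" (structure) +
  fixes E :: "'b \<Rightarrow> 'h \<Rightarrow> 'b \<Rightarrow> 'l"
  assumes E_closed: "E b h x \<in> carrier L"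
    and L_sep: "U \<in> carrier L \<Longrightarrow> V \<in> carrier L \<Longrightarrow> (\<And>f. lmap L kmul f \<Longrightarrow> f U = f V) \<Longrightarrow> U = V"
    and E_test: "lmap L kmul f \<Longrightarrow> trilinear_map sB hs sB kmul (\<lambda>b h x. f (E b h x))"
    and E_span: "U \<in> carrier L \<Longrightarrow> \<exists>xs. U = lsum L (map (\<lambda>(b, h, x). E b h x) xs)"
    and E_lift: "trilinear_map sB hs sB kmul G \<Longrightarrow>
      \<exists>f. lmap L kmul f \<and> (\<forall>b h x. f (E b h x) = G b h x)"
begin

text \<open>The locale assumes trilinearity under k-valued functionals only; functionals on the
  target separate its points, so it holds for every target.\<close>

lemma E_tri:
  assumes f: "lmap L t f" and t: "vector_space t"
  shows "trilinear_map sB hs sB t (\<lambda>b h x. f (E b h x))"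
  unfolding trilinear_map_def
proof (intro conjI allI linI t vs_sB vs_hs; rule functional_ext[OF t])
  fix \<beta> :: "'a \<Rightarrow> 'k" and b b' x x' :: 'b and h h' :: 'h and r :: 'k
  assume \<beta>: "lin t kmul \<beta>"
  note [simp] = trilinear_mapD[OF E_test[OF lmap_comp[OF f \<beta>]], THEN linD(1), OF lin_id]
    trilinear_mapD[OF E_test[OF lmap_comp[OF f \<beta>]], THEN linD(2), OF lin_id] linD[OF \<beta>] vs_sB vs_hs
  show "\<beta> (f (E (b + b') h x)) = \<beta> (f (E b h x) + f (E b' h x))"
    "\<beta> (f (E b (h + h') x)) = \<beta> (f (E b h x) + f (E b h' x))"
    "\<beta> (f (E b h (x + x'))) = \<beta> (f (E b h x) + f (E b h x'))"
    "\<beta> (f (E (sB r b) h x)) = \<beta> (t r (f (E b h x)))"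
    "\<beta> (f (E b (hs r h) x)) = \<beta> (t r (f (E b h x)))"
    "\<beta> (f (E b h (sB r x))) = \<beta> (t r (f (E b h x)))"
    by simp_all
qed

lemma lmap_eqI:
  assumes "lmap L t f" "lmap L t g" "\<And>b h x. f (E b h x) = g (E b h x)" "U \<in> carrier L"
  shows "f U = g U"
proof -
  obtain xs where xs: "U = lsum L (map (\<lambda>(b, h, x). E b h x) xs)"
    using E_span[OF assms(4)] by blast
  have sub: "set (map (\<lambda>(b, h, x). E b h x) xs) \<subseteq> carrier L" by (auto simp: E_closed)
  show ?thesis
    unfolding xs lmap_lsum[OF assms(1) sub] lmap_lsum[OF assms(2) sub]
    by (intro arg_cong[of _ _ sum_list]) (auto simp: assms(3))
qed

lemma E_add: "E (b + b') h x = E b h x \<oplus> E b' h x"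
  and E_scale: "E (sB r b) h x = r \<odot> E b h x"
  by (rule L_sep; simp add: E_closed lmapD linD[OF trilinear_mapD(1)[OF E_test lin_id[OF vs_sB]]])+

lemma E_add3: "E b h (x + x') = E b h x \<oplus> E b h x'"
  and E_scale3: "E b h (sB r x) = r \<odot> E b h x"
  by (rule L_sep; simp add: E_closed lmapD linD[OF trilinear_mapD(3)[OF E_test lin_id[OF vs_sB]]])+

end

text \<open>In these coordinates the coring structure does not mention \<sigma>, so twisting the
  product leaves it untouched. The coproduct formula is required under every k-bilinear \<Psi>,
  balanced over B or not.\<close>

locale presented_coring = presented_module +
  assumes src_E: "src L b = E b 1 1"
    and tgt_E: "tgt L b = E 1 1 b"
    and comult_L_closed: "U \<in> carrier L \<Longrightarrow> set (comult L U) \<subseteq> carrier L \<times> carrier L"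
    and comult_lmap: "bilmap L kmul \<Psi> \<Longrightarrow> lmap L kmul (\<lambda>U. \<Sum>(U1, U2)\<leftarrow>comult L U. \<Psi> U1 U2)"
    and comult_E: "bilmap L kmul \<Psi> \<Longrightarrow> (\<Sum>(U1, U2)\<leftarrow>comult L (E b h x). \<Psi> U1 U2) =
      sw kmul 2 h (\<lambda>h1 h2. \<Psi> (E b h1 1) (E 1 h2 x))"
    and counit_lmap: "lmap L sB (counit L)"
    and counit_E: "counit L (E b h x) = sB (eps h) (b * x)"

locale presented = presented_coring +
  assumes one_E: "\<one> = E 1 1 1"
    and mult_closed: "U \<in> carrier L \<Longrightarrow> V \<in> carrier L \<Longrightarrow> U \<otimes> V \<in> carrier L"
    and mult_lmap1: "V \<in> carrier L \<Longrightarrow> lmap L kmul f \<Longrightarrow> lmap L kmul (\<lambda>U. f (U \<otimes> V))"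
    and mult_lmap2: "U \<in> carrier L \<Longrightarrow> lmap L kmul f \<Longrightarrow> lmap L kmul (\<lambda>V. f (U \<otimes> V))"
    and mult_E_test: "lmap L kmul f \<Longrightarrow> f (E b h x \<otimes> E c g y) =
      sw kmul 2 h (\<lambda>h1 r. sw kmul 2 r (\<lambda>h2 h3. sw kmul 3 g (\<lambda>g1 q. sw kmul 3 q (\<lambda>g2 g3.
        f (E (b * lam h1 c g1) (h2 * g2) (rho h3 y g3 * x))))))"
begin

lemma mult_E:
  assumes f: "lmap L t f" and t: "vector_space t"
  shows "f (E b h x \<otimes> E c g y) =
    sw t 2 h (\<lambda>h1 r. sw t 2 r (\<lambda>h2 h3. sw t 3 g (\<lambda>g1 q. sw t 3 q (\<lambda>g2 g3.
      f (E (b * lam h1 c g1) (h2 * g2) (rho h3 y g3 * x))))))"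
proof (rule functional_ext[OF t])
  fix \<beta> assume \<beta>: "lin t kmul \<beta>"
  show "\<beta> (f (E b h x \<otimes> E c g y)) = \<beta> (sw t 2 h (\<lambda>h1 r. sw t 2 r (\<lambda>h2 h3. sw t 3 g (\<lambda>g1 q. sw t 3
    q (\<lambda>g2 g3.
      f (E (b * lam h1 c g1) (h2 * g2) (rho h3 y g3 * x)))))))"
    by (simp add: mult_E_test[OF lmap_comp[OF f \<beta>]] sw_pull[OF \<beta>])
qed

lemma mult_add:
  assumes "U \<in> carrier L" "V \<in> carrier L" "W \<in> carrier L"
  shows "(U \<oplus> V) \<otimes> W = U \<otimes> W \<oplus> V \<otimes> W" "W \<otimes> (U \<oplus> V) = W \<otimes> U \<oplus> W \<otimes> V"
  by (rule L_sep; simp add: assms mult_closed lmapD lmapD(1)[OF mult_lmap1] lmapD(1)[OF mult_lmap2])+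

lemma mult_smult:
  assumes "U \<in> carrier L" "V \<in> carrier L"
  shows "(r \<odot> U) \<otimes> V = r \<odot> (U \<otimes> V)" "U \<otimes> (r \<odot> V) = r \<odot> (U \<otimes> V)"
  by (rule L_sep; simp add: assms mult_closed lmapD lmapD(2)[OF mult_lmap1] lmapD(2)[OF mult_lmap2])+

lemma mult_lmap:
  assumes "lmap L t f"
  shows "V \<in> carrier L \<Longrightarrow> lmap L t (\<lambda>U. f (U \<otimes> V))" "U \<in> carrier L \<Longrightarrow> lmap L t (\<lambda>V. f (U \<otimes> V))"
  using assms by (auto simp: lmap_def mult_add mult_smult mult_closed)

lemma E_test_scale:
  assumes "lmap L kmul f"
  shows "f (E (sB r b) h x) = r * f (E b h x)" "f (E b h (sB r x)) = r * f (E b h x)"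
  using linD(2)[OF trilinear_mapD(1)[OF E_test[OF assms] lin_id[OF vs_sB]]]
    linD(2)[OF trilinear_mapD(3)[OF E_test[OF assms] lin_id[OF vs_sB]]] by auto

lemma mult_E_label: "lmap L kmul f \<Longrightarrow> f (E b h x \<otimes> E c g y) =
    sw kmul n h (\<lambda>h1 r. sw kmul n r (\<lambda>h2 h3. sw kmul m g (\<lambda>g1 q. sw kmul m q (\<lambda>g2 g3.
      f (E (b * lam h1 c g1) (h2 * g2) (rho h3 y g3 * x))))))"
  by (simp add: mult_E_test sw_def)

lemma src_mult_E: "src L e \<otimes> E b h x = E (e * b) h x"
  and tgt_mult_E: "tgt L e \<otimes> E b h x = E b h (x * e)"
proof -
  have "f (src L e \<otimes> E b h x) = f (E (e * b) h x) \<and> f (tgt L e \<otimes> E b h x) = f (E b h (x * e))"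
    if f: "lmap L kmul f" for f
    by (simp add: trilinear_mapD[OF E_test[OF f]] E_test_scale[OF f] src_E tgt_E mult_E_test[OF f]
      sw_one lin_all lam_one rho_one sB_simps sw_eps_k one_act)
  then show "src L e \<otimes> E b h x = E (e * b) h x" "tgt L e \<otimes> E b h x = E b h (x * e)"
    by (auto intro!: L_sep simp: E_closed mult_closed src_E tgt_E)
qed

text \<open>As \<sigma> and \<sigma>^-1 are normalised, right multiplication by s(e) involves only
  the action; the same holds for t(e) in the other outer coordinate.\<close>

lemma E_mult_src: 
  assumes "lmap L t f" "vector_space t"
  shows "f (E b h x \<otimes> src L e) = sw t 2 h (\<lambda>h1 h2. f (E (b * (h1 \<triangleright> e)) h2 x))"
proof (rule functional_ext[OF assms(2)])
  fix \<beta> assume \<beta>: "lin t kmul \<beta>"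
  note f = lmap_comp[OF assms(1) \<beta>]
  show "\<beta> (f (E b h x \<otimes> src L e)) = \<beta> (sw t 2 h (\<lambda>h1 h2. f (E (b * (h1 \<triangleright> e)) h2 x)))"
    by (simp add: trilinear_mapD[OF E_test[OF f]] E_test_scale[OF f] src_E mult_E_test[OF f]
      sw_one lin_all lam_one rho_one sB_simps sw_eps_k one_act act_one \<sigma>i_one
      sw_pull[OF \<beta>])
qed

lemma E_mult_tgt: 
  assumes "lmap L t f" "vector_space t"
  shows "f (E b h x \<otimes> tgt L e) = sw t 2 h (\<lambda>h1 h2. f (E b h1 ((h2 \<triangleright> e) * x)))"
proof (rule functional_ext[OF assms(2)])
  fix \<beta> assume \<beta>: "lin t kmul \<beta>"
  note f = lmap_comp[OF assms(1) \<beta>]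
  show "\<beta> (f (E b h x \<otimes> tgt L e)) = \<beta> (sw t 2 h (\<lambda>h1 h2. f (E b h1 ((h2 \<triangleright> e) * x))))"
    by (simp add: trilinear_mapD[OF E_test[OF f]] E_test_scale[OF f] tgt_E mult_E_test[OF f]
      sw_one lin_all lam_one rho_one sB_simps sw_eps_k one_act act_one \<sigma>_one_right
      sw_pull[OF \<beta>])
qed

text \<open>On generators the two outer coordinates separate: the left one is settled by
  \<open>lam_lam\<close>, the right one by \<open>rho_rho\<close>. The general case follows by
  extending one argument at a time.\<close>

lemma mult_assoc:
  assumes "U \<in> carrier L" "V \<in> carrier L" "W \<in> carrier L"
  shows "(U \<otimes> V) \<otimes> W = U \<otimes> (V \<otimes> W)"
proof (rule L_sep)
  fix f assume f: "lmap L kmul f"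
  have gen: "f ((E b h x \<otimes> E c g y) \<otimes> E d k z) = f (E b h x \<otimes> (E c g y \<otimes> E d k z))" (is "?L = ?R")
    for b h x c g y d k z
  proof -
    note F = trilinear_mapD[OF E_test[OF f]]
    note F_pull = sw_pull[OF F(1)[OF lin_id[OF vs_sB]]] sw_pull[OF F(3)[OF lin_id[OF vs_sB]]]
    have "?L = sw kmul 2 h (\<lambda>p r. sw kmul 2 r (\<lambda>h3 q. sw kmul 3 g (\<lambda>p' r'. sw kmul 3 r' (\<lambda>g3 q'.
        sw kmul 4 k (\<lambda>k1 r''. sw kmul 4 r'' (\<lambda>k2 k3.
        f (E (b * sw sB 2 p (\<lambda>h1 h2. sw sB 3 p' (\<lambda>g1 g2. lam h1 c g1 * lam (h2 * g2) d k1)))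
          (h3 * (g3 * k2))
          (sw sB 2 q (\<lambda>h1 h2. sw sB 3 q' (\<lambda>g1 g2. rho (h1 * g1) z k3 * rho h2 y g2)) * x))))))))"
      by (simp add: mult_E_label[OF mult_lmap1[OF E_closed f], where n = 2 and m = 3]
        mult_E_label[OF f, where n = 2 and m = 4] F F_pull lin_all sw_norm sw_skip sw_prod_23)
    also have "\<dots> = ?R"
      unfolding lam_lam rho_rho
      by (simp add: mult_E_label[OF mult_lmap2[OF E_closed f], where n = 3 and m = 4]
        mult_E_label[OF f, where n = 2 and m = 3] F F_pull lin_all sw_norm sw_skip
        sw_prod[where n = 3 and m = 3 and l = 4])
    finally show ?thesis .
  qed
  have gen2: "f (U \<otimes> E c g y \<otimes> E d k z) = f (U \<otimes> (E c g y \<otimes> E d k z))"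
    if "U \<in> carrier L" for U c g y d k z
    by (rule lmap_eqI[OF mult_lmap(1)[OF mult_lmap(1)[OF f]] mult_lmap(1)[OF f] gen that])
      (simp_all add: E_closed mult_closed)
  have gen3: "f (U \<otimes> V \<otimes> E d k z) = f (U \<otimes> (V \<otimes> E d k z))"
    if "U \<in> carrier L" "V \<in> carrier L" for U V d k z
    by (rule lmap_eqI[OF mult_lmap(2)[OF mult_lmap(1)[OF f]] mult_lmap(1)[OF mult_lmap(2)[OF f]]
      gen2 that(2)])
      (simp_all add: E_closed that)
  show "f (U \<otimes> V \<otimes> W) = f (U \<otimes> (V \<otimes> W))"
    by (rule lmap_eqI[OF mult_lmap(2)[OF f] mult_lmap(2)[OF mult_lmap(2)[OF f]] gen3 assms(3)])
      (simp_all add: assms mult_closed)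
qed (simp_all add: assms mult_closed)

lemma src_closed: "src L b \<in> carrier L" and tgt_closed: "tgt L b \<in> carrier L"
  by (simp_all add: src_E tgt_E E_closed)

lemma L_ring: "ring L"
proof (rule ringI)
  show "abelian_group L" by (rule LM.abelian_group_axioms)
  have one: "\<one> = src L 1" "\<one> \<in> carrier L" by (simp_all add: one_E src_E E_closed)
  have "\<one> \<otimes> U = U" if "U \<in> carrier L" for U
  proof (rule L_sep)
    fix f assume f: "lmap L kmul f"
    show "f (\<one> \<otimes> U) = f U"
      by (rule lmap_eqI[OF mult_lmap(2)[OF f one(2)] f _ that])
        (unfold one(1), simp add: src_mult_E)
  qed (simp_all add: that one(2) mult_closed)
  moreover have "U \<otimes> \<one> = U" if "U \<in> carrier L" for U
  proof (rule L_sep)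
    fix f assume f: "lmap L kmul f"
    show "f (U \<otimes> \<one>) = f U"
      by (rule lmap_eqI[OF mult_lmap(1)[OF f one(2)] f _ that])
        (unfold one(1), simp add: E_mult_src[OF f vs_kmul] act_one sB_simps E_test_scale[OF f]
          sw_eps_k trilinear_mapD[OF E_test[OF f]] lin_cross)
  qed (simp_all add: that one(2) mult_closed)
  ultimately show "monoid L"
    by unfold_locales (simp_all add: mult_closed mult_assoc one(2))
qed (simp_all add: mult_add)

text \<open>Scalars lie in the images of both s and t; therefore balancing over B includes balancing
  over k.\<close>

lemma smult_mult:
  assumes "U \<in> carrier L"
  shows "src L (sB r 1) \<otimes> U = r \<odot> U" "tgt L (sB r 1) \<otimes> U = r \<odot> U"
proof -
  have "src L (sB r 1) = r \<odot> \<one>" "tgt L (sB r 1) = r \<odot> \<one>"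
    by (simp_all add: src_E tgt_E one_E E_scale E_scale3)
  then show "src L (sB r 1) \<otimes> U = r \<odot> U" "tgt L (sB r 1) \<otimes> U = r \<odot> U"
    using ring.ring_simprules(6)[OF L_ring] ring.ring_simprules(12)[OF L_ring] assms
    by (simp_all add: mult_smult E_closed one_E)
qed

lemma smult_simps:
  assumes "U \<in> carrier L"
  shows "(r + r') \<odot> U = r \<odot> U \<oplus> r' \<odot> U" "0 \<odot> U = \<zero>" "1 \<odot> U = U" "r \<odot> (r' \<odot> U) = (r * r') \<odot> U"
    "V \<in> carrier L \<Longrightarrow> r \<odot> (U \<oplus> V) = r \<odot> U \<oplus> r \<odot> V" "r \<odot> \<zero> = \<zero>"
  by (rule L_sep; simp add: assms lmapD algebra_simps)+

text \<open>\<open>fsum_cong_by_functionals\<close> with k acting on the first factor. Homogeneity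
  in the second factor is the balancing relation at b = \<open>sB r 1\<close>.\<close>

lemma btens2_testI:
  assumes sub: "set xs \<subseteq> carrier L \<times> carrier L" "set ys \<subseteq> carrier L \<times> carrier L"
    and test: "\<And>\<Psi>. bilmap L kmul \<Psi> \<Longrightarrow> (\<And>U V b. U \<in> carrier L \<Longrightarrow> V \<in> carrier L \<Longrightarrow>
      \<Psi> (tgt L b \<otimes> U) V = \<Psi> U (src L b \<otimes> V)) \<Longrightarrow> (\<Sum>(U, V)\<leftarrow>xs. \<Psi> U V) = (\<Sum>(U, V)\<leftarrow>ys. \<Psi> U V)"
  shows "fsum_cong (btens2_rel L) xs ys"
proof -
  let ?sc = "\<lambda>r (U, V). (r \<odot> U, V)"
  interpret scaled_fsum "btens2_rel L" "carrier L \<times> carrier L" ?sc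
  proof
    fix xs ys and r :: 'a assume R: "btens2_rel L xs ys"
    then show "set xs \<subseteq> carrier L \<times> carrier L \<and> set ys \<subseteq> carrier L \<times> carrier L"
      by cases (auto simp: mult_closed src_closed tgt_closed)
    from R show "fsum_cong (btens2_rel L) (map (?sc r) xs) (map (?sc r) ys)"
      by cases (auto intro!: fsum_cong.gen btens2_rel.intros
        simp: mult_smult(2)[symmetric] src_closed tgt_closed smult_simps)
  next
    fix x r r' assume "x \<in> carrier L \<times> carrier L"
    then obtain U V where "x = (U, V)" "(U, V) \<in> carrier L \<times> carrier L" by auto
    then show "fsum_cong (btens2_rel L) [?sc (r + r') x] [?sc r x, ?sc r' x]"
      using fsum_cong.gen[where R = "btens2_rel L", OF btens2_rel.intros(1)[of "r \<odot> U" L "r' \<odot> U" V]]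
      by (simp add: smult_simps)
  qed (auto simp: smult_simps fsum_cong.refl intro: fsum_cong.gen[where R = "btens2_rel L",
    OF btens2_rel.intros(3)])
  show ?thesis
  proof (rule fsum_cong_by_functionals[OF sub])
    fix F assume F_sc: "\<And>r x. x \<in> carrier L \<times> carrier L \<Longrightarrow> F (?sc r x) = r * F x"
      and F_R: "\<And>xs ys. btens2_rel L xs ys \<Longrightarrow> (\<Sum>x\<leftarrow>xs. F x) = (\<Sum>x\<leftarrow>ys. F x)"
    have bal: "F (tgt L b \<otimes> U, V) = F (U, src L b \<otimes> V)" if "U \<in> carrier L" "V \<in> carrier L" for U V b
      using F_R[OF btens2_rel.intros(5)[OF that]] by simp
    have "bilmap L kmul (\<lambda>U V. F (U, V))"
      unfolding bilmap_def lmap_def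
    proof (intro ballI conjI allI)
      fix U V W r assume UVW: "U \<in> carrier L" "V \<in> carrier L" "W \<in> carrier L"
      show "F (U \<oplus> V, W) = F (U, W) + F (V, W)" "F (W, U \<oplus> V) = F (W, U) + F (W, V)"
        using F_R[OF btens2_rel.intros(1)[OF UVW]] F_R[OF btens2_rel.intros(2)[OF UVW(3,1,2)]] by auto
    next
      fix U V r assume UV: "U \<in> carrier L" "V \<in> carrier L"
      show "F (U, r \<odot> V) = r * F (U, V)"
        using F_sc[of "(U, V)" r] bal[OF UV, of "sB r 1"] UV by (simp add: smult_mult)
      show "F (r \<odot> V, U) = r * F (V, U)"
        using F_sc[of "(V, U)" r] UV by simp
    qed
    from test[OF this bal] show "(\<Sum>x\<leftarrow>xs. F x) = (\<Sum>x\<leftarrow>ys. F x)" by simp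
  qed
qed

text \<open>The test functions are merely k-multilinear: this is enough for coassociativity, which
  in coordinates already holds over k.\<close>

lemma btens3_testI:
  assumes sub: "set xs \<subseteq> carrier L \<times> carrier L \<times> carrier L" "set ys \<subseteq> carrier L \<times> carrier L \<times> carrier L"
    and test: "\<And>\<Psi>. (\<And>W. W \<in> carrier L \<Longrightarrow> bilmap L kmul (\<lambda>U V. \<Psi> U V W)) \<Longrightarrow>
      (\<And>U. U \<in> carrier L \<Longrightarrow> bilmap L kmul (\<lambda>V W. \<Psi> U V W)) \<Longrightarrow>
      (\<Sum>(U, V, W)\<leftarrow>xs. \<Psi> U V W) = (\<Sum>(U, V, W)\<leftarrow>ys. \<Psi> U V W)"
  shows "fsum_cong (btens3_rel L) xs ys"
proof -
  let ?sc = "\<lambda>r (U, V, W). (r \<odot> U, V, W)"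
  interpret scaled_fsum "btens3_rel L" "carrier L \<times> carrier L \<times> carrier L" ?sc
  proof
    fix xs ys and r :: 'a assume R: "btens3_rel L xs ys"
    then show "set xs \<subseteq> carrier L \<times> carrier L \<times> carrier L \<and> set ys \<subseteq> carrier L \<times> carrier L \<times> carrier L"
      by cases (auto simp: mult_closed src_closed tgt_closed)
    from R show "fsum_cong (btens3_rel L) (map (?sc r) xs) (map (?sc r) ys)"
      by cases (auto intro!: fsum_cong.gen btens3_rel.intros
        simp: mult_smult(2)[symmetric] src_closed tgt_closed smult_simps)
  next
    fix x r r' assume "x \<in> carrier L \<times> carrier L \<times> carrier L"
    then obtain U V W where "x = (U, V, W)" "(U, V, W) \<in> carrier L \<times> carrier L \<times> carrier L" by auto
    then show "fsum_cong (btens3_rel L) [?sc (r + r') x] [?sc r x, ?sc r' x]"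
      using fsum_cong.gen[where R = "btens3_rel L", OF btens3_rel.intros(1)[of "r \<odot> U" L "r' \<odot> U" V W]]
      by (simp add: smult_simps)
  qed (auto simp: smult_simps fsum_cong.refl intro: fsum_cong.gen[where R = "btens3_rel L",
    OF btens3_rel.intros(4)])
  show ?thesis
  proof (rule fsum_cong_by_functionals[OF sub])
    fix F assume F_sc: "\<And>r x. x \<in> carrier L \<times> carrier L \<times> carrier L \<Longrightarrow> F (?sc r x) = r * F x"
      and F_R: "\<And>xs ys. btens3_rel L xs ys \<Longrightarrow> (\<Sum>x\<leftarrow>xs. F x) = (\<Sum>x\<leftarrow>ys. F x)"
    have add: "F (U \<oplus> V, W, Z) = F (U, W, Z) + F (V, W, Z)" "F (W, U \<oplus> V, Z) = F (W, U, Z) + F (W,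
      V, Z)"
      "F (W, Z, U \<oplus> V) = F (W, Z, U) + F (W, Z, V)"
      if "U \<in> carrier L" "V \<in> carrier L" "W \<in> carrier L" "Z \<in> carrier L" for U V W Z
      using F_R[OF btens3_rel.intros(1)[OF that]] F_R[OF btens3_rel.intros(2)[OF that(3,1,2,4)]]
        F_R[OF btens3_rel.intros(3)[OF that(3,4,1,2)]] by auto
    have sc: "F (r \<odot> U, V, W) = r * F (U, V, W)" "F (U, r \<odot> V, W) = r * F (U, V, W)"
      "F (U, V, r \<odot> W) = r * F (U, V, W)"
      if UVW: "U \<in> carrier L" "V \<in> carrier L" "W \<in> carrier L" for U V W r
    proof -
      show 1: "F (r \<odot> U, V, W) = r * F (U, V, W)" using F_sc[of "(U, V, W)" r] UVW by simp
      show 2: "F (U, r \<odot> V, W) = r * F (U, V, W)"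
        using F_R[OF btens3_rel.intros(7)[OF UVW, of "sB r 1"]] UVW 1 by (simp add: smult_mult)
      show "F (U, V, r \<odot> W) = r * F (U, V, W)"
        using F_R[OF btens3_rel.intros(8)[OF UVW, of "sB r 1"]] UVW 2 by (simp add: smult_mult)
    qed
    have "(\<Sum>(U, V, W)\<leftarrow>xs. F (U, V, W)) = (\<Sum>(U, V, W)\<leftarrow>ys. F (U, V, W))"
      by (rule test) (auto simp: bilmap_def lmap_def add sc)
    then show "(\<Sum>x\<leftarrow>xs. F x) = (\<Sum>x\<leftarrow>ys. F x)" by simp
  qed
qed

end

section \<open>Sums over the coproduct as linear maps\<close>

context presented_coring
begin

definition cs where
  "cs \<Psi> U = (\<Sum>(U1, U2)\<leftarrow>comult L U. \<Psi> U1 U2)"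

lemma cs_cong:
  assumes "U \<in> carrier L" "\<And>U1 U2. U1 \<in> carrier L \<Longrightarrow> U2 \<in> carrier L \<Longrightarrow> \<Psi> U1 U2 = \<Psi>' U1 U2"
  shows "cs \<Psi> U = cs \<Psi>' U"
  unfolding cs_def using comult_L_closed[OF assms(1)] assms(2)
  by (intro arg_cong[of _ _ sum_list] map_cong) auto

lemma bilmapI:
  assumes "\<And>V. V \<in> carrier L \<Longrightarrow> lmap L t (\<lambda>U. \<Psi> U V)" "\<And>U. U \<in> carrier L \<Longrightarrow> lmap L t (\<lambda>V. \<Psi> U V)"
  shows "bilmap L t \<Psi>"
  using assms by (auto simp: bilmap_def)

lemma bilmapD:
  assumes "bilmap L t \<Psi>"
  shows "V \<in> carrier L \<Longrightarrow> lmap L t (\<lambda>U. \<Psi> U V)" "U \<in> carrier L \<Longrightarrow> lmap L t (\<lambda>V. \<Psi> U V)"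
  using assms by (auto simp: bilmap_def)

lemma bilmap_comp: "bilmap L t \<Psi> \<Longrightarrow> lin t u \<beta> \<Longrightarrow> bilmap L u (\<lambda>U V. \<beta> (\<Psi> U V))"
  by (auto simp: bilmap_def intro: lmap_comp)

lemma cs_apply: "lin t u \<beta> \<Longrightarrow> \<beta> (cs \<Psi> U) = cs (\<lambda>U V. \<beta> (\<Psi> U V)) U"
  by (simp add: cs_def lin_apply_sum_list case_prod_unfold)

lemma comult_mem: "(V, W) \<in> set (comult L U) \<Longrightarrow> U \<in> carrier L \<Longrightarrow> V \<in> carrier L \<and> W \<in> carrier L"
  using comult_L_closed by blast

lemma cs_test: "bilmap L kmul \<Psi> \<Longrightarrow> lmap L kmul (cs \<Psi>)"
    "bilmap L kmul \<Psi> \<Longrightarrow> cs \<Psi> (E b h x) = sw kmul 2 h (\<lambda>h1 h2. \<Psi> (E b h1 1) (E 1 h2 x))"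
  using comult_lmap comult_E by (simp_all add: cs_def[abs_def])

lemma cs_lmap:
  assumes \<Psi>: "bilmap L t \<Psi>" and t: "vector_space t"
  shows "lmap L t (cs \<Psi>)"
  unfolding lmap_def
proof (intro ballI conjI allI; rule functional_ext[OF t])
  fix \<beta> U V r assume UV: "U \<in> carrier L" "V \<in> carrier L" and \<beta>: "lin t kmul \<beta>"
  show "\<beta> (cs \<Psi> (U \<oplus> V)) = \<beta> (cs \<Psi> U + cs \<Psi> V)"
    using lmapD(1)[OF cs_test(1)[OF bilmap_comp[OF \<Psi> \<beta>]] UV]
    by (simp add: cs_apply[OF \<beta>] linD[OF \<beta>])
next
  fix \<beta> U r assume U: "U \<in> carrier L" and \<beta>: "lin t kmul \<beta>"
  show "\<beta> (cs \<Psi> (r \<odot> U)) = \<beta> (t r (cs \<Psi> U))"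
    using lmapD(2)[OF cs_test(1)[OF bilmap_comp[OF \<Psi> \<beta>]] U]
    by (simp add: cs_apply[OF \<beta>] linD[OF \<beta>])
qed

lemma cs_E:
  assumes \<Psi>: "bilmap L t \<Psi>" and t: "vector_space t"
  shows "cs \<Psi> (E b h x) = sw t 2 h (\<lambda>h1 h2. \<Psi> (E b h1 1) (E 1 h2 x))"
proof (rule functional_ext[OF t])
  fix \<beta> assume \<beta>: "lin t kmul \<beta>"
  show "\<beta> (cs \<Psi> (E b h x)) = \<beta> (sw t 2 h (\<lambda>h1 h2. \<Psi> (E b h1 1) (E 1 h2 x)))"
    by (simp add: cs_apply[OF \<beta>] sw_pull[OF \<beta>] cs_test(2)[OF bilmap_comp[OF \<Psi> \<beta>]])
qed

lemma cs_lmap_param: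
  assumes t: "vector_space t" and
    \<Psi>: "\<And>U1 U2. U1 \<in> carrier L \<Longrightarrow> U2 \<in> carrier L \<Longrightarrow> lmap M t (\<lambda>V. \<Psi> V U1 U2)" and W: "W \<in> carrier L"
  shows "lmap M t (\<lambda>V. cs (\<Psi> V) W)"
proof -
  interpret t: vector_space t by fact
  have "lmap M t (\<lambda>V. \<Sum>(U1, U2)\<leftarrow>Us. \<Psi> V U1 U2)" if "set Us \<subseteq> carrier L \<times> carrier L" for Us
    using that by (induction Us) (use \<Psi> in \<open>auto simp: lmap_def t.scale_right_distrib algebra_simps\<close>)
  from this[OF comult_L_closed[OF W]] show ?thesis by (simp add: cs_def)
qed

definition cs2 where
  "cs2 K U V = cs (\<lambda>U1 U2. cs (\<lambda>V1 V2. K U1 U2 V1 V2) V) U"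

definition quad where
  "quad t K \<longleftrightarrow> (\<forall>A\<in>carrier L. \<forall>B\<in>carrier L. \<forall>C\<in>carrier L.
    lmap L t (\<lambda>Z. K Z A B C) \<and> lmap L t (\<lambda>Z. K A Z B C) \<and> lmap L t (\<lambda>Z. K A B Z C) \<and>
    lmap L t (\<lambda>Z. K A B C Z))"

lemma quadD:
  assumes "quad t K" "A \<in> carrier L" "B \<in> carrier L" "C \<in> carrier L"
  shows "lmap L t (\<lambda>Z. K Z A B C)" "lmap L t (\<lambda>Z. K A Z B C)" "lmap L t (\<lambda>Z. K A B Z C)"
    "lmap L t (\<lambda>Z. K A B C Z)"
  using assms by (auto simp: quad_def)

lemma cs2_param:
  assumes "vector_space t" "U \<in> carrier L" "V \<in> carrier L" and
    "\<And>A B C D. A \<in> carrier L \<Longrightarrow> B \<in> carrier L \<Longrightarrow> C \<in> carrier L \<Longrightarrow> D \<in> carrier L \<Longrightarrow>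
      lmap L t (\<lambda>Z. K Z A B C D)"
  shows "lmap L t (\<lambda>Z. cs2 (K Z) U V)"
  unfolding cs2_def by (intro cs_lmap_param assms)

lemma quad_bilmap:
  assumes K: "quad t K" and t: "vector_space t"
  shows "V \<in> carrier L \<Longrightarrow> bilmap L t (\<lambda>U1 U2. cs (\<lambda>V1 V2. K U1 U2 V1 V2) V)"
    "U1 \<in> carrier L \<Longrightarrow> U2 \<in> carrier L \<Longrightarrow> bilmap L t (\<lambda>V1 V2. K U1 U2 V1 V2)"
  by (auto intro!: bilmapI cs_lmap_param t quadD[OF K])

lemma cs2_bilmap:
  assumes K: "quad t K" and t: "vector_space t"
  shows "bilmap L t (cs2 K)"
  unfolding cs2_def[abs_def]
  by (intro bilmapI cs_lmap cs_lmap_param quad_bilmap[OF K t] t)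

lemma cs2_E:
  assumes K: "quad t K" and t: "vector_space t"
  shows "cs2 K (E b h x) (E c g y) = sw t 2 h (\<lambda>h1 h2. sw t 3 g (\<lambda>g1 g2.
    K (E b h1 1) (E 1 h2 x) (E c g1 1) (E 1 g2 y)))"
  unfolding cs2_def
  by (simp add: cs_E[OF quad_bilmap(1)[OF K t E_closed] t] cs_E[OF quad_bilmap(2)[OF K t E_closed
    E_closed] t]
    sw_label[of t 2 g _ 3])

lemma sum_cs2: "(\<Sum>z\<leftarrow>[K V1 V2 W1 W2. (V1, V2) \<leftarrow> comult L V, (W1, W2) \<leftarrow> comult L W]. f z) =
    cs2 (\<lambda>V1 V2 W1 W2. f (K V1 V2 W1 W2)) V W"
  by (simp add: cs2_def cs_def sum_list_concat_map case_prod_unfold o_def)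

lemma cs2_cong:
  assumes "U \<in> carrier L" "V \<in> carrier L" "\<And>A B C D. A \<in> carrier L \<Longrightarrow> B \<in> carrier L \<Longrightarrow> C \<in> carrier L \<Longrightarrow>
    D \<in> carrier L \<Longrightarrow> K A B C D = K' A B C D"
  shows "cs2 K U V = cs2 K' U V"
  unfolding cs2_def by (intro cs_cong assms)

lemma tri_eqI:
  assumes F: "\<And>V W. V \<in> carrier L \<Longrightarrow> W \<in> carrier L \<Longrightarrow> lmap L t (\<lambda>U. F U V W) \<and> lmap L t (\<lambda>U. G U V W)"
    "\<And>U W. U \<in> carrier L \<Longrightarrow> W \<in> carrier L \<Longrightarrow> lmap L t (\<lambda>V. F U V W) \<and> lmap L t (\<lambda>V. G U V W)"
    "\<And>U V. U \<in> carrier L \<Longrightarrow> V \<in> carrier L \<Longrightarrow> lmap L t (\<lambda>W. F U V W) \<and> lmap L t (\<lambda>W. G U V W)"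
    and eq: "\<And>a h u b g v c f w. F (E a h u) (E b g v) (E c f w) = G (E a h u) (E b g v) (E c f w)"
    and UVW: "U \<in> carrier L" "V \<in> carrier L" "W \<in> carrier L"
  shows "F U V W = G U V W"
proof -
  have 1: "F U (E b g v) (E c f w) = G U (E b g v) (E c f w)" for b g v c f w
    using F(1)[OF E_closed E_closed]
    by (auto intro!: lmap_eqI[where t = t and f = "\<lambda>U. F U (E b g v) (E c f w)" and g =
      "\<lambda>U. G U (E b g v) (E c f w)"] eq UVW)
  have 2: "F U V (E c f w) = G U V (E c f w)" for c f w
    using F(2)[OF UVW(1) E_closed]
    by (auto intro!: lmap_eqI[where t = t and f = "\<lambda>V. F U V (E c f w)" and g =
      "\<lambda>V. G U V (E c f w)"] 1 UVW)
  show ?thesis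
    using F(3)[OF UVW(1,2)]
    by (auto intro!: lmap_eqI[where t = t and f = "\<lambda>W. F U V W" and g = "\<lambda>W. G U V W"] 2 UVW)
qed

end

section \<open>The bialgebroid axioms\<close>

context presented
begin

lemma fsum_testI:
  assumes "set xs \<subseteq> carrier L \<times> carrier L" "U \<in> carrier L"
    and "\<And>\<Psi>. bilmap L kmul \<Psi> \<Longrightarrow> (\<And>U V b. U \<in> carrier L \<Longrightarrow> V \<in> carrier L \<Longrightarrow>
      \<Psi> (tgt L b \<otimes> U) V = \<Psi> U (src L b \<otimes> V)) \<Longrightarrow> cs \<Psi> U = (\<Sum>(U, V)\<leftarrow>xs. \<Psi> U V)"
  shows "fsum_cong (btens2_rel L) (comult L U) xs"
  using assms comult_L_closed[OF assms(2)] by (intro btens2_testI) (auto simp: cs_def)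

lemma one_closed: "\<one> \<in> carrier L" by (simp add: one_E E_closed)

lemma bilmap_mult:
  assumes \<Psi>: "bilmap L t \<Psi>"
  shows "A \<in> carrier L \<Longrightarrow> bilmap L t (\<lambda>U V. \<Psi> (A \<otimes> U) V)" "A \<in> carrier L \<Longrightarrow>
    bilmap L t (\<lambda>U V. \<Psi> U (A \<otimes> V))"
    "A \<in> carrier L \<Longrightarrow> bilmap L t (\<lambda>U V. \<Psi> (U \<otimes> A) V)" "A \<in> carrier L \<Longrightarrow> bilmap L t (\<lambda>U V. \<Psi> U (V \<otimes> A))"
  using assms by (auto intro!: bilmapI bilmapD[OF \<Psi>] mult_closed mult_lmap(1)[OF bilmapD(1)[OF \<Psi>]]
    mult_lmap(2)[OF bilmapD(2)[OF \<Psi>]] mult_lmap(2)[OF bilmapD(1)[OF \<Psi>]] mult_lmap(1)[OF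
      bilmapD(2)[OF \<Psi>]])

lemma L_comult_add:
  assumes "U \<in> carrier L" "V \<in> carrier L"
  shows "fsum_cong (btens2_rel L) (comult L (U \<oplus> V)) (comult L U @ comult L V)"
proof (rule fsum_testI)
  fix \<Psi> assume "bilmap L kmul \<Psi>"
  from lmapD(1)[OF cs_lmap[OF this vs_kmul] assms]
  show "cs \<Psi> (U \<oplus> V) = (\<Sum>(U, V)\<leftarrow>comult L U @ comult L V. \<Psi> U V)" by (simp add: cs_def)
qed (use assms comult_L_closed in auto)

lemma sum_comult_map:
  "(\<Sum>(U, V)\<leftarrow>map (\<lambda>(U1, U2). (f U1, g U2)) (comult L U). \<Psi> U V) = cs (\<lambda>U V. \<Psi> (f U) (g V)) U"
  by (simp add: cs_def case_prod_unfold o_def)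

lemma L_comult_bimodule:
  assumes "U \<in> carrier L"
  shows "fsum_cong (btens2_rel L) (comult L (src L b \<otimes> tgt L c \<otimes> U))
    [(src L b \<otimes> U1, tgt L c \<otimes> U2). (U1, U2) \<leftarrow> comult L U]"
proof (rule fsum_testI)
  fix \<Psi> assume \<Psi>: "bilmap L kmul \<Psi>"
  have \<Psi>': "bilmap L kmul (\<lambda>U V. \<Psi> (src L b \<otimes> U) (tgt L c \<otimes> V))"
    by (intro bilmap_mult(1)[OF bilmap_mult(2)[OF \<Psi>]] src_closed tgt_closed)
  show "cs \<Psi> (src L b \<otimes> tgt L c \<otimes> U) =
      (\<Sum>(U, V)\<leftarrow>[(src L b \<otimes> U1, tgt L c \<otimes> U2). (U1, U2) \<leftarrow> comult L U]. \<Psi> U V)"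
    unfolding sum_comult_map
    by (rule lmap_eqI[OF mult_lmap(2)[OF cs_lmap[OF \<Psi> vs_kmul]] cs_lmap[OF \<Psi>' vs_kmul] _ assms])
      (simp_all add: cs_E[OF \<Psi>] cs_E[OF \<Psi>'] vs_kmul mult_assoc src_closed tgt_closed E_closed
        tgt_mult_E src_mult_E mult_closed)
qed (use assms comult_L_closed[OF assms] in \<open>auto simp: mult_closed src_closed tgt_closed\<close>)

lemma L_counit_bimodule:
  assumes "U \<in> carrier L"
  shows "counit L (src L b \<otimes> tgt L c \<otimes> U) = b * counit L U * c"
proof -
  have "lmap L sB (\<lambda>U. b * counit L U * c)"
    by (rule lmap_comp[OF counit_lmap]) (simp add: lin_cross)
  from lmap_eqI[OF mult_lmap(2)[OF counit_lmap, of "src L b \<otimes> tgt L c"] this _ assms] show ?thesis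
    by (simp add: mult_assoc src_closed tgt_closed E_closed tgt_mult_E src_mult_E mult_closed
      counit_E sB_simps mult.assoc)
qed

lemma L_counit_src:
  assumes "U \<in> carrier L"
  shows "counit L (src L b \<otimes> U) = b * counit L U"
proof -
  have "lmap L sB (\<lambda>U. b * counit L U)"
    by (rule lmap_comp[OF counit_lmap]) (simp add: lin_cross)
  from lmap_eqI[OF mult_lmap(2)[OF counit_lmap src_closed] this _ assms] show ?thesis
    by (simp add: src_mult_E counit_E sB_simps mult.assoc)
qed

lemma cs_cs_lmap:
  assumes \<Psi>: "\<And>W. W \<in> carrier L \<Longrightarrow> bilmap L kmul (\<lambda>U V. \<Psi> U V W)"
    "\<And>U. U \<in> carrier L \<Longrightarrow> bilmap L kmul (\<lambda>V W. \<Psi> U V W)"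
  shows "bilmap L kmul (\<lambda>Q W. cs (\<lambda>U V. \<Psi> U V W) Q)" "bilmap L kmul (\<lambda>U Q. cs (\<lambda>V W. \<Psi> U V W) Q)"
  by (auto intro!: bilmapI cs_lmap vs_kmul \<Psi> cs_lmap_param
    bilmapD[OF \<Psi>(1)] bilmapD[OF \<Psi>(2)])

lemma L_coassoc:
  assumes "U \<in> carrier L"
  shows "fsum_cong (btens3_rel L)
      [(U1, U2, U3). (Q, U3) \<leftarrow> comult L U, (U1, U2) \<leftarrow> comult L Q]
      [(U1, U2, U3). (U1, Q) \<leftarrow> comult L U, (U2, U3) \<leftarrow> comult L Q]"
proof (rule btens3_testI)
  fix \<Psi> assume \<Psi>: "\<And>W. W \<in> carrier L \<Longrightarrow> bilmap L kmul (\<lambda>U V. \<Psi> U V W)"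
    "\<And>U. U \<in> carrier L \<Longrightarrow> bilmap L kmul (\<lambda>V W. \<Psi> U V W)"
  note cc = cs_cs_lmap[OF \<Psi>]
  have "cs (\<lambda>Q W. cs (\<lambda>U V. \<Psi> U V W) Q) U = cs (\<lambda>U Q. cs (\<lambda>V W. \<Psi> U V W) Q) U"
  proof (rule lmap_eqI[OF cs_lmap[OF cc(1) vs_kmul] cs_lmap[OF cc(2) vs_kmul] _ assms])
    fix b h x
    note lins = trilinear_mapD[OF E_tri[OF bilmapD(1)[OF \<Psi>(1)[OF E_closed] E_closed] vs_kmul]]
      trilinear_mapD[OF E_tri[OF bilmapD(2)[OF \<Psi>(1)[OF E_closed] E_closed] vs_kmul]]
      trilinear_mapD[OF E_tri[OF bilmapD(2)[OF \<Psi>(2)[OF E_closed] E_closed] vs_kmul]]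
    show "cs (\<lambda>Q W. cs (\<lambda>U V. \<Psi> U V W) Q) (E b h x) = cs (\<lambda>U Q. cs (\<lambda>V W. \<Psi> U V W) Q) (E b h x)"
      by (simp add: cs_E[OF cc(1) vs_kmul] cs_E[OF cc(2) vs_kmul] cs_E[OF \<Psi>(1)[OF E_closed] vs_kmul]
        cs_E[OF \<Psi>(2)[OF E_closed] vs_kmul] lins sw_norm)
  qed
  then show "(\<Sum>(U, V, W)\<leftarrow>[(U1, U2, U3). (Q, U3) \<leftarrow> comult L U, (U1, U2) \<leftarrow> comult L Q]. \<Psi> U V W) =
      (\<Sum>(U, V, W)\<leftarrow>[(U1, U2, U3). (U1, Q) \<leftarrow> comult L U, (U2, U3) \<leftarrow> comult L Q]. \<Psi> U V W)"
    by (simp add: cs_def sum_list_concat_map case_prod_unfold o_def)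
qed (use assms in \<open>auto dest!: comult_mem\<close>)

lemma L_counit_left_right:
  assumes "U \<in> carrier L"
  shows "lsum L [src L (counit L U1) \<otimes> U2. (U1, U2) \<leftarrow> comult L U] = U" (is "lsum L ?xs = U")
    "lsum L [tgt L (counit L U2) \<otimes> U1. (U1, U2) \<leftarrow> comult L U] = U" (is "lsum L ?ys = U")
proof -
  have closed: "set ?xs \<subseteq> carrier L" "set ?ys \<subseteq> carrier L"
    using comult_L_closed[OF assms] by (auto simp: mult_closed src_closed tgt_closed)
  have "f (lsum L ?xs) = f U \<and> f (lsum L ?ys) = f U" if f: "lmap L kmul f" for f
  proof -
    have src: "lmap L kmul (\<lambda>U. f (src L (counit L U) \<otimes> V))" and tgt: "lmap L kmul (\<lambda>U. f (tgt L
      (counit L U) \<otimes> V))"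
      if "V \<in> carrier L" for V
      using that counit_lmap
      by (auto simp: lmap_def src_E tgt_E E_add E_scale E_add3 E_scale3 mult_add mult_smult
        E_closed lmapD[OF f] mult_closed)
    have 1: "bilmap L kmul (\<lambda>U V. f (src L (counit L U) \<otimes> V))"
      and 2: "bilmap L kmul (\<lambda>U V. f (tgt L (counit L V) \<otimes> U))"
      by (auto intro!: bilmapI src tgt mult_lmap f src_closed tgt_closed)
    have "cs (\<lambda>U V. f (src L (counit L U) \<otimes> V)) U = f U"
      by (rule lmap_eqI[OF cs_lmap[OF 1 vs_kmul] f _ assms])
        (simp add: cs_E[OF 1 vs_kmul] counit_E src_mult_E sB_simps E_test_scale[OF f] sw_eps_k
          trilinear_mapD[OF E_test[OF f]] lin_cross)
    moreover have "cs (\<lambda>U V. f (tgt L (counit L V) \<otimes> U)) U = f U"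
      by (rule lmap_eqI[OF cs_lmap[OF 2 vs_kmul] f _ assms])
        (simp add: cs_E[OF 2 vs_kmul] counit_E tgt_mult_E sB_simps E_test_scale[OF f] sw_eps_k
          trilinear_mapD[OF E_test[OF f]] lin_cross)
    ultimately show ?thesis
      unfolding lmap_lsum[OF f closed(1)] lmap_lsum[OF f closed(2)]
      by (simp add: cs_def case_prod_unfold o_def)
  qed
  then show "lsum L ?xs = U" "lsum L ?ys = U"
    by (auto intro!: L_sep assms lsum_closed closed)
qed

text \<open>Both sides carry h2 \<triangleright> b between the legs h1 and h3, on the left as
  t-coordinate of the first factor and on the right as s-coordinate of the second. Balancing over B
  identifies the two.\<close>

lemma L_takeuchi:
  assumes "U \<in> carrier L"
  shows "fsum_cong (btens2_rel L)
      [(U1 \<otimes> tgt L b, U2). (U1, U2) \<leftarrow> comult L U]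
      [(U1, U2 \<otimes> src L b). (U1, U2) \<leftarrow> comult L U]"
proof (rule btens2_testI)
  fix \<Psi> assume \<Psi>: "bilmap L kmul \<Psi>" and bal: "\<And>U V b. U \<in> carrier L \<Longrightarrow> V \<in> carrier L \<Longrightarrow>
      \<Psi> (tgt L b \<otimes> U) V = \<Psi> U (src L b \<otimes> V)"
  note \<Psi>1 = bilmap_mult(3)[OF \<Psi> tgt_closed[of b]] and \<Psi>2 = bilmap_mult(4)[OF \<Psi> src_closed[of b]]
  note lins = trilinear_mapD[OF E_tri[OF bilmapD(1)[OF \<Psi> E_closed] vs_kmul]]
      trilinear_mapD[OF E_tri[OF bilmapD(2)[OF \<Psi> E_closed] vs_kmul]]
  have mv: "\<Psi> (E b h x) (E c g y) = \<Psi> (E b h 1) (E (x * c) g y)" for b h x c g y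
    using bal[of "E b h 1" "E c g y" x] by (simp add: tgt_mult_E src_mult_E E_closed)
  have "cs (\<lambda>U V. \<Psi> (U \<otimes> tgt L b) V) U = cs (\<lambda>U V. \<Psi> U (V \<otimes> src L b)) U"
    by (rule lmap_eqI[OF cs_lmap[OF \<Psi>1 vs_kmul] cs_lmap[OF \<Psi>2 vs_kmul] _ assms])
      (simp add: cs_E[OF \<Psi>1 vs_kmul] cs_E[OF \<Psi>2 vs_kmul] E_mult_tgt[OF bilmapD(1)[OF \<Psi> E_closed]
        vs_kmul]
        E_mult_src[OF bilmapD(2)[OF \<Psi> E_closed] vs_kmul] mv[of _ _ "_ \<triangleright> _"] lins sw_norm)
  then show "(\<Sum>(U, V)\<leftarrow>[(U1 \<otimes> tgt L b, U2). (U1, U2) \<leftarrow> comult L U]. \<Psi> U V) =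
      (\<Sum>(U, V)\<leftarrow>[(U1, U2 \<otimes> src L b). (U1, U2) \<leftarrow> comult L U]. \<Psi> U V)"
    by (simp add: cs_def case_prod_unfold o_def)
qed (use comult_L_closed[OF assms] in \<open>auto simp: mult_closed src_closed tgt_closed\<close>)

text \<open>The product of the first legs leaves a \<sigma>^-1 in its t-coordinate, that of the
  second legs a \<sigma> in its s-coordinate. Balancing over B brings them together, and they
  cancel.\<close>

lemma L_comult_mult:
  assumes UV: "U \<in> carrier L" "V \<in> carrier L"
  shows "fsum_cong (btens2_rel L) (comult L (U \<otimes> V))
    [(U1 \<otimes> V1, U2 \<otimes> V2). (U1, U2) \<leftarrow> comult L U, (V1, V2) \<leftarrow> comult L V]"
proof (rule fsum_testI)
  fix \<Psi> assume \<Psi>: "bilmap L kmul \<Psi>" and bal: "\<And>U V b. U \<in> carrier L \<Longrightarrow> V \<in> carrier L \<Longrightarrow>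
      \<Psi> (tgt L b \<otimes> U) V = \<Psi> U (src L b \<otimes> V)"
  have mv: "\<Psi> (E b h x) (E c g y) = \<Psi> (E b h 1) (E (x * c) g y)" for b h x c g y
    using bal[of "E b h 1" "E c g y" x] by (simp add: tgt_mult_E src_mult_E E_closed)
  have U': "bilmap L kmul (\<lambda>V1 V2. \<Psi> (U1 \<otimes> V1) (U2 \<otimes> V2))"
    if "U1 \<in> carrier L" "U2 \<in> carrier L" for U1 U2
    using bilmap_mult(1)[OF bilmap_mult(2)[OF \<Psi>]] that by blast
  have V': "bilmap L kmul (\<lambda>U1 U2. \<Psi> (U1 \<otimes> V1) (U2 \<otimes> V2))"
    if "V1 \<in> carrier L" "V2 \<in> carrier L" for V1 V2
    using bilmap_mult(3)[OF bilmap_mult(4)[OF \<Psi>]] that by blast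
  let ?R = "\<lambda>V. cs (\<lambda>U1 U2. cs (\<lambda>V1 V2. \<Psi> (U1 \<otimes> V1) (U2 \<otimes> V2)) V)"
  have bil: "bilmap L kmul (\<lambda>U1 U2. cs (\<lambda>V1 V2. \<Psi> (U1 \<otimes> V1) (U2 \<otimes> V2)) V)" if "V \<in> carrier L" for V
    by (auto intro!: bilmapI cs_lmap_param vs_kmul that bilmapD[OF V'])
  have gen: "cs \<Psi> (E b h x \<otimes> E c g y) = ?R (E c g y) (E b h x)" for b h x c g y
  proof -
    note lins = trilinear_mapD[OF E_tri[OF bilmapD(1)[OF \<Psi> E_closed] vs_kmul]]
        trilinear_mapD[OF E_tri[OF bilmapD(2)[OF \<Psi> E_closed] vs_kmul]]
    note pull = sw_pull[OF lins(4)[OF lin_id[OF vs_sB]]]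
    \<comment> \<open>Balancing, applied to the one t-coordinate left over by the product of the
      first legs.\<close>
    have *: "\<Psi> (E b1 h1 (\<sigma>i u v)) (E (\<sigma> u' v') h2 y) = \<Psi> (E b1 h1 1) (E (\<sigma>i u v * \<sigma> u' v') h2 y)"
      for b1 h1 u v u' v' h2 y by (subst mv) simp
    have "cs \<Psi> (E b h x \<otimes> E c g y) = sw kmul 2 h (\<lambda>h1 r. sw kmul 2 r (\<lambda>h2 r. sw kmul 2 r (\<lambda>p r. sw
      kmul 2 r (\<lambda>h3 h4.
        sw kmul 3 g (\<lambda>g1 r. sw kmul 3 r (\<lambda>g2 r. sw kmul 3 r (\<lambda>p' r. sw kmul 3 r (\<lambda>g3 g4.
        \<Psi> (E (b * lam h1 c g1) (h2 * g2) 1)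
          (E (sw sB 2 p (\<lambda>u v. sw sB 3 p' (\<lambda>u' v'. \<sigma>i u u' * \<sigma> v v'))) (h3 * g3) (rho h4 y g4 *
            x))))))))))"
      by (simp add: mult_E_test[OF cs_test(1)[OF \<Psi>]] cs_test(2)[OF \<Psi>] lins lin_all sw_norm sw_skip
        sw_prod_23 sw_\<sigma>i_\<sigma> linD(2)[OF lins(4)[OF lin_id[OF vs_sB]]] sw_eps_k
        B.scale_scale[symmetric] del: B.scale_scale)
    also have "\<dots> = ?R (E c g y) (E b h x)"
      by (simp add: cs_test(2)[OF bil[OF E_closed]] cs_test(2)[OF U'[OF E_closed E_closed],
        unfolded sw_label[of kmul 2 _ _ 3]]
        mult_E_test[OF bilmapD(1)[OF \<Psi>]] mult_E_test[OF bilmapD(2)[OF \<Psi>]] mult_closed E_closed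
        lam_one rho_one * lins lin_all sw_norm sw_skip pull)
    finally show ?thesis .
  qed
  have "cs \<Psi> (U \<otimes> E c g y) = ?R (E c g y) U" for c g y
    by (rule lmap_eqI[OF mult_lmap(1)[OF cs_test(1)[OF \<Psi>] E_closed] cs_test(1)[OF bil[OF
      E_closed]] gen UV(1)])
  then have "cs \<Psi> (U \<otimes> V) = ?R V U"
    by (intro lmap_eqI[OF mult_lmap(2)[OF cs_test(1)[OF \<Psi>] UV(1)] _ _ UV(2)] cs_lmap_param vs_kmul UV
      cs_test(1) U')
  then show "cs \<Psi> (U \<otimes> V) =
      (\<Sum>(U, V)\<leftarrow>[(U1 \<otimes> V1, U2 \<otimes> V2). (U1, U2) \<leftarrow> comult L U, (V1, V2) \<leftarrow> comult L V]. \<Psi> U V)"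
    by (simp add: cs_def sum_list_concat_map case_prod_unfold o_def)
qed (use UV in \<open>auto simp: mult_closed dest!: comult_mem\<close>)

lemma L_comult_one: "fsum_cong (btens2_rel L) (comult L \<one>) [(\<one>, \<one>)]"
proof (rule fsum_testI)
  fix \<Psi> assume \<Psi>: "bilmap L kmul \<Psi>"
  show "cs \<Psi> \<one> = (\<Sum>(U, V)\<leftarrow>[(\<one>, \<one>)]. \<Psi> U V)"
    by (simp add: one_E cs_test(2)[OF \<Psi>] sw_one lin_cross
      trilinear_mapD[OF E_tri[OF bilmapD(1)[OF \<Psi> E_closed] vs_kmul]]
      trilinear_mapD[OF E_tri[OF bilmapD(2)[OF \<Psi> E_closed] vs_kmul]])
qed (simp_all add: one_closed)

text \<open>The counit makes \<open>lam\<close> and \<open>rho\<close> adjacent, so \<sigma> and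
  \<sigma>^-1 cancel and the measuring property joins c and y. The value depends on c y and the
  counit of g alone, which is the reason for the two counit axioms below.\<close>

lemma counit_mult_E: "counit L (E b h x \<otimes> E c g y) = sB (eps g) (b * (h \<triangleright> (c * y)) * x)"
proof -
  have "counit L (E b h x \<otimes> E c g y) = b * sw sB 2 h (\<lambda>p q. sw sB 3 g (\<lambda>p' q'. lam p c p' *
    rho q y q')) * x"
    by (simp add: mult_E[OF counit_lmap vs_sB] counit_E counit_mult sB_simps sw_eps lin_all sw_norm
      del: B.scale_scale)
  also have "sw sB 2 h (\<lambda>p q. sw sB 3 g (\<lambda>p' q'. lam p c p' * rho q y q')) =
      sw sB 2 h (\<lambda>h1 r. sw sB 2 r (\<lambda>r q. (h1 \<triangleright> c) * sw sB 2 r (\<lambda>u v. sw sB 3 g (\<lambda>u' v'. \<sigma> u u' *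
        \<sigma>i v v')) * (q \<triangleright> y)))"
    by (simp add: lam_def rho_def lin_all sw_norm sw_skip)
  also have "\<dots> = sB (eps g) (h \<triangleright> (c * y))"
    by (simp add: sw_\<sigma>_\<sigma>i measuring[where n = 2] sB_simps sw_eps lin_all sw_norm del: B.scale_scale)
  finally show ?thesis by (simp add: sB_simps del: B.scale_scale)
qed

lemma L_counit_mult_src_tgt:
  assumes "U \<in> carrier L" "V \<in> carrier L"
  shows "counit L (U \<otimes> src L (counit L V)) = counit L (U \<otimes> V)"
    "counit L (U \<otimes> tgt L (counit L V)) = counit L (U \<otimes> V)"
proof -
  have src: "lmap L sB (\<lambda>V. counit L (U \<otimes> src L (counit L V)))"
    and tgt: "lmap L sB (\<lambda>V. counit L (U \<otimes> tgt L (counit L V)))"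
    if "U \<in> carrier L" for U
    using that counit_lmap
    by (auto simp: lmap_def src_E tgt_E E_add E_scale E_add3 E_scale3 mult_add mult_smult E_closed
      lmapD[OF counit_lmap] mult_closed)
  have 1: "counit L (E b h x \<otimes> src L (counit L (E c g y))) = counit L (E b h x \<otimes> E c g y)"
    "counit L (E b h x \<otimes> tgt L (counit L (E c g y))) = counit L (E b h x \<otimes> E c g y)" for b h x c g y
    by (simp_all add: counit_mult_E) (simp_all add: src_E tgt_E counit_mult_E counit_E counit_one
      act_sB sB_simps)
  have 2: "counit L (U \<otimes> src L (counit L (E c g y))) = counit L (U \<otimes> E c g y)"
    "counit L (U \<otimes> tgt L (counit L (E c g y))) = counit L (U \<otimes> E c g y)" for c g y
    by (rule lmap_eqI[OF mult_lmap(1)[OF counit_lmap] mult_lmap(1)[OF counit_lmap] _ assms(1)];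
      simp add: 1 src_closed tgt_closed E_closed)+
  show "counit L (U \<otimes> src L (counit L V)) = counit L (U \<otimes> V)"
    by (rule lmap_eqI[OF src mult_lmap(2)[OF counit_lmap] 2(1) assms(2)]) (simp_all add: assms)
  show "counit L (U \<otimes> tgt L (counit L V)) = counit L (U \<otimes> V)"
    by (rule lmap_eqI[OF tgt mult_lmap(2)[OF counit_lmap] 2(2) assms(2)]) (simp_all add: assms)
qed

lemma src_mult: "src L (b * c) = src L b \<otimes> src L c"
  unfolding src_E[of "b * c"] src_E[of c] src_mult_E ..

lemma tgt_mult: "tgt L (b * c) = tgt L c \<otimes> tgt L b"
  unfolding tgt_E[of "b * c"] tgt_E[of b] tgt_mult_E ..

lemma src_tgt: "src L b \<otimes> tgt L c = E b 1 c"
  by (simp add: tgt_E src_mult_E)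

lemma lin_src:
  assumes "lmap L t f" "vector_space t" "U \<in> carrier L"
  shows "lin sB t (\<lambda>b. f (src L b \<otimes> U))" "lin sB t (\<lambda>b. f (tgt L b \<otimes> U))"
  using assms
  by (auto intro!: linI vs_sB simp: src_E tgt_E E_add E_scale E_add3 E_scale3 mult_add mult_smult
    E_closed
    mult_closed lmapD[OF assms(1)])

theorem left_bialgebroid: "left_bialgebroid sB L"
proof (rule left_bialgebroid.intro)
  show "ring L" by (rule L_ring)
  show "Module.module (ring_of_type_algebra :: 'a ring) L" by (rule L_module)
  show "src L (b + c) = src L b \<oplus> src L c" "src L (sB r b) = r \<odot> src L b"
    "tgt L (b + c) = tgt L b \<oplus> tgt L c" "tgt L (sB r b) = r \<odot> tgt L b" for b c r
    by (simp_all add: src_E tgt_E E_add E_scale E_add3 E_scale3)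
  show "src L 1 = \<one>" "tgt L 1 = \<one>" by (simp_all add: src_E tgt_E one_E)
  show "src L b \<otimes> tgt L c = tgt L c \<otimes> src L b" for b c
    unfolding src_tgt by (simp add: src_E tgt_mult_E)
  show "counit L \<one> = 1" by (simp add: one_E counit_E counit_one)
  show "fsum_cong (btens3_rel L)
      [(U1, U2, U3). (Q, U3) \<leftarrow> comult L U, (U1, U2) \<leftarrow> comult L Q]
      [(U1, U2, U3). (U1, Q) \<leftarrow> comult L U, (U2, U3) \<leftarrow> comult L Q]" if "U \<in> carrier L" for U
    using that by (rule L_coassoc)
qed (simp_all add: src_mult tgt_mult mult_smult src_closed tgt_closed comult_L_closed
  L_comult_add L_comult_bimodule lmapD[OF counit_lmap] L_counit_bimodule L_counit_left_right
  L_takeuchi L_comult_mult L_comult_one L_counit_src L_counit_mult_src_tgt B.k_algebra_axioms)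

end

text \<open>Linearity of \<open>\<phi>\<close> is expressed by pulling back linear functionals, which separate points.\<close>

lemma presented_hom:
  assumes "presented H sB act \<sigma> \<sigma>i L E" "presented H sB act \<sigma> \<sigma>i M E'"
    and closed: "\<And>U. U \<in> carrier L \<Longrightarrow> \<phi> U \<in> carrier M"
    and pull: "\<And>f. lmap M (*) f \<Longrightarrow> lmap L (*) (\<lambda>U. f (\<phi> U))"
    and \<phi>_E: "\<And>b h x. \<phi> (E b h x) = E' b h x"
  shows "bialgebroid_hom sB L M \<phi>"
proof -
  interpret L: presented H sB act \<sigma> \<sigma>i L E by fact
  interpret M: presented H sB act \<sigma> \<sigma>i M E' by fact
  have add: "\<phi> (U \<oplus>\<^bsub>L\<^esub> V) = \<phi> U \<oplus>\<^bsub>M\<^esub> \<phi> V" if "U \<in> carrier L" "V \<in> carrier L" for U V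
    using that by (intro M.L_sep) (simp_all add: closed M.lmapD L.lmapD(1)[OF pull])
  have smult: "\<phi> (r \<odot>\<^bsub>L\<^esub> U) = r \<odot>\<^bsub>M\<^esub> \<phi> U" if "U \<in> carrier L" for U r
    using that by (intro M.L_sep) (simp_all add: closed M.lmapD L.lmapD(2)[OF pull])
  have pull': "lmap L t (\<lambda>U. f (\<phi> U))" if "lmap M t f" for t f
    using that by (auto simp: lmap_def add smult closed)
  have mult: "\<phi> (U \<otimes>\<^bsub>L\<^esub> V) = \<phi> U \<otimes>\<^bsub>M\<^esub> \<phi> V" if UV: "U \<in> carrier L" "V \<in> carrier L" for U V
  proof (rule M.L_sep)
    fix f assume f: "lmap M (*) f"
    have gen: "f (\<phi> (E b h x \<otimes>\<^bsub>L\<^esub> E c g y)) = f (\<phi> (E b h x) \<otimes>\<^bsub>M\<^esub> \<phi> (E c g y))" for b h x c g y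
      by (simp add: L.mult_E_test[OF pull[OF f]] M.mult_E_test[OF f] \<phi>_E)
    have gen2: "f (\<phi> (U \<otimes>\<^bsub>L\<^esub> E c g y)) = f (\<phi> U \<otimes>\<^bsub>M\<^esub> \<phi> (E c g y))" for c g y
      by (rule L.lmap_eqI[OF L.mult_lmap1[OF L.E_closed pull[OF f]]
            pull[OF M.mult_lmap1[OF closed[OF L.E_closed] f]] gen UV(1)])
    show "f (\<phi> (U \<otimes>\<^bsub>L\<^esub> V)) = f (\<phi> U \<otimes>\<^bsub>M\<^esub> \<phi> V)"
      by (rule L.lmap_eqI[OF L.mult_lmap2[OF UV(1) pull[OF f]]
            pull[OF M.mult_lmap2[OF closed[OF UV(1)] f]] gen2 UV(2)])
  qed (use UV in \<open>simp_all add: closed L.mult_closed M.mult_closed\<close>)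
  have st: "\<phi> (src L b) = src M b" "\<phi> (tgt L b) = tgt M b" for b
    by (simp_all add: L.src_E L.tgt_E M.src_E M.tgt_E \<phi>_E)
  have "fsum_cong (btens2_rel M) (comult M (\<phi> U)) [(\<phi> U1, \<phi> U2). (U1, U2) \<leftarrow> comult L U]"
    if U: "U \<in> carrier L" for U
  proof (rule M.fsum_testI)
    fix \<Psi> assume \<Psi>: "bilmap M (*) \<Psi>"
    have \<Psi>': "bilmap L (*) (\<lambda>U V. \<Psi> (\<phi> U) (\<phi> V))"
      by (intro L.bilmapI pull M.bilmapD[OF \<Psi>] closed)
    have "M.cs \<Psi> (\<phi> U) = L.cs (\<lambda>U V. \<Psi> (\<phi> U) (\<phi> V)) U"
      by (rule L.lmap_eqI[OF pull[OF M.cs_test(1)[OF \<Psi>]] L.cs_test(1)[OF \<Psi>'] _ U])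
        (simp add: M.cs_test(2)[OF \<Psi>] L.cs_test(2)[OF \<Psi>'] \<phi>_E)
    then show "M.cs \<Psi> (\<phi> U) = (\<Sum>(U, V)\<leftarrow>[(\<phi> U1, \<phi> U2). (U1, U2) \<leftarrow> comult L U]. \<Psi> U V)"
      by (simp add: L.cs_def case_prod_unfold o_def)
  qed (use U in \<open>auto simp: closed dest: L.comult_mem\<close>)
  moreover have "counit M (\<phi> U) = counit L U" if "U \<in> carrier L" for U
    by (rule L.lmap_eqI[OF pull'[OF M.counit_lmap] L.counit_lmap _ that])
      (simp add: \<phi>_E L.counit_E M.counit_E)
  moreover have "\<phi> \<in> ring_hom L M"
    by (rule ring_hom_memI) (simp_all add: closed mult add L.one_E M.one_E \<phi>_E)
  ultimately show ?thesis
    unfolding bialgebroid_hom_def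
    by (auto simp: L.left_bialgebroid M.left_bialgebroid smult mult st L.mult_closed
      L.src_closed L.tgt_closed)
qed

text \<open>\<open>\<psi>\<close> picks coordinates of U by \<open>E_span\<close>, a choice that
  need not be linear. By \<open>E_lift\<close>, a functional of \<open>\<psi> U\<close> is the value
  at U of a linear functional on L, so the choice has no effect.\<close>

lemma presented_map:
  assumes "presented H sB act \<sigma> \<sigma>i L E" "presented H sB act \<sigma> \<sigma>i M E'"
  obtains \<psi> where "\<And>U. U \<in> carrier L \<Longrightarrow> \<psi> U \<in> carrier M"
    "\<And>f. lmap M (*) f \<Longrightarrow> lmap L (*) (\<lambda>U. f (\<psi> U))" "\<And>b h x. \<psi> (E b h x) = E' b h x"
proof -
  interpret L: presented H sB act \<sigma> \<sigma>i L E by fact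
  interpret M: presented H sB act \<sigma> \<sigma>i M E' by fact
  define coords where "coords U = (SOME xs. U = lsum L (map (\<lambda>(b, h, x). E b h x) xs))" for U
  define \<psi> where "\<psi> U = lsum M (map (\<lambda>(b, h, x). E' b h x) (coords U))" for U
  have coords: "U = lsum L (map (\<lambda>(b, h, x). E b h x) (coords U))" if "U \<in> carrier L" for U
    unfolding coords_def using L.E_span[OF that] by (rule someI_ex)
  have lift: "\<exists>f'. lmap L (*) f' \<and> (\<forall>U\<in>carrier L. f (\<psi> U) = f' U) \<and> (\<forall>b h x. f' (E b h x) =
    f (E' b h x))"
    if f: "lmap M (*) f" for f
  proof -
    obtain f' where f': "lmap L (*) f'" "\<forall>b h x. f' (E b h x) = f (E' b h x)"
      using L.E_lift[OF M.E_test[OF f]] by blast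
    have "f (\<psi> U) = f' U" if U: "U \<in> carrier L" for U
    proof -
      have "f (\<psi> U) = (\<Sum>(b, h, x)\<leftarrow>coords U. f (E' b h x))"
        unfolding \<psi>_def by (subst M.lmap_lsum[OF f]) (auto simp: M.E_closed case_prod_unfold o_def)
      also have "\<dots> = f' (lsum L (map (\<lambda>(b, h, x). E b h x) (coords U)))"
        by (subst L.lmap_lsum[OF f'(1)]) (auto simp: f' L.E_closed case_prod_unfold o_def)
      finally show ?thesis using coords[OF U] by simp
    qed
    with f' show ?thesis by blast
  qed
  have closed: "\<psi> U \<in> carrier M" for U
    unfolding \<psi>_def by (rule M.lsum_closed) (auto simp: M.E_closed)
  show thesis
  proof (rule that)
    fix f assume f: "lmap M (*) f"
    with lift[OF f] show "lmap L (*) (\<lambda>U. f (\<psi> U))" by (auto simp: lmap_def)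
  next
    fix b h x
    show "\<psi> (E b h x) = E' b h x"
      by (rule M.L_sep) (use lift L.E_closed in \<open>fastforce simp: closed M.E_closed\<close>)+
  qed (rule closed)
qed

text \<open>\<open>presented_map\<close> in the opposite direction supplies the inverse, since both
  composites fix all E b h x. For \<phi> there remains only the comparison of coordinates.\<close>

theorem presented_iso:
  assumes L: "presented H sB act \<sigma> \<sigma>i L E" and M: "presented H sB act \<sigma> \<sigma>i M E'"
    and closed: "\<And>U. U \<in> carrier L \<Longrightarrow> \<phi> U \<in> carrier M"
    and pull: "\<And>f. lmap M (*) f \<Longrightarrow> lmap L (*) (\<lambda>U. f (\<phi> U))"
    and \<phi>_E: "\<And>b h x. \<phi> (E b h x) = E' b h x"
  shows "bialgebroid_iso sB L M \<phi>"
proof -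
  interpret L: presented H sB act \<sigma> \<sigma>i L E by fact
  interpret M: presented H sB act \<sigma> \<sigma>i M E' by fact
  obtain \<psi> where \<psi>: "\<And>U. U \<in> carrier M \<Longrightarrow> \<psi> U \<in> carrier L"
    "\<And>f. lmap L (*) f \<Longrightarrow> lmap M (*) (\<lambda>U. f (\<psi> U))" "\<And>b h x. \<psi> (E' b h x) = E b h x"
    by (rule presented_map[OF M L]) blast
  have "\<psi> (\<phi> U) = U" if "U \<in> carrier L" for U
    by (rule L.L_sep, simp_all add: that closed \<psi>(1))
      (rule L.lmap_eqI[OF pull[OF \<psi>(2)] _ _ that], simp_all add: \<psi>(3) \<phi>_E)
  moreover have "\<phi> (\<psi> U) = U" if "U \<in> carrier M" for U
    by (rule M.L_sep, simp_all add: that closed \<psi>(1))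
      (rule M.lmap_eqI[OF \<psi>(2)[OF pull] _ _ that], simp_all add: \<psi>(3) \<phi>_E)
  ultimately show ?thesis
    unfolding bialgebroid_iso_def
    using presented_hom[OF L M closed pull \<phi>_E] presented_hom[OF M L \<psi>] by blast
qed

section \<open>The bialgebroid \<open>B\<^sup>e #\<^sub>\<sigma> H\<close>\<close>

context crossed
begin

abbreviation "tc \<equiv> tens_class H sB"
abbreviation "R3 \<equiv> ktens3_rel sB sB hs"
abbreviation "BH \<equiv> Be_cross H sB act \<sigma> \<sigma>i"
abbreviation "tform \<equiv> trilinear_map sB sB hs"

lemma tc_eq: "tc xs = tc ys \<longleftrightarrow> fsum_cong R3 xs ys"
  unfolding tens_class_def
  by (auto intro: fsum_cong.refl fsum_cong.sym fsum_cong.trans)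

lemma rep_tc: "fsum_cong R3 (rep (tc xs)) xs"
proof -
  have "xs \<in> tc xs" by (simp add: tens_class_def fsum_cong.refl)
  then have "rep (tc xs) \<in> tc xs" unfolding rep_def by (rule someI)
  then show ?thesis by (auto simp: tens_class_def intro: fsum_cong.sym)
qed

lemma tc_rep: "U \<in> range tc \<Longrightarrow> tc (rep U) = U"
  by (elim rangeE) (simp add: tc_eq rep_tc)

sublocale BBH: scaled_fsum R3 UNIV "\<lambda>r (b, c, h). (sB r b, c, h)"
proof
  fix xs ys and r :: 'k assume "R3 xs ys"
  then show "fsum_cong R3 (map (\<lambda>(b, c, h). (sB r b, c, h)) xs) (map (\<lambda>(b, c, h). (sB r b, c, h)) ys)"
  proof cases
    case (7 r' a b c)
    then show ?thesis
      using fsum_cong.gen[where R = R3, OF ktens3_rel.intros(7)[of sB sB hs r' "sB r a" b c]]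
      by (simp add: mult.commute)
  qed (auto intro: fsum_cong.gen[where R = R3, OF ktens3_rel.intros(1)]
    fsum_cong.gen[where R = R3, OF ktens3_rel.intros(2)] fsum_cong.gen[where R = R3,
      OF ktens3_rel.intros(3)]
    fsum_cong.gen[where R = R3, OF ktens3_rel.intros(4)] fsum_cong.gen[where R = R3,
      OF ktens3_rel.intros(5)]
    fsum_cong.gen[where R = R3, OF ktens3_rel.intros(6)] fsum_cong.gen[where R = R3,
      OF ktens3_rel.intros(8)]
    simp: B.scale_right_distrib)
qed (auto simp: fsum_cong.refl B.scale_left_distrib intro: fsum_cong.gen[where R = R3,
  OF ktens3_rel.intros(1)]
    fsum_cong.gen[where R = R3, OF ktens3_rel.intros(4)])

lemma BH_simps:
  "carrier BH = range tc" "\<zero>\<^bsub>BH\<^esub> = tc []" "\<one>\<^bsub>BH\<^esub> = tc [(1, 1, 1)]"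
  "src BH b = tc [(b, 1, 1)]" "tgt BH b = tc [(1, b, 1)]"
  by (simp_all add: Be_cross_def)

lemma BH_add: "tc xs \<oplus>\<^bsub>BH\<^esub> tc ys = tc (xs @ ys)"
  by (simp add: Be_cross_def tc_eq fsum_cong_append rep_tc)

lemma BH_smult: "r \<odot>\<^bsub>BH\<^esub> tc xs = tc (map (\<lambda>(b, c, h). (sB r b, c, h)) xs)"
  using BBH.sc_cong[OF rep_tc] by (simp add: Be_cross_def tc_eq)

lemma BBH_sc:
  "fsum_cong R3 (map (\<lambda>(b, c, h). (sB (r + r') b, c, h)) xs)
    (map (\<lambda>(b, c, h). (sB r b, c, h)) xs @ map (\<lambda>(b, c, h). (sB r' b, c, h)) xs)"
proof (induction xs)
  case (Cons x xs)
  obtain b c h where x: "x = (b, c, h)" by (cases x)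
  let ?m = "\<lambda>r. map (\<lambda>(b, c, h). (sB r b, c, h)) xs"
  have "fsum_cong R3 ([(sB r b + sB r' b, c, h)] @ ?m (r + r'))
      (([(sB r b, c, h)] @ [(sB r' b, c, h)]) @ (?m r @ ?m r'))"
    using ktens3_rel.intros(1)[of sB sB hs "sB r b" "sB r' b" c h]
    by (intro fsum_cong_append Cons.IH fsum_cong.gen) simp
  from fsum_cong.trans[OF this fsum_cong_interchange] show ?case
    by (simp add: x B.scale_left_distrib)
qed (simp add: fsum_cong.refl)

lemma BH_module: "Module.module (ring_of_type_algebra :: 'k ring) BH"
proof (rule Module.moduleI)
  show "abelian_group BH"
  proof (rule abelian_groupI)
    fix U assume "U \<in> carrier BH"
    then obtain xs where xs: "U = tc xs" by (auto simp: BH_simps)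
    have "tc (map (\<lambda>(b, c, h). (sB (-1) b, c, h)) xs) \<oplus>\<^bsub>BH\<^esub> U = \<zero>\<^bsub>BH\<^esub>"
      unfolding xs BH_add BH_simps tc_eq
      by (rule fsum_cong.trans[OF fsum_cong.comm BBH.fsum_cong_negatives]) simp
    then show "\<exists>V\<in>carrier BH. V \<oplus>\<^bsub>BH\<^esub> U = \<zero>\<^bsub>BH\<^esub>"
      by (intro bexI[of _ "tc (map (\<lambda>(b, c, h). (sB (-1) b, c, h)) xs)"]) (auto simp: BH_simps)
  next
    fix U V assume "U \<in> carrier BH" "V \<in> carrier BH"
    then obtain xs ys where "U = tc xs" "V = tc ys" by (auto simp: BH_simps)
    then show "U \<oplus>\<^bsub>BH\<^esub> V = V \<oplus>\<^bsub>BH\<^esub> U" by (simp add: BH_add tc_eq fsum_cong.comm)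
  qed (auto simp: BH_simps BH_add)
  show "cring (ring_of_type_algebra :: 'k ring)" by (rule cring_from_type_algebra)
  fix r r' :: 'k and U assume "U \<in> carrier BH"
  then obtain xs where "U = tc xs" by (auto simp: BH_simps)
  then show "(r \<oplus>\<^bsub>ring_of_type_algebra\<^esub> r') \<odot>\<^bsub>BH\<^esub> U = r \<odot>\<^bsub>BH\<^esub> U \<oplus>\<^bsub>BH\<^esub> r' \<odot>\<^bsub>BH\<^esub> U"
    using BBH_sc[of r r' xs] by (simp add: ring_of_type_algebra_def BH_smult BH_add tc_eq)
qed (auto simp: BH_simps BH_add BH_smult tc_eq ring_of_type_algebra_def case_prod_unfold o_def
  fsum_cong.refl)

sublocale BH: k_module BH by (rule k_module.intro) (rule BH_module)

text \<open>Every structure map on classes is the evaluation of some form on a chosen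
  representative. For a trilinear form the choice drops out (\<open>ev_tc\<close>).\<close>

definition ev where "ev T U = (\<Sum>(b, c, h)\<leftarrow>rep U. T b c h)"

lemma ev_tc: "tform t T \<Longrightarrow> ev T (tc xs) = (\<Sum>(b, c, h)\<leftarrow>xs. T b c h)"
  unfolding ev_def by (rule sum_list_ktens3[OF rep_tc])

lemma lmap_ev:
  assumes T: "tform t T" and t: "vector_space t"
  shows "lmap BH t (ev T)"
proof -
  have "ev T (r \<odot>\<^bsub>BH\<^esub> tc xs) = t r (ev T (tc xs))" for r xs
    using lin_apply_sum_list[OF lin_scale_right[OF lin_id[OF t]], of r "\<lambda>(b, c, h). T b c h" xs]
    by (simp add: BH_smult ev_tc[OF T] case_prod_unfold o_def linD(2)[OF trilinear_mapD(1)[OF T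
      lin_id[OF vs_sB]]])
  then show ?thesis
    by (auto simp: lmap_def BH_simps BH_add ev_tc[OF T])
qed

lemma lin_ev: "vector_space s \<Longrightarrow> vector_space t \<Longrightarrow> (\<And>b c h. lin s t (\<lambda>x. K x b c h)) \<Longrightarrow>
    lin s t (\<lambda>x. ev (K x) U)"
  unfolding ev_def by (intro lin_sum_list) (auto simp: case_prod_unfold)

lemma tc_sum: "lmap BH t f \<Longrightarrow> f (tc xs) = (\<Sum>(b, c, h)\<leftarrow>xs. f (tc [(b, c, h)]))"
proof (induction xs)
  case Nil
  then show ?case using BH.lmapD(3)[of t f] by (simp add: BH_simps)
next
  case (Cons x xs)
  then show ?case
    using BH.lmapD(1)[of t f "tc [x]" "tc xs"] by (auto simp: BH_simps BH_add)
qed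

lemma tform_lmap:
  assumes f: "lmap BH t f" and t: "vector_space t"
  shows "tform t (\<lambda>b c h. f (tc [(b, c, h)]))"
proof -
  have add: "f (tc [x]) = f (tc [y]) + f (tc [z])" if "R3 [x] [y, z]" for x y z
  proof -
    have "tc [x] = tc [y, z]" unfolding tc_eq using that by (rule fsum_cong.gen)
    then show ?thesis using tc_sum[OF f, of "[y, z]"] by (auto split: prod.splits)
  qed
  have scale1: "f (tc [(sB r b, c, h)]) = t r (f (tc [(b, c, h)]))" for r b c h
    using BH.lmapD(2)[OF f, of "tc [(b, c, h)]" r] by (simp add: BH_smult BH_simps)
  have scale2: "tc [(b, sB r c, h)] = tc [(sB r b, c, h)]" and scale3: "tc [(b, c, hs r h)] =
    tc [(b, sB r c, h)]"
    for r b c h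
    by (auto simp: tc_eq intro: fsum_cong.sym fsum_cong.gen ktens3_rel.intros)
  show ?thesis
    unfolding trilinear_map_def
    by (auto intro!: linI t vs_sB vs_hs simp: add[OF ktens3_rel.intros(1)] add[OF ktens3_rel.intros(2)]
      add[OF ktens3_rel.intros(3)] scale1 scale2 scale3)
qed

lemma lmap_eq_ev: "lmap BH t f \<Longrightarrow> U \<in> carrier BH \<Longrightarrow> f U = ev (\<lambda>b c h. f (tc [(b, c, h)])) U"
  unfolding ev_def using tc_sum[of t f "rep U"] by (simp add: BH_simps tc_rep)

lemma BH_sep:
  assumes UV: "U \<in> carrier BH" "V \<in> carrier BH" and test: "\<And>f. lmap BH kmul f \<Longrightarrow> f U = f V"
  shows "U = V"
proof -
  obtain xs ys where xs: "U = tc xs" "V = tc ys" using UV by (auto simp: BH_simps)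
  have "fsum_cong R3 xs ys"
  proof (rule BBH.fsum_cong_by_functionals)
    fix F :: "'b \<times> 'b \<times> 'h \<Rightarrow> 'k"
    assume F: "\<And>r x. x \<in> UNIV \<Longrightarrow> F (case x of (b, c, h) \<Rightarrow> (sB r b, c, h)) = r * F x"
      "\<And>xs ys. R3 xs ys \<Longrightarrow> (\<Sum>x\<leftarrow>xs. F x) = (\<Sum>x\<leftarrow>ys. F x)"
    have F1: "F (sB r b, c, h) = r * F (b, c, h)" for r b c h using F(1)[of "(b, c, h)" r] by simp
    have F2: "F (b, sB r c, h) = r * F (b, c, h)" for r b c h
      using F(2)[OF ktens3_rel.intros(7)[of sB sB hs r b c h]] by (simp add: F1)
    have F3: "F (b, c, hs r h) = r * F (b, c, h)" for r b c h
      using F(2)[OF ktens3_rel.intros(8)[of sB sB hs b r c h]] by (simp add: F2)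
    have F4: "F (b + b', c, h) = F (b, c, h) + F (b', c, h)" "F (b, c + c', h) = F (b, c, h) +
      F (b, c', h)"
      "F (b, c, h + h') = F (b, c, h) + F (b, c, h')" for b b' c c' h h'
      using F(2)[OF ktens3_rel.intros(1)[of sB sB hs b b' c h]] F(2)[OF ktens3_rel.intros(2)[of sB
        sB hs b c c' h]]
        F(2)[OF ktens3_rel.intros(3)[of sB sB hs b c h h']] by auto
    have T: "tform kmul (\<lambda>b c h. F (b, c, h))"
      unfolding trilinear_map_def by (auto intro!: linI vs_sB vs_hs vs_kmul simp: F1 F2 F3 F4)
    show "(\<Sum>x\<leftarrow>xs. F x) = (\<Sum>x\<leftarrow>ys. F x)"
      using test[OF lmap_ev[OF T vs_kmul]] unfolding xs by (simp add: ev_tc[OF T])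
  qed simp_all
  then show ?thesis by (simp add: xs tc_eq)
qed

definition EB :: "'b \<Rightarrow> 'h \<Rightarrow> 'b \<Rightarrow> ('b \<times> 'b \<times> 'h) list set" where
  "EB b h x = tc [(b, mu h2 x, h1). (h1, h2) \<leftarrow> hcomult H h]"

lemma ev_EB: "tform t T \<Longrightarrow> ev T (EB b h x) = sw t 2 h (\<lambda>h1 h2. T b (mu h2 x) h1)"
  unfolding EB_def by (simp add: ev_tc sw_def case_prod_unfold o_def)

lemma EB_closed: "EB b h x \<in> carrier BH" by (simp add: EB_def BH_simps)

definition mult_form where
  "mult_form T b b' h c c' g =
    sw kmul 2 h (\<lambda>h1 r. sw kmul 2 r (\<lambda>h2 r. sw kmul 2 r (\<lambda>h3 h4.
    sw kmul 3 g (\<lambda>g1 r. sw kmul 3 r (\<lambda>g2 r. sw kmul 3 r (\<lambda>g3 g4.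
      T (b * (h1 \<triangleright> c) * \<sigma> h2 g1) (c' * (S g4 \<triangleright> b') * \<sigma> (S g3) (S h4)) (h3 * g2)))))))"

lemma ev_mult:
  assumes T: "tform kmul T"
  shows "ev T (U \<otimes>\<^bsub>BH\<^esub> V) = ev (\<lambda>b b' h. ev (\<lambda>c c' g. mult_form T b b' h c c' g) V) U"
proof -
  have "(\<Sum>(b, c, h)\<leftarrow>Be_cross_mult H act \<sigma> (b, b', h) (c, c', g). T b c h) = mult_form T b b' h c c' g"
    for b b' h c c' g
    unfolding mult_form_def comult4_sw[of _ h kmul 2, symmetric] comult4_sw[of _ g kmul 3, symmetric]
    by (simp add: Be_cross_mult_def sum_list_concat_map case_prod_unfold o_def)
  then have *: "(\<Sum>z\<leftarrow>Be_cross_mult H act \<sigma> x y. case z of (b, c, h) \<Rightarrow> T b c h) =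
      (case x of (b, b', h) \<Rightarrow> case y of (c, c', g) \<Rightarrow> mult_form T b b' h c c' g)" for x y
    by (cases x; cases y) auto
  have "U \<otimes>\<^bsub>BH\<^esub> V = tc (concat [Be_cross_mult H act \<sigma> x y. x \<leftarrow> rep U, y \<leftarrow> rep V])"
    by (simp add: Be_cross_def)
  then have "ev T (U \<otimes>\<^bsub>BH\<^esub> V) = (\<Sum>z\<leftarrow>concat [Be_cross_mult H act \<sigma> x y. x \<leftarrow> rep U, y \<leftarrow> rep V].
      case z of (b, c, h) \<Rightarrow> T b c h)"
    by (simp add: ev_tc[OF T])
  also have "\<dots> = (\<Sum>x\<leftarrow>rep U. \<Sum>y\<leftarrow>rep V. \<Sum>z\<leftarrow>Be_cross_mult H act \<sigma> x y. case z of (b, c, h) \<Rightarrow> T b c h)"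
    by (simp add: sum_list_concat_map sum_list_map_concat o_def)
  finally show ?thesis unfolding * ev_def by (simp add: case_prod_unfold)
qed

lemma tform_mult:
  assumes T: "tform kmul T"
  shows "tform kmul (\<lambda>b b' h. mult_form T b b' h c c' g)" "tform kmul (\<lambda>c c' g. mult_form T b b' h
    c c' g)"
    "tform kmul (\<lambda>b b' h. ev (\<lambda>c c' g. mult_form T b b' h c c' g) V)"
  by (simp_all add: trilinear_map_def lin_ev vs_sB vs_hs vs_kmul mult_form_def lin_all
    trilinear_mapD[OF T])

text \<open>The antipodes of the product sit in the second factor of B^e, and there
  \<open>mu_cross\<close> merges them into a single \<open>mu\<close> at the product of two
  legs.\<close>

lemma EB_mult:
  assumes f: "lmap BH kmul f"
  shows "f (EB b h x \<otimes>\<^bsub>BH\<^esub> EB c g y) =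
      sw kmul 2 h (\<lambda>h1 r. sw kmul 2 r (\<lambda>h2 h3. sw kmul 3 g (\<lambda>g1 q. sw kmul 3 q (\<lambda>g2 g3.
        f (EB (b * lam h1 c g1) (h2 * g2) (rho h3 y g3 * x))))))" (is "_ = ?R")
proof -
  define T where "T = (\<lambda>b c h. f (tc [(b, c, h)]))"
  have T: "tform kmul T" unfolding T_def by (rule tform_lmap[OF f vs_kmul])
  note lins = trilinear_mapD[OF T] lin_all
  note pull = sw_pull[OF trilinear_mapD(1)[OF T lin_id[OF vs_sB]]] sw_pull[OF trilinear_mapD(2)[OF
    T lin_id[OF vs_sB]]]
  have f_T: "f U = ev T U" if "U \<in> carrier BH" for U
    using lmap_eq_ev[OF f that] by (simp add: T_def)
  have mult_closed: "U \<otimes>\<^bsub>BH\<^esub> V \<in> carrier BH" for U V by (simp add: Be_cross_def)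
  have "f (EB b h x \<otimes>\<^bsub>BH\<^esub> EB c g y) = sw kmul 2 h (\<lambda>p q. sw kmul 3 g (\<lambda>p' q'. mult_form T b (mu q
    x) p c (mu q' y) p'))"
    unfolding f_T[OF mult_closed] ev_mult[OF T]
    unfolding ev_EB[OF tform_mult(3)[OF T]]
    by (simp add: ev_EB[OF tform_mult(2)[OF T]] sw_label[of kmul 2 g _ 3])
  also have "\<dots> = sw kmul 2 h (\<lambda>h1 r. sw kmul 2 r (\<lambda>h2 r. sw kmul 2 r (\<lambda>h3 p.
      sw kmul 3 g (\<lambda>g1 r. sw kmul 3 r (\<lambda>g2 p'. T (b * ((h1 \<triangleright> c) * \<sigma> h2 g1))
        (sw sB 2 p (\<lambda>h1 h2. sw sB 3 p' (\<lambda>g1 r. sw sB 3 r (\<lambda>g2 g3.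
          mu g3 y * ((S g2 \<triangleright> mu h2 x) * \<sigma> (S g1) (S h1)))))) (h3 * g2))))))"
    by (simp add: mult_form_def lins sw_norm sw_skip pull)
  also have "\<dots> = ?R"
    unfolding mu_cross
    by (simp add: f_T EB_closed ev_EB[OF T] lam_def[of h] lam_def[of _ c] lins sw_norm sw_skip
      pull sw_prod_23)
  finally show ?thesis .
qed

lemma tform_lift:
  assumes G: "trilinear_map sB hs sB t G"
  shows "tform t (\<lambda>b c h. sw t 2 h (\<lambda>h1 h2. G b h1 (nu h2 c)))"
  by (simp add: trilinear_map_def lin_all trilinear_mapD[OF G])

text \<open>Sending b \<otimes> c # h to (b, h1, nu h2 c) undoes the coordinates by
  \<open>nu_mu\<close>. Thus every trilinear form on the coordinates extends to a functional, as
  \<open>E_lift\<close> demands.\<close>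

lemma ev_lift:
  assumes G: "trilinear_map sB hs sB t G" and t: "vector_space t"
  shows "ev (\<lambda>b c h. sw t 2 h (\<lambda>h1 h2. G b h1 (nu h2 c))) (EB b h x) = G b h x"
proof -
  note lins = trilinear_mapD[OF G] lin_all
  note pull = sw_pull[OF trilinear_mapD(3)[OF G lin_id[OF vs_sB]]]
  have "ev (\<lambda>b c h. sw t 2 h (\<lambda>h1 h2. G b h1 (nu h2 c))) (EB b h x) =
      sw t 2 h (\<lambda>h1 p. G b h1 (sw sB 2 p (\<lambda>h2 h3. nu h2 (mu h3 x))))"
    by (simp add: ev_EB[OF tform_lift[OF G]] lins sw_norm pull)
  also have "\<dots> = G b h x"
    unfolding nu_mu
    by (simp add: linD(2)[OF trilinear_mapD(3)[OF G lin_id[OF vs_sB]]] sw_counit_right[where t =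
      t] lins)
  finally show ?thesis .
qed

definition comult_form where
  "comult_form \<Psi> b b' h = sw kmul 2 h (\<lambda>p h4. sw kmul 2 p (\<lambda>h1 q. \<Psi> (tc [(b, invS q, h1)])
    (tc [(1, b', h4)])))"

lemma tform_bilmap:
  assumes "bilmap BH kmul \<Psi>"
  shows "tform kmul (\<lambda>b c h. \<Psi> (tc [(b, c, h)]) (tc xs))" "tform kmul (\<lambda>b c h. \<Psi> (tc xs) (tc [(b,
    c, h)]))"
  using assms by (auto intro!: tform_lmap vs_kmul simp: bilmap_def BH_simps)

text \<open>Since \<open>mu h 1 = invS h\<close>, the factor \<sigma>^-1(S h2, h3) in the first leg
  of the coproduct is exactly what turns this leg into \<open>EB b h1 1\<close>.\<close>

lemma sum_comult:
  assumes \<Psi>: "bilmap BH kmul \<Psi>"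
  shows "(\<Sum>(U1, U2)\<leftarrow>comult BH U. \<Psi> U1 U2) = ev (comult_form \<Psi>) U"
    "tform kmul (comult_form \<Psi>)"
    "ev (comult_form \<Psi>) (EB b h x) = sw kmul 2 h (\<lambda>h1 h2. \<Psi> (EB b h1 1) (EB 1 h2 x))"
proof -
  note tf = trilinear_mapD[OF tform_bilmap(1)[OF \<Psi>]] trilinear_mapD[OF tform_bilmap(2)[OF \<Psi>]] lin_all
  note pull = sw_pull[OF trilinear_mapD(2)[OF tform_bilmap(1)[OF \<Psi>] lin_id[OF vs_sB]]]
  have 1: "comult_form \<Psi> b b' h = (\<Sum>(h1, h2, h3, h4)\<leftarrow>comult4 (hcomult H) h.
      \<Psi> (tc [(b, \<sigma>i (S h2) h3, h1)]) (tc [(1, b', h4)]))" for b b' h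
    unfolding comult4_sw[of _ h kmul 2]
    by (simp add: comult_form_def invS_def tf sw_norm sw_skip pull)
  show "(\<Sum>(U1, U2)\<leftarrow>comult BH U. \<Psi> U1 U2) = ev (comult_form \<Psi>) U"
    by (simp add: Be_cross_def ev_def 1 sum_list_concat_map case_prod_unfold o_def)
  show T: "tform kmul (comult_form \<Psi>)"
    by (simp add: trilinear_map_def comult_form_def tf)
  have E1: "lmap BH kmul (\<lambda>U. \<Psi> U (tc xs))" "lmap BH kmul (\<lambda>U. \<Psi> (tc xs) U)" for xs
    using \<Psi> by (auto simp: bilmap_def BH_simps)
  have E: "\<Psi> (EB b h x) (tc xs) = sw kmul 2 h (\<lambda>h1 h2. \<Psi> (tc [(b, mu h2 x, h1)]) (tc xs))"
    "\<Psi> (tc xs) (EB b h x) = sw kmul 2 h (\<lambda>h1 h2. \<Psi> (tc xs) (tc [(b, mu h2 x, h1)]))" for b h x xs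
    using lmap_eq_ev[OF E1(1)[of xs] EB_closed[of b h x]] lmap_eq_ev[OF E1(2)[of xs] EB_closed[of
      b h x]]
    by (simp_all add: ev_EB[OF tform_bilmap(1)[OF \<Psi>]] ev_EB[OF tform_bilmap(2)[OF \<Psi>]])
  have E2: "\<Psi> (EB b h x) (EB c g y) = sw kmul 2 h (\<lambda>h1 h2. sw kmul 2 g (\<lambda>g1 g2.
      \<Psi> (tc [(b, mu h2 x, h1)]) (tc [(c, mu g2 y, g1)])))" for b h x c g y
    using E(1)[of b h x "[(c, mu h2 y, h1). (h1, h2) \<leftarrow> hcomult H g]"] by (simp add: E(2) flip: EB_def)
  show "ev (comult_form \<Psi>) (EB b h x) = sw kmul 2 h (\<lambda>h1 h2. \<Psi> (EB b h1 1) (EB 1 h2 x))"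
    by (simp add: ev_EB[OF T] comult_form_def E2 mu_one tf sw_norm sw_skip)
qed

lemma presented_Be_cross: "presented H sB act \<sigma> \<sigma>i BH EB"
proof -
  have f_ev: "f U = ev (\<lambda>b c h. f (tc [(b, c, h)])) U" if "lmap BH kmul f" "U \<in> carrier BH" for f U
    by (rule lmap_eq_ev[OF that])
  have tf: "tform kmul (\<lambda>b c h. f (tc [(b, c, h)]))" if "lmap BH kmul f" for f
    by (rule tform_lmap[OF that vs_kmul])
  have mult_closed: "U \<otimes>\<^bsub>BH\<^esub> V \<in> carrier BH" for U V by (simp add: Be_cross_def)
  have E11: "EB b 1 x = tc [(b, x, 1)]" for b x
  proof (rule BH_sep)
    fix f assume f: "lmap BH kmul f"
    show "f (EB b 1 x) = f (tc [(b, x, 1)])"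
      by (simp add: f_ev[OF f EB_closed] ev_EB[OF tf[OF f]] sw_one lin_all trilinear_mapD[OF tf[OF
        f]] mu_one)
  qed (simp_all add: EB_closed, simp add: BH_simps)
  \<comment> \<open>The action and the cocycle in the counit combine to \<open>nu\<close>; on
    coordinates \<open>nu_mu\<close> then evaluates it.\<close>
  have counit: "counit BH U = ev (\<lambda>b b' h. b * nu h b') U" for U
  proof -
    have "b * nu h b' = (\<Sum>(h1, h2, h3)\<leftarrow>comult3 (hcomult H) h. b * (h1 \<triangleright> b') * \<sigma> h2 (S h3))" for b b' h
      unfolding comult3_sw[of _ h sB 2] by (simp add: nu_def nuS_def lin_all sw_norm)
    then show ?thesis by (simp add: Be_cross_def ev_def)
  qed
  have counit_T: "tform sB (\<lambda>b b' h. b * nu h b')"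
    by (simp add: trilinear_map_def lin_all)
  show ?thesis
  proof (intro presented.intro presented_coring.intro presented_module.intro presented_axioms.intro
      presented_coring_axioms.intro presented_module_axioms.intro)
    show "crossed H sB (\<triangleright>) \<sigma> \<sigma>i" by unfold_locales
    show "k_module BH" by unfold_locales
    fix f assume f: "lmap BH kmul f"
    show "trilinear_map sB hs sB kmul (\<lambda>b h x. f (EB b h x))"
      by (simp add: trilinear_map_def f_ev[OF f EB_closed] ev_EB[OF tf[OF f]] lin_all
        trilinear_mapD[OF tf[OF f]])
    fix U V assume UV: "U \<in> carrier BH" "V \<in> carrier BH"
    have fm: "f (U \<otimes>\<^bsub>BH\<^esub> V) = ev (\<lambda>b b' h. ev (\<lambda>c c' g. mult_form (\<lambda>b c h. f (tc [(b, c, h)]))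
      b b' h c c' g) V) U" for U V
      unfolding f_ev[OF f mult_closed] by (rule ev_mult[OF tf[OF f]])
    show "lmap BH kmul (\<lambda>U. f (U \<otimes>\<^bsub>BH\<^esub> V))"
      unfolding fm by (rule lmap_ev[OF tform_mult(3)[OF tf[OF f]] vs_kmul])
    show "lmap BH kmul (\<lambda>V. f (U \<otimes>\<^bsub>BH\<^esub> V))"
    proof -
      \<comment> \<open>The double evaluation may be carried out in either order, which gives
        linearity in V by the argument used for U.\<close>
      have "ev (\<lambda>b b' h. ev (\<lambda>c c' g. mult_form T b b' h c c' g) V) U =
          ev (\<lambda>c c' g. ev (\<lambda>b b' h. mult_form T b b' h c c' g) U) V" for T U V
        unfolding ev_def case_prod_unfold by (rule sum_list_swap)
      moreover have "tform kmul (\<lambda>c c' g. ev (\<lambda>b b' h. mult_form (\<lambda>b c h. f (tc [(b, c, h)]))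
        b b' h c c' g) U)"
        using tform_mult(2)[OF tf[OF f]]
        by (auto simp: trilinear_map_def intro!: lin_ev vs_sB vs_hs vs_kmul)
      ultimately show ?thesis
        unfolding fm using lmap_ev[OF _ vs_kmul] by simp
    qed
  next
    fix U assume U: "U \<in> carrier BH"
    \<comment> \<open>By \<open>mu_nu\<close> the coordinates of b \<otimes> b' # h are (b, h1, nu
      h2 b').\<close>
    let ?xs = "concat (map (\<lambda>(b, b', h). map (\<lambda>(h1, h2). (b, h1, nu h2 b')) (hcomult H h)) (rep U))"
    let ?Us = "map (\<lambda>(b, h, x). EB b h x) ?xs"
    have sub: "set ?Us \<subseteq> carrier BH" by (auto simp: EB_closed)
    have "U = lsum BH ?Us"
    proof (rule BH_sep)
      fix f assume f: "lmap BH kmul f"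
      define T where "T = (\<lambda>b c h. f (tc [(b, c, h)]))"
      have T: "tform kmul T" unfolding T_def by (rule tf[OF f])
      have f_EB: "f (EB b h x) = sw kmul 2 h (\<lambda>h1 h2. T b (mu h2 x) h1)" for b h x
        using f_ev[OF f EB_closed] ev_EB[OF T] by (simp add: T_def)
      have id: "sw kmul 2 h (\<lambda>h1 h2. f (EB b h1 (nu h2 b'))) = T b b' h" for b b' h
      proof -
        have "sw kmul 2 h (\<lambda>h1 h2. f (EB b h1 (nu h2 b'))) =
            sw kmul 2 h (\<lambda>h1 p. T b (sw sB 2 p (\<lambda>h2 h3. mu h2 (nu h3 b'))) h1)"
          by (simp add: f_EB sw_pull[OF trilinear_mapD(2)[OF T lin_id[OF vs_sB]]] lin_all
            trilinear_mapD[OF T] sw_norm)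
        also have "\<dots> = T b b' h"
          unfolding mu_nu by (simp add: linD(2)[OF trilinear_mapD(2)[OF T lin_id[OF vs_sB]]] sw_eps_k
            trilinear_mapD[OF T] lin_cross)
        finally show ?thesis .
      qed
      have "f (lsum BH ?Us) = (\<Sum>(b, b', h)\<leftarrow>rep U. sw kmul 2 h (\<lambda>h1 h2. f (EB b h1 (nu h2 b'))))"
        unfolding BH.lmap_lsum[OF f sub]
        by (simp add: sum_list_concat_map sw_def case_prod_unfold o_def)
      then show "f U = f (lsum BH ?Us)"
        unfolding id using f_ev[OF f U] by (simp add: ev_def T_def)
    qed (rule U BH.lsum_closed[OF sub])+
    then show "\<exists>xs. U = lsum BH (map (\<lambda>(b, h, x). EB b h x) xs)" by blast
  next
    fix G assume G: "trilinear_map sB hs sB kmul G"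
    show "\<exists>f. lmap BH kmul f \<and> (\<forall>b h x. f (EB b h x) = G b h x)"
      using lmap_ev[OF tform_lift[OF G] vs_kmul] ev_lift[OF G vs_kmul] by blast
  next
    fix \<Psi> assume \<Psi>: "bilmap BH kmul \<Psi>"
    show "lmap BH kmul (\<lambda>U. \<Sum>(U1, U2)\<leftarrow>comult BH U. \<Psi> U1 U2)"
      "(\<Sum>(U1, U2)\<leftarrow>comult BH (EB b h x). \<Psi> U1 U2) = sw kmul 2 h (\<lambda>h1 h2. \<Psi> (EB b h1 1)
        (EB 1 h2 x))" for b h x
      unfolding sum_comult(1)[OF \<Psi>] by (rule lmap_ev[OF sum_comult(2)[OF \<Psi>] vs_kmul]
        sum_comult(3)[OF \<Psi>])+
  next
    show "lmap BH sB (counit BH)"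
      unfolding counit[abs_def] by (rule lmap_ev[OF counit_T vs_sB])
    fix b h x
    have "counit BH (EB b h x) = b * sw sB 2 h (\<lambda>h1 h2. nu h1 (mu h2 x))"
      by (simp add: counit ev_EB[OF counit_T] sw_norm)
    then show "counit BH (EB b h x) = sB (eps h) (b * x)"
      unfolding nu_mu by (simp add: sB_simps)
  next
    fix U show "set (comult BH U) \<subseteq> carrier BH \<times> carrier BH"
      by (auto simp: Be_cross_def)
  qed (simp_all add: EB_closed EB_mult mult_closed E11 BH_simps(2-) BH_sep)
qed

end

section \<open>Forms on the smash product bialgebroid and the cocycle twist\<close>

context crossed
begin

abbreviation "triv \<equiv> trivial_cocycle H sB"

text \<open>For the trivial cocycle condition (2) says that \<triangleright> is an action, that is,
  associative type. Everything proved for \<sigma> therefore applies to B^e # H.\<close>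

lemma crossed_trivial: "crossed H sB act triv triv"
proof -
  note [simp del] = B.scale_scale
  have bil: "bilinear_map hs hs sB triv"
    by (simp add: bilinear_map_def trivial_cocycle_def[abs_def] B.scale_scale[symmetric] lin_cross)
  show ?thesis
  proof (intro crossed.intro cocycle_cross_product.intro crossed_axioms.intro bil)
    show "hopf_algebra H" "k_algebra sB" by unfold_locales
    show "associative_type (\<triangleright>)" by (rule assoc_type)
    fix h g b
    show "h \<triangleright> (g \<triangleright> b) = (\<Sum>(h1, h2, h3)\<leftarrow>comult3 (hcomult H) h. \<Sum>(g1, g2, g3)\<leftarrow>comult3 (hcomult H) g.
        triv h1 g1 * ((h2 * g2) \<triangleright> b) * triv h3 g3)"
      unfolding comult3_sw[of _ h sB 2] comult3_sw[of _ g sB 2]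
      by (simp add: trivial_cocycle_def sB_simps sw_eps lin_cross act_mult sw_sB_pull)
  next
    fix h g f
    show "(\<Sum>(h1, h2)\<leftarrow>hcomult H h. \<Sum>(g1, g2)\<leftarrow>hcomult H g. \<Sum>(f1, f2)\<leftarrow>hcomult H f.
          (h1 \<triangleright> triv g1 f1) * triv h2 (g2 * f2)) =
       (\<Sum>(h1, h2)\<leftarrow>hcomult H h. \<Sum>(g1, g2)\<leftarrow>hcomult H g. triv h1 g1 * triv (h2 * g2) f)"
      unfolding sw_def[of sB 2, symmetric]
      by (simp add: trivial_cocycle_def act_sB act_one sB_simps counit_mult sw_eps lin_cross sw_sB_pull)
        (simp add: B.scale_scale ac_simps)
    show "(\<Sum>(h1, h2)\<leftarrow>hcomult H h. \<Sum>(g1, g2)\<leftarrow>hcomult H g. triv h1 g1 * triv h2 g2) = sB (eps h *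
      eps g) 1"
      unfolding sw_def[of sB 2, symmetric]
      by (simp add: trivial_cocycle_def sB_simps sw_eps lin_cross sw_sB_pull)
    then show "(\<Sum>(h1, h2)\<leftarrow>hcomult H h. \<Sum>(g1, g2)\<leftarrow>hcomult H g. triv h1 g1 * triv h2 g2) =
      sB (eps h * eps g) 1" .
  qed (simp_all add: act_bilinear measuring_mult measuring_one one_act trivial_cocycle_def counit_one)
qed

definition conv2 where
  "conv2 \<gamma> \<delta> h g = sw sB 2 h (\<lambda>h1 h2. sw sB 3 g (\<lambda>g1 g2. \<gamma> h1 g1 * \<delta> h2 g2))"

abbreviation "bil \<equiv> bilinear_map hs hs sB"

lemma lmap_B_mult:
  "lmap L sB f \<Longrightarrow> lmap L sB (\<lambda>U. f U * c)" "lmap L sB f \<Longrightarrow> lmap L sB (\<lambda>U. c * f U)"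
  by (auto simp: lmap_def algebra_simps B.scale_mult_left B.scale_mult_right)

lemma conv2_bil:
  assumes "bil \<gamma>" "bil \<delta>"
  shows "bil (conv2 \<gamma> \<delta>)"
  by (simp add: bilinear_map_def conv2_def[abs_def] lin_cross bilinear_mapD[OF assms(1)]
    bilinear_mapD[OF assms(2)])

lemma conv2_assoc:
  assumes "bil \<alpha>" "bil \<beta>" "bil \<gamma>"
  shows "conv2 (conv2 \<alpha> \<beta>) \<gamma> = conv2 \<alpha> (conv2 \<beta> \<gamma>)"
  by (intro ext) (simp add: conv2_def sw_norm bilinear_mapD[OF assms(1)] bilinear_mapD[OF assms(2)]
    bilinear_mapD[OF assms(3)])

lemma conv2_unit:
  assumes "bil \<gamma>"
  shows "conv2 \<gamma> (\<lambda>h g. sB (eps h * eps g) 1) = \<gamma>" "conv2 (\<lambda>h g. sB (eps h * eps g) 1) \<gamma> = \<gamma>"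
  by (intro ext; simp add: conv2_def sB_simps sw_eps lin_cross sw_sB_pull bilinear_mapD[OF assms]
    del: B.scale_scale)+

lemma conv2_\<sigma>: "conv2 \<sigma> \<sigma>i = (\<lambda>h g. sB (eps h * eps g) 1)" "conv2 \<sigma>i \<sigma> = (\<lambda>h g. sB (eps h * eps g) 1)"
  by (intro ext; simp add: conv2_def sw_\<sigma>_\<sigma>i sw_\<sigma>i_\<sigma>)+

end

section \<open>Bimodule forms on the smash product bialgebroid in coordinates\<close>

locale twisting = crossed H sB act \<sigma> \<sigma>i +
  smash: presented H sB act "trivial_cocycle H sB" "trivial_cocycle H sB" L E
  for H :: "('k::field, 'h::{ring, monoid_mult}) hopf"
    and sB :: "'k \<Rightarrow> 'b::{ring, monoid_mult} \<Rightarrow> 'b"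
    and act :: "'h \<Rightarrow> 'b \<Rightarrow> 'b" (infixr "\<triangleright>" 75)
    and \<sigma> \<sigma>i :: "'h \<Rightarrow> 'h \<Rightarrow> 'b"
    and L :: "('k, 'b, 'l) bialgebroid" (structure)
    and E :: "'b \<Rightarrow> 'h \<Rightarrow> 'b \<Rightarrow> 'l"
begin

lemma smash_lam_rho: "smash.lam h c g = sB (eps g) (h \<triangleright> c)" "smash.rho h c g = sB (eps g) (h \<triangleright> c)"
  by (simp_all add: smash.lam_def smash.rho_def trivial_cocycle_def sB_simps sw_eps lin_cross
    sw_sB_pull del: B.scale_scale)

lemma smash_mult_E:
  assumes f: "lmap L t f" and t: "vector_space t"
  shows "f (E b h x \<otimes> E c g y) =
    sw t 2 h (\<lambda>h1 r. sw t 2 r (\<lambda>h2 h3. f (E (b * (h1 \<triangleright> c)) (h2 * g) ((h3 \<triangleright> y) * x))))"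
proof -
  note tri = smash.E_tri[OF f t]
  note scale = linD(2)[OF trilinear_mapD(1)[OF tri lin_id[OF vs_sB]]]
    linD(2)[OF trilinear_mapD(3)[OF tri lin_id[OF vs_sB]]]
  note pull = sw_pull[OF lin_scale_right[OF lin_id[OF t]], symmetric]
  show ?thesis
    by (simp add: smash.mult_E[OF f t] smash_lam_rho sB_simps scale pull trilinear_mapD[OF tri]
      lin_cross lin_scale_right[where t = t] sw_counit_left[where t = t] sw_counit_right[where t = t])
qed

text \<open>Every form is determined by its values \<open>\<gamma> h g\<close> on \<open>1 \<otimes> 1 # h\<close> and \<open>1 \<otimes> 1 # g\<close>.\<close>

definition coords :: "('h \<Rightarrow> 'h \<Rightarrow> 'b) \<Rightarrow> ('l \<Rightarrow> 'l \<Rightarrow> 'b) \<Rightarrow> bool" where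
  "coords \<gamma> f \<longleftrightarrow> bilinear_map hs hs sB \<gamma> \<and> bilmap L sB f \<and> (\<forall>b h x c g y. f (E b h x) (E c g y) =
    sw sB 2 h (\<lambda>h1 r. sw sB 2 r (\<lambda>h2 h3. b * ((h1 \<triangleright> c) * (\<gamma> h2 g * ((h3 \<triangleright> y) * x))))))"

lemma coordsD:
  assumes "coords \<gamma> f"
  shows "bilinear_map hs hs sB \<gamma>" "bilmap L sB f" "f (E b h x) (E c g y) =
    sw sB 2 h (\<lambda>h1 r. sw sB 2 r (\<lambda>h2 h3. b * ((h1 \<triangleright> c) * (\<gamma> h2 g * ((h3 \<triangleright> y) * x)))))"
  using assms by (auto simp: coords_def)

lemma bil_eqI:
  assumes f: "bilmap L t f" and g: "bilmap L t g"
    and eq: "\<And>b h x c k y. f (E b h x) (E c k y) = g (E b h x) (E c k y)"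
    and UV: "U \<in> carrier L" "V \<in> carrier L"
  shows "f U V = g U V"
proof -
  have "f U (E c k y) = g U (E c k y)" for c k y
    by (rule smash.lmap_eqI[OF smash.bilmapD(1)[OF f] smash.bilmapD(1)[OF g] eq UV(1)])
      (rule smash.E_closed)+
  from smash.lmap_eqI[OF smash.bilmapD(2)[OF f UV(1)] smash.bilmapD(2)[OF g UV(1)] this UV(2)]
  show ?thesis .
qed

lemma coords_agree:
  assumes "coords \<gamma> f" "coords \<gamma> g" "U \<in> carrier L" "V \<in> carrier L"
  shows "f U V = g U V"
  by (rule bil_eqI[OF coordsD(2)[OF assms(1)] coordsD(2)[OF assms(2)] _ assms(3,4)])
    (simp only: coordsD(3)[OF assms(1)] coordsD(3)[OF assms(2)])

text \<open>Balancing is the measuring property: h \<triangleright> (e c) splits over the legs of h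
  in the same way as the product of E b h x with s(e), and similarly for t(e) on the right.\<close>

lemma coords_forms:
  assumes f: "coords \<gamma> f"
  shows "f \<in> bimodule_forms L"
proof -
  note fb = coordsD(2)[OF f] and f_E = coordsD(3)[OF f] and \<gamma> = bilinear_mapD[OF coordsD(1)[OF f]]
  note cl = smash.src_closed smash.tgt_closed smash.E_closed smash.mult_closed
  have src: "f (U \<otimes> src L e) V = f U (src L e \<otimes> V)" and tgt: "f (U \<otimes> tgt L e) V = f U (tgt L e \<otimes> V)"
    if "U \<in> carrier L" "V \<in> carrier L" for U V e
    by (rule bil_eqI[of sB "\<lambda>U V. f (U \<otimes> src L e) V" "\<lambda>U V. f U (src L e \<otimes> V)"]
        bil_eqI[of sB "\<lambda>U V. f (U \<otimes> tgt L e) V" "\<lambda>U V. f U (tgt L e \<otimes> V)"];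
      simp add: that smash.bilmap_mult[OF fb] cl smash.src_mult_E smash.tgt_mult_E f_E
        smash.E_mult_src[OF smash.bilmapD(1)[OF fb smash.E_closed] vs_sB]
        smash.E_mult_tgt[OF smash.bilmapD(1)[OF fb smash.E_closed] vs_sB]
        lin_all \<gamma> sw_norm sw_skip measuring[where n = 2])+
  have bim: "f (src L b \<otimes> tgt L c \<otimes> U) V = b * f U V * c" if "U \<in> carrier L" "V \<in> carrier L" for U V b c
  proof (rule bil_eqI[of sB "\<lambda>U V. f (src L b \<otimes> tgt L c \<otimes> U) V" "\<lambda>U V. b * f U V * c"])
    show "bilmap L sB (\<lambda>U V. b * f U V * c)"
      by (rule smash.bilmap_comp[OF fb]) (simp add: lin_cross)
  qed (simp_all add: that smash.bilmap_mult[OF fb] cl smash.mult_assoc smash.src_mult_E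
    smash.tgt_mult_E f_E
    sw_norm)
  have add: "f (U \<oplus> U') V = f U V + f U' V" "f V (U \<oplus> U') = f V U + f V U'"
    if "U \<in> carrier L" "U' \<in> carrier L" "V \<in> carrier L" for U U' V
    using smash.lmapD(1)[OF smash.bilmapD(1)[OF fb]] smash.lmapD(1)[OF smash.bilmapD(2)[OF fb]] that
    by auto
  have bal: "f (U \<otimes> (src L b \<otimes> tgt L c)) V = f U ((src L b \<otimes> tgt L c) \<otimes> V)"
    if "U \<in> carrier L" "V \<in> carrier L" for U V b c
  proof -
    have "f (U \<otimes> (src L b \<otimes> tgt L c)) V = f ((U \<otimes> src L b) \<otimes> tgt L c) V"
      by (simp add: smash.mult_assoc cl that)
    also have "\<dots> = f U (src L b \<otimes> (tgt L c \<otimes> V))"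
      by (simp add: src tgt cl that)
    finally show ?thesis by (simp add: smash.mult_assoc cl that)
  qed
  show ?thesis
    unfolding bimodule_forms_def by (auto simp: add bal bim)
qed

text \<open>The convolution inverse is known only as some biadditive bimodule form. Its k-linearity
  comes from the scalars inside s(B). The coordinates of the second argument move to the first by
  balancing, pass h through the action and leave on the outside, so that only the values at E 1 h 1
  and E 1 g 1 remain.\<close>

lemma forms_coords:
  assumes f: "f \<in> bimodule_forms L"
  shows "coords (\<lambda>h g. f (E 1 h 1) (E 1 g 1)) f"
proof -
  note cl = smash.src_closed smash.tgt_closed smash.E_closed smash.mult_closed smash.one_closed
  interpret LR: ring L by (rule smash.L_ring)
  have st1: "src L 1 = \<one>" "tgt L 1 = \<one>" by (simp_all add: smash.src_E smash.tgt_E smash.one_E)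
  have add: "f (U \<oplus> U') V = f U V + f U' V" "f V (U \<oplus> U') = f V U + f V U'"
    and bal: "f (U \<otimes> (src L b \<otimes> tgt L c)) V = f U ((src L b \<otimes> tgt L c) \<otimes> V)"
    and bim: "f (src L b \<otimes> tgt L c \<otimes> U) V = b * f U V * c"
    if "U \<in> carrier L" "U' \<in> carrier L" "V \<in> carrier L" for U U' V b c
    using f that by (simp_all add: bimodule_forms_def)
  have src: "f (src L b \<otimes> U) V = b * f U V" and tgt: "f (tgt L b \<otimes> U) V = f U V * b"
    and bsrc: "f (U \<otimes> src L b) V = f U (src L b \<otimes> V)" and btgt: "f (U \<otimes> tgt L b) V = f U (tgt L b \<otimes> V)"
    if "U \<in> carrier L" "V \<in> carrier L" for U V b
    using bim[OF that(1,1,2), of b 1] bim[OF that(1,1,2), of 1 b] bal[OF that(1,1,2),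
      of b 1] bal[OF that(1,1,2), of 1 b]
    by (simp_all add: st1 cl that)
  have sc: "f (r \<odot> U) V = sB r (f U V)" "f U (r \<odot> V) = sB r (f U V)" if "U \<in> carrier L" "V \<in>
    carrier L" for U V r
  proof -
    show 1: "f (r \<odot> U) V = sB r (f U V)"
      using src[OF that, of "sB r 1"] by (simp add: smash.smult_mult that sB_simps)
    have "U \<otimes> src L (sB r 1) = r \<odot> U"
    proof -
      have "src L (sB r 1) = r \<odot> \<one>" by (simp add: smash.src_E smash.one_E smash.E_scale)
      then show ?thesis by (simp add: smash.mult_smult cl that)
    qed
    then show "f U (r \<odot> V) = sB r (f U V)"
      using bsrc[OF that, of "sB r 1"] 1 by (simp add: smash.smult_mult that)
  qed
  have fb: "bilmap L sB f"
    by (auto simp: bilmap_def lmap_def add sc)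
  have bil: "bilinear_map hs hs sB (\<lambda>h g. f (E 1 h 1) (E 1 g 1))"
    using trilinear_mapD(2)[OF smash.E_tri[OF smash.bilmapD(1)[OF fb smash.E_closed] vs_sB]
      lin_id[OF vs_hs]]
      trilinear_mapD(2)[OF smash.E_tri[OF smash.bilmapD(2)[OF fb smash.E_closed] vs_sB] lin_id[OF
        vs_hs]]
    by (simp add: bilinear_map_def)
  have "f (E b h x) (E c g y) =
    sw sB 2 h (\<lambda>h1 r. sw sB 2 r (\<lambda>h2 h3. b * ((h1 \<triangleright> c) * (f (E 1 h2 1) (E 1 g 1) * ((h3 \<triangleright> y) *
      x)))))" for b h x c g y
  proof -
    have 1: "E b h x = src L b \<otimes> (tgt L x \<otimes> E 1 h 1)" for b h x
      by (simp add: smash.src_mult_E smash.tgt_mult_E)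
    have 2: "f (E b h x) V = b * (f (E 1 h 1) V * x)" if "V \<in> carrier L" for b h x V
      unfolding 1[of b h x] using that by (simp add: src tgt cl)
    have "f (E 1 h 1) (E c g y) = f ((E 1 h 1 \<otimes> src L c) \<otimes> tgt L y) (E 1 g 1)"
      unfolding 1[of c g y] by (simp add: bsrc btgt cl)
    also have "\<dots> = sw sB 2 h (\<lambda>h1 h2. f (E (1 * (h1 \<triangleright> c)) h2 1 \<otimes> tgt L y) (E 1 g 1))"
      by (rule smash.E_mult_src[OF smash.mult_lmap(1)[OF smash.bilmapD(1)[OF fb smash.E_closed]
        smash.tgt_closed] vs_sB])
    also have "\<dots> = sw sB 2 h (\<lambda>h1 r. sw sB 2 r (\<lambda>h2 h3. f (E (h1 \<triangleright> c) h2 (h3 \<triangleright> y)) (E 1 g 1)))"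
      by (simp add: smash.E_mult_tgt[OF smash.bilmapD(1)[OF fb smash.E_closed] vs_sB])
    also have "\<dots> = sw sB 2 h (\<lambda>h1 r. sw sB 2 r (\<lambda>h2 h3. (h1 \<triangleright> c) * (f (E 1 h2 1) (E 1 g 1) *
      (h3 \<triangleright> y))))"
      by (simp only: 2[of _ "_ \<triangleright> _" _ "_ \<triangleright> _"] smash.E_closed)
    finally have 3: "f (E 1 h 1) (E c g y) =
      sw sB 2 h (\<lambda>h1 r. sw sB 2 r (\<lambda>h2 h3. (h1 \<triangleright> c) * (f (E 1 h2 1) (E 1 g 1) * (h3 \<triangleright> y))))" .
    show ?thesis
      unfolding 2[of "E c g y" b h x, OF smash.E_closed] 3 by (simp only: sw_mult mult.assoc)
  qed
  with fb bil show ?thesis unfolding coords_def by blast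
qed

lemma coords_special:
  assumes f: "coords \<gamma> f"
  shows "f (E b h 1) (E c g 1) = sw sB 2 h (\<lambda>h1 h2. b * ((h1 \<triangleright> c) * \<gamma> h2 g))"
    "f (E 1 h x) (E 1 g y) = sw sB 2 h (\<lambda>h1 h2. \<gamma> h1 g * ((h2 \<triangleright> y) * x))"
  by (simp_all add: coordsD(3)[OF f] act_one sB_simps sw_eps lin_cross bilinear_mapD[OF
    coordsD(1)[OF f]] sw_sB_pull
    del: B.scale_scale)

lemma quad_product:
  assumes f: "bilmap L sB f" and g: "bilmap L sB g"
  shows "smash.quad sB (\<lambda>U1 U2 V1 V2. f U1 V1 * g U2 V2)"
  unfolding smash.quad_def
  by (intro ballI conjI lmap_B_mult smash.bilmapD[OF f] smash.bilmapD[OF g])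

lemma convolution_cs2: "convolution L f g = smash.cs2 (\<lambda>U1 U2 V1 V2. f U1 V1 * g U2 V2)"
  by (intro ext) (simp add: convolution_def smash.cs2_def smash.cs_def)

text \<open>The coproduct gives the s-coordinates to f and the t-coordinates to g. Their
  half-trivial values (\<open>coords_special\<close>) leave \<gamma> and \<delta> next to each other
  in the middle.\<close>

lemma coords_convolution:
  assumes f: "coords \<gamma> f" and g: "coords \<delta> g"
  shows "coords (conv2 \<gamma> \<delta>) (convolution L f g)"
proof -
  note q = quad_product[OF coordsD(2)[OF f] coordsD(2)[OF g]]
  note \<gamma> = bilinear_mapD[OF coordsD(1)[OF f]] and \<delta> = bilinear_mapD[OF coordsD(1)[OF g]]
  have "convolution L f g (E b h x) (E c k y) =
    sw sB 2 h (\<lambda>h1 r. sw sB 2 r (\<lambda>h2 h3. b * ((h1 \<triangleright> c) * (conv2 \<gamma> \<delta> h2 k * ((h3 \<triangleright> y) *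
      x)))))" for b h x c k y
    by (simp add: convolution_cs2 smash.cs2_E[OF q vs_sB] coords_special[OF f] coords_special[OF
      g] conv2_def
      \<gamma> \<delta> sw_norm sw_skip)
  then show ?thesis
    unfolding coords_def convolution_cs2
    using conv2_bil[OF coordsD(1)[OF f] coordsD(1)[OF g]] smash.cs2_bilmap[OF q vs_sB] by blast
qed

lemma coords_counit: "coords (\<lambda>h g. sB (eps h * eps g) 1) (\<lambda>U V. counit L (U \<otimes> V))"
  unfolding coords_def
proof (intro conjI allI)
  show "bil (\<lambda>h g. sB (eps h * eps g) 1)"
    by (simp add: bilinear_map_def B.scale_scale[symmetric] lin_cross del: B.scale_scale)
  show "bilmap L sB (\<lambda>U V. counit L (U \<otimes> V))"
    by (intro smash.bilmapI smash.mult_lmap smash.counit_lmap)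
  show "counit L (E b h x \<otimes> E c g y) = sw sB 2 h (\<lambda>h1 r. sw sB 2 r (\<lambda>h2 h3.
      b * ((h1 \<triangleright> c) * (sB (eps h2 * eps g) 1 * ((h3 \<triangleright> y) * x)))))" for b h x c g y
    by (simp add: smash.counit_mult_E measuring[where n = 2] sB_simps sw_eps lin_cross sw_sB_pull
      mult.assoc
      del: B.scale_scale)
qed

text \<open>\<open>conv_inverse\<close> is an arbitrary choice, but its coordinates are a
  convolution inverse of \<sigma> on H \<otimes> H, where inverses are unique.\<close>

lemma conv_inverse_coords:
  assumes f: "coords \<sigma> f" and inv: "is_conv_inverse L f g"
  shows "coords \<sigma>i g"
proof -
  define \<gamma> where "\<gamma> = (\<lambda>h k. g (E 1 h 1) (E 1 k 1))"
  have g: "coords \<gamma> g"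
    unfolding \<gamma>_def using inv by (intro forms_coords) (simp add: is_conv_inverse_def)
  have ev: "\<delta> h k = d (E 1 h 1) (E 1 k 1)" if "coords \<delta> d" for \<delta> d h k
    unfolding coords_special(1)[OF that]
    by (simp add: act_one sB_simps sw_eps lin_cross bilinear_mapD[OF coordsD(1)[OF that]] del:
      B.scale_scale)
  have "conv2 \<sigma> \<gamma> = (\<lambda>h g. sB (eps h * eps g) 1)"
  proof (intro ext)
    fix h k
    have "conv2 \<sigma> \<gamma> h k = counit L (E 1 h 1 \<otimes> E 1 k 1)"
      unfolding ev[OF coords_convolution[OF f g]]
      using inv by (simp add: is_conv_inverse_def smash.E_closed)
    then show "conv2 \<sigma> \<gamma> h k = sB (eps h * eps k) 1"
      unfolding ev[OF coords_counit] .
  qed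
  then have "\<gamma> = \<sigma>i"
    using conv2_assoc[OF \<sigma>i_bilinear \<sigma>_bilinear coordsD(1)[OF g]]
    by (simp add: conv2_\<sigma> conv2_unit \<sigma>i_bilinear coordsD(1)[OF g])
  with g show ?thesis by simp
qed

lemma is_conv_inverse_coords:
  assumes f: "coords \<sigma> f" and g: "coords \<sigma>i g"
  shows "is_conv_inverse L f g"
  unfolding is_conv_inverse_def
  using coords_forms[OF f] coords_forms[OF g]
    coords_agree[OF coords_convolution[OF f g, unfolded conv2_\<sigma>] coords_counit]
    coords_agree[OF coords_convolution[OF g f, unfolded conv2_\<sigma>] coords_counit]
  by blast

end

section \<open>The 2-cocycle conditions and the twisted product\<close>

locale twisted = twisting +
  fixes \<zeta> \<xi>
  assumes \<zeta>: "coords \<sigma> \<zeta>" and \<xi>: "coords \<sigma>i \<xi>"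
begin

lemma conv_inverse: "is_conv_inverse L \<zeta> (conv_inverse L \<zeta>)"
  unfolding conv_inverse_def by (rule someI[of "is_conv_inverse L \<zeta>",
    OF is_conv_inverse_coords[OF \<zeta> \<xi>]])

lemma coords_conv_inverse: "coords \<sigma>i (conv_inverse L \<zeta>)"
  by (rule conv_inverse_coords[OF \<zeta> conv_inverse])

lemma \<zeta>_lam: "\<zeta> (E b h x) (E c g y) = b * (sw sB 2 h (\<lambda>h1 h2. lam h1 c g * (h2 \<triangleright> y)) * x)"
  by (simp add: coordsD(3)[OF \<zeta>] lam_def lin_all sw_norm)

lemma \<zeta>_left: "\<zeta> (E b h 1) (E c g 1) = b * lam h c g"
  by (simp add: \<zeta>_lam act_one sB_simps sw_eps lin_all del: B.scale_scale)

lemma coords_rho: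
  assumes f: "coords \<sigma>i f"
  shows "f (E b h x) (E c g y) = b * (sw sB 2 h (\<lambda>h1 h2. (h1 \<triangleright> c) * rho h2 y g) * x)"
    "f (E 1 h x) (E 1 g y) = rho h y g * x"
  by (simp_all add: coordsD(3)[OF f] rho_def act_one sB_simps sw_eps lin_all sw_norm del: B.scale_scale)

lemma smash_mult_E1:
  assumes f: "lmap L t f" and t: "vector_space t"
  shows "f (E 1 h x \<otimes> E 1 g y) = sw t 2 h (\<lambda>h1 h2. f (E 1 (h1 * g) ((h2 \<triangleright> y) * x)))"
    "f (E b h 1 \<otimes> E c g 1) = sw t 2 h (\<lambda>h1 h2. f (E (b * (h1 \<triangleright> c)) (h2 * g) 1))"
    "f (E 1 h 1 \<otimes> E 1 g 1) = f (E 1 (h * g) 1)"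
proof -
  note tri = smash.E_tri[OF f t]
  note simps = smash_mult_E[OF f t] act_one linD(2)[OF trilinear_mapD(1)[OF tri lin_id[OF vs_sB]]]
    linD(2)[OF trilinear_mapD(3)[OF tri lin_id[OF vs_sB]]] trilinear_mapD[OF tri] sB_simps
    sw_pull[OF lin_scale_right[OF lin_id[OF t]], symmetric]
    lin_cross lin_scale_right[where t = t] sw_counit_left[where t = t] sw_counit_right[where t = t]
  show "f (E 1 h x \<otimes> E 1 g y) = sw t 2 h (\<lambda>h1 h2. f (E 1 (h1 * g) ((h2 \<triangleright> y) * x)))"
    and "f (E b h 1 \<otimes> E c g 1) = sw t 2 h (\<lambda>h1 h2. f (E (b * (h1 \<triangleright> c)) (h2 * g) 1))"
    and "f (E 1 h 1 \<otimes> E 1 g 1) = f (E 1 (h * g) 1)"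
    by (simp_all add: simps)
qed

lemmas \<zeta>_bil = coordsD(2)[OF \<zeta>]

text \<open>The inner product of the left 2-cocycle condition, seen through a linear map k. Its two
  sides are the cases k = \<zeta> U and k = \<zeta> with last argument W; \<open>right_prod\<close>
  serves the right condition likewise and reappears in the twisted product.\<close>

definition left_prod where
  "left_prod k V W = smash.cs2 (\<lambda>V1 V2 W1 W2. k (src L (\<zeta> V1 W1) \<otimes> V2 \<otimes> W2)) V W"

definition right_prod where
  "right_prod \<eta> k V W = smash.cs2 (\<lambda>V1 V2 W1 W2. k (tgt L (\<eta> V2 W2) \<otimes> V1 \<otimes> W1)) V W"

lemma left_prod_quad:
  assumes k: "lmap L t k" and t: "vector_space t"
  shows "smash.quad t (\<lambda>V1 V2 W1 W2. k (src L (\<zeta> V1 W1) \<otimes> V2 \<otimes> W2))"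
  unfolding smash.quad_def
proof (intro ballI conjI)
  fix A B C assume *: "A \<in> carrier L" "B \<in> carrier L" "C \<in> carrier L"
  note cl = smash.src_closed smash.mult_closed *
  show "lmap L t (\<lambda>Z. k (src L (\<zeta> Z B) \<otimes> A \<otimes> C))" "lmap L t (\<lambda>Z. k (src L (\<zeta> A Z) \<otimes> B \<otimes> C))"
    using lmap_comp[OF smash.bilmapD(1)[OF \<zeta>_bil *(2)] smash.lin_src(1)[OF k t
      smash.mult_closed[OF *(1,3)]]]
      lmap_comp[OF smash.bilmapD(2)[OF \<zeta>_bil *(1)] smash.lin_src(1)[OF k t smash.mult_closed[OF
        *(2,3)]]]
    by (simp_all add: smash.mult_assoc cl)
  show "lmap L t (\<lambda>Z. k (src L (\<zeta> A B) \<otimes> Z \<otimes> C))" "lmap L t (\<lambda>Z. k (src L (\<zeta> A C) \<otimes> B \<otimes> Z))"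
    using smash.mult_lmap(2)[OF smash.mult_lmap(1)[OF k *(3)] smash.src_closed]
      smash.mult_lmap(2)[OF k smash.mult_closed[OF smash.src_closed *(2)]] by simp_all
qed

lemma right_prod_quad:
  assumes \<eta>: "bilmap L sB \<eta>" and k: "lmap L t k" and t: "vector_space t"
  shows "smash.quad t (\<lambda>V1 V2 W1 W2. k (tgt L (\<eta> V2 W2) \<otimes> V1 \<otimes> W1))"
  unfolding smash.quad_def
proof (intro ballI conjI)
  fix A B C assume *: "A \<in> carrier L" "B \<in> carrier L" "C \<in> carrier L"
  note cl = smash.tgt_closed smash.mult_closed *
  show "lmap L t (\<lambda>Z. k (tgt L (\<eta> Z C) \<otimes> A \<otimes> B))" "lmap L t (\<lambda>Z. k (tgt L (\<eta> B Z) \<otimes> A \<otimes> C))"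
    using lmap_comp[OF smash.bilmapD(1)[OF \<eta> *(3)] smash.lin_src(2)[OF k t smash.mult_closed[OF
      *(1,2)]]]
      lmap_comp[OF smash.bilmapD(2)[OF \<eta> *(2)] smash.lin_src(2)[OF k t smash.mult_closed[OF *(1,3)]]]
    by (simp_all add: smash.mult_assoc cl)
  show "lmap L t (\<lambda>Z. k (tgt L (\<eta> A C) \<otimes> Z \<otimes> B))" "lmap L t (\<lambda>Z. k (tgt L (\<eta> B C) \<otimes> A \<otimes> Z))"
    using smash.mult_lmap(2)[OF smash.mult_lmap(1)[OF k *(2)] smash.tgt_closed]
      smash.mult_lmap(2)[OF k smash.mult_closed[OF smash.tgt_closed *(1)]] by simp_all
qed

lemma left_prod_bilmap:
  assumes k: "lmap L t k" and t: "vector_space t"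
  shows "bilmap L t (left_prod k)"
  using smash.cs2_bilmap[OF left_prod_quad[OF k t] t] by (simp add: left_prod_def[abs_def])

lemma left_prod_E:
  assumes k: "lmap L t k" and t: "vector_space t"
  shows "left_prod k (E b g v) (E c f w) = sw t n g (\<lambda>g1 r. sw t n r (\<lambda>g2 g3. sw t m f (\<lambda>f1 f2.
    k (E (b * lam g1 c f1) (g2 * f2) ((g3 \<triangleright> w) * v)))))"
proof -
  have "k (src L e \<otimes> E 1 g2 v \<otimes> E 1 f2 w) = sw t 2 g2 (\<lambda>g1 g2. k (E e (g1 * f2) ((g2 \<triangleright> w) *
    v)))" for e g2 f2
    unfolding smash.mult_assoc[OF smash.src_closed smash.E_closed smash.E_closed]
      smash_mult_E1(1)[OF smash.mult_lmap(2)[OF k smash.src_closed] t]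
    by (simp add: smash.src_mult_E)
  then have "left_prod k (E b g v) (E c f w) = sw t 2 g (\<lambda>g1 r. sw t 3 f (\<lambda>f1 f2. sw t 2 r (\<lambda>g2 g3.
      k (E (b * lam g1 c f1) (g2 * f2) ((g3 \<triangleright> w) * v)))))"
    by (simp add: left_prod_def smash.cs2_E[OF left_prod_quad[OF k t] t] \<zeta>_left)
  then show ?thesis by (simp add: sw_swap) (simp add: sw_def)
qed

lemma right_prod_bilmap:
  assumes \<eta>: "bilmap L sB \<eta>" and k: "lmap L t k" and t: "vector_space t"
  shows "bilmap L t (right_prod \<eta> k)"
  using smash.cs2_bilmap[OF right_prod_quad[OF \<eta> k t] t] by (simp add: right_prod_def[abs_def])

lemma right_prod_E:
  assumes \<eta>: "coords \<sigma>i \<eta>" and k: "lmap L t k" and t: "vector_space t"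
  shows "right_prod \<eta> k (E b g v) (E c f w) = sw t n g (\<lambda>g1 r. sw t n r (\<lambda>g2 g3. sw t m f (\<lambda>f1 f2.
    k (E (b * (g1 \<triangleright> c)) (g2 * f1) (rho g3 w f2 * v)))))"
    "right_prod \<eta> k (E 1 g v) (E 1 f w) = sw t n g (\<lambda>g2 g3. sw t m f (\<lambda>f1 f2.
    k (E 1 (g2 * f1) (rho g3 w f2 * v))))"
proof -
  note k' = smash.mult_lmap(2)[OF k smash.tgt_closed]
  have 1: "k (tgt L e \<otimes> E b h 1 \<otimes> E c g 1) = sw t 2 h (\<lambda>h1 h2. k (E (b * (h1 \<triangleright> c)) (h2 * g) e))"
    "k (tgt L e \<otimes> E 1 h 1 \<otimes> E 1 g 1) = k (E 1 (h * g) e)" for e b c h g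
    unfolding smash.mult_assoc[OF smash.tgt_closed smash.E_closed smash.E_closed]
    by (simp only: smash_mult_E1(2)[OF k' t] smash.tgt_mult_E mult_1_left)
      (simp only: smash_mult_E1(3)[OF k' t] smash.tgt_mult_E mult_1_left)
  note quad = right_prod_quad[OF coordsD(2)[OF \<eta>] k t]
  have "right_prod \<eta> k (E b g v) (E c f w) = sw t 2 g (\<lambda>r g3. sw t 3 f (\<lambda>f1 f2. sw t 2 r (\<lambda>g1 g2.
      k (E (b * (g1 \<triangleright> c)) (g2 * f1) (rho g3 w f2 * v)))))"
    by (simp add: right_prod_def smash.cs2_E[OF quad t] coords_rho(2)[OF \<eta>] 1(1))
  also have "\<dots> = sw t 2 g (\<lambda>g1 r. sw t 2 r (\<lambda>g2 g3. sw t 3 f (\<lambda>f1 f2.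
      k (E (b * (g1 \<triangleright> c)) (g2 * f1) (rho g3 w f2 * v)))))"
    by (simp add: sw_swap sw_coassoc lin_all trilinear_mapD[OF smash.E_tri[OF k t]])
  finally show "right_prod \<eta> k (E b g v) (E c f w) = sw t n g (\<lambda>g1 r. sw t n r (\<lambda>g2 g3. sw t m f
    (\<lambda>f1 f2.
    k (E (b * (g1 \<triangleright> c)) (g2 * f1) (rho g3 w f2 * v)))))"
    by (simp add: sw_def)
  have "right_prod \<eta> k (E 1 g v) (E 1 f w) = sw t 2 g (\<lambda>g2 g3. sw t 3 f (\<lambda>f1 f2.
    k (E 1 (g2 * f1) (rho g3 w f2 * v))))"
    by (simp add: right_prod_def smash.cs2_E[OF quad t] coords_rho(2)[OF \<eta>] 1(2))
  then show "right_prod \<eta> k (E 1 g v) (E 1 f w) = sw t n g (\<lambda>g2 g3. sw t m f (\<lambda>f1 f2.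
    k (E 1 (g2 * f1) (rho g3 w f2 * v))))"
    by (simp add: sw_def)
qed

text \<open>On generators the outer coordinates separate. The left one is \<open>lam_lam\<close>,
  while the right one needs only the measuring property and associative type.\<close>

lemma left_cocycle:
  assumes UVW: "U \<in> carrier L" "V \<in> carrier L" "W \<in> carrier L"
  shows "left_prod (\<zeta> U) V W = left_prod (\<lambda>Z. \<zeta> Z W) U V"
proof (rule smash.tri_eqI[OF _ _ _ _ UVW, of sB "\<lambda>U. left_prod (\<zeta> U)" "\<lambda>U V W. left_prod (\<lambda>Z. \<zeta> Z
  W) U V"])
  note k1 = smash.bilmapD(2)[OF \<zeta>_bil] and k2 = smash.bilmapD(1)[OF \<zeta>_bil]
  note b1 = left_prod_bilmap[OF k1 vs_sB] and b2 = left_prod_bilmap[OF k2 vs_sB]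
  note cl = smash.src_closed smash.mult_closed
  show "lmap L sB (\<lambda>U. left_prod (\<zeta> U) V W) \<and> lmap L sB (\<lambda>U. left_prod (\<lambda>Z. \<zeta> Z W) U V)"
    if "V \<in> carrier L" "W \<in> carrier L" for V W
    using smash.bilmapD(1)[OF b2] that
    by (auto simp: left_prod_def[of "\<zeta> _"] intro!: smash.cs2_param vs_sB k2 cl)
  show "lmap L sB (\<lambda>V. left_prod (\<zeta> U) V W) \<and> lmap L sB (\<lambda>V. left_prod (\<lambda>Z. \<zeta> Z W) U V)"
    if "U \<in> carrier L" "W \<in> carrier L" for U W
    using smash.bilmapD(1)[OF b1] smash.bilmapD(2)[OF b2] that by auto
  show "lmap L sB (\<lambda>W. left_prod (\<zeta> U) V W) \<and> lmap L sB (\<lambda>W. left_prod (\<lambda>Z. \<zeta> Z W) U V)"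
    if "U \<in> carrier L" "V \<in> carrier L" for U V
    using smash.bilmapD(2)[OF b1] that
    by (auto simp: left_prod_def[of "\<lambda>Z. \<zeta> Z _"] intro!: smash.cs2_param vs_sB k1 cl)
  show "left_prod (\<zeta> (E a h u)) (E b g v) (E c f w) = left_prod (\<lambda>Z. \<zeta> Z (E c f w)) (E a h u) (E b g v)"
    for a h u b g v c f w
  proof -
    have "left_prod (\<lambda>Z. \<zeta> Z (E c f w)) (E a h u) (E b g v) =
        sw sB 2 h (\<lambda>p r. sw sB 2 r (\<lambda>h3 h4. sw sB 3 g (\<lambda>p' g3. a * (
          sw sB 2 p (\<lambda>h1 h2. sw sB 3 p' (\<lambda>g1 g2. lam h1 b g1 * lam (h2 * g2) c f)) *
          (((h3 * g3) \<triangleright> w) * ((h4 \<triangleright> v) * u))))))"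
      by (simp add: left_prod_E[OF k2[OF smash.E_closed] vs_sB, where n = 2 and m = 3] \<zeta>_lam sw_prod_23
        lin_all sw_norm sw_skip)
    also have "\<dots> = left_prod (\<zeta> (E a h u)) (E b g v) (E c f w)"
      unfolding lam_lam
      by (simp add: left_prod_E[OF k1[OF smash.E_closed] vs_sB, where n = 3 and m = 4] \<zeta>_lam
        measuring[where n = 2] act_mult lin_all sw_norm sw_skip)
    finally show ?thesis by simp
  qed
qed

text \<open>The mirror image of \<open>left_cocycle\<close>: \<open>rho_rho\<close> settles the
  right coordinate, the measuring property and associative type the left one.\<close>

lemma right_cocycle:
  assumes \<eta>: "coords \<sigma>i \<eta>" and UVW: "U \<in> carrier L" "V \<in> carrier L" "W \<in> carrier L"
  shows "right_prod \<eta> (\<eta> U) V W = right_prod \<eta> (\<lambda>Z. \<eta> Z W) U V"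
proof (rule smash.tri_eqI[OF _ _ _ _ UVW, of sB "\<lambda>U. right_prod \<eta> (\<eta> U)" "\<lambda>U V W. right_prod \<eta>
  (\<lambda>Z. \<eta> Z W) U V"])
  note \<eta>b = coordsD(2)[OF \<eta>]
  note k1 = smash.bilmapD(2)[OF \<eta>b] and k2 = smash.bilmapD(1)[OF \<eta>b]
  note b1 = right_prod_bilmap[OF \<eta>b k1 vs_sB] and b2 = right_prod_bilmap[OF \<eta>b k2 vs_sB]
  note cl = smash.tgt_closed smash.mult_closed
  show "lmap L sB (\<lambda>U. right_prod \<eta> (\<eta> U) V W) \<and> lmap L sB (\<lambda>U. right_prod \<eta> (\<lambda>Z. \<eta> Z W) U V)"
    if "V \<in> carrier L" "W \<in> carrier L" for V W
    using smash.bilmapD(1)[OF b2] that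
    by (auto simp: right_prod_def[of \<eta> "\<eta> _"] intro!: smash.cs2_param vs_sB k2 cl)
  show "lmap L sB (\<lambda>V. right_prod \<eta> (\<eta> U) V W) \<and> lmap L sB (\<lambda>V. right_prod \<eta> (\<lambda>Z. \<eta> Z W) U V)"
    if "U \<in> carrier L" "W \<in> carrier L" for U W
    using smash.bilmapD(1)[OF b1] smash.bilmapD(2)[OF b2] that by auto
  show "lmap L sB (\<lambda>W. right_prod \<eta> (\<eta> U) V W) \<and> lmap L sB (\<lambda>W. right_prod \<eta> (\<lambda>Z. \<eta> Z W) U V)"
    if "U \<in> carrier L" "V \<in> carrier L" for U V
    using smash.bilmapD(2)[OF b1] that
    by (auto simp: right_prod_def[of \<eta> "\<lambda>Z. \<eta> Z _"] intro!: smash.cs2_param vs_sB k1 cl)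
  show "right_prod \<eta> (\<eta> (E a h u)) (E b g v) (E c f w) = right_prod \<eta> (\<lambda>Z. \<eta> Z (E c f w))
    (E a h u) (E b g v)"
    for a h u b g v c f w
  proof -
    have "right_prod \<eta> (\<lambda>Z. \<eta> Z (E c f w)) (E a h u) (E b g v) =
        sw sB 2 h (\<lambda>h1 r. sw sB 2 r (\<lambda>h2 p. sw sB 3 g (\<lambda>g1 p'. a * ((h1 \<triangleright> b) * (((h2 * g1) \<triangleright> c) * (
          sw sB 2 p (\<lambda>h1 h2. sw sB 3 p' (\<lambda>g1 g2. rho (h1 * g1) w f * rho h2 v g2)) * u))))))"
      by (simp add: right_prod_E(1)[OF \<eta> k2[OF smash.E_closed] vs_sB, where n = 2 and m =
        3] coords_rho(1)[OF \<eta>]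
        sw_prod_23 lin_all sw_norm sw_skip)
    also have "\<dots> = right_prod \<eta> (\<eta> (E a h u)) (E b g v) (E c f w)"
      unfolding rho_rho
      by (simp add: right_prod_E(1)[OF \<eta> k1[OF smash.E_closed] vs_sB, where n = 3 and m =
        4] coords_rho(1)[OF \<eta>]
        measuring[where n = 2] act_mult lin_all sw_norm sw_skip)
    finally show ?thesis by simp
  qed
qed

lemma \<zeta>_sum:
  assumes k: "lmap L t k" and VW: "V \<in> carrier L" "W \<in> carrier L"
  shows "k (lsum L [src L (\<zeta> V1 W1) \<otimes> V2 \<otimes> W2. (V1, V2) \<leftarrow> comult L V, (W1, W2) \<leftarrow> comult L W]) =
    left_prod k V W"
proof -
  let ?Us = "[src L (\<zeta> V1 W1) \<otimes> V2 \<otimes> W2. (V1, V2) \<leftarrow> comult L V, (W1, W2) \<leftarrow> comult L W]"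
  have "k (lsum L ?Us) = (\<Sum>U\<leftarrow>?Us. k U)"
    by (rule smash.lmap_lsum[OF k])
      (use VW in \<open>auto intro!: smash.mult_closed smash.src_closed dest: smash.comult_mem\<close>)
  also have "\<dots> = left_prod k V W"
    unfolding left_prod_def by (rule smash.sum_cs2)
  finally show ?thesis .
qed

lemma \<eta>_sum:
  assumes k: "lmap L t k" and VW: "V \<in> carrier L" "W \<in> carrier L"
  shows "k (lsum L [tgt L (\<eta> V2 W2) \<otimes> V1 \<otimes> W1. (V1, V2) \<leftarrow> comult L V, (W1, W2) \<leftarrow> comult L W]) =
    right_prod \<eta> k V W"
proof -
  let ?Us = "[tgt L (\<eta> V2 W2) \<otimes> V1 \<otimes> W1. (V1, V2) \<leftarrow> comult L V, (W1, W2) \<leftarrow> comult L W]"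
  have "k (lsum L ?Us) = (\<Sum>U\<leftarrow>?Us. k U)"
    by (rule smash.lmap_lsum[OF k])
      (use VW in \<open>auto intro!: smash.mult_closed smash.tgt_closed dest: smash.comult_mem\<close>)
  also have "\<dots> = right_prod \<eta> k V W"
    unfolding right_prod_def by (rule smash.sum_cs2)
  finally show ?thesis .
qed

lemma coords_one:
  assumes f: "coords \<gamma> f" and \<gamma>: "\<And>h. \<gamma> h 1 = sB (eps h) 1" "\<And>h. \<gamma> 1 h = sB (eps h) 1"
    and U: "U \<in> carrier L"
  shows "f \<one> U = counit L U" "f U \<one> = counit L U"
proof -
  note b = smash.bilmapD[OF coordsD(2)[OF f] smash.one_closed]
  show "f \<one> U = counit L U"
    by (rule smash.lmap_eqI[OF b(2) smash.counit_lmap _ U])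
      (simp add: smash.one_E coordsD(3)[OF f] smash.counit_E sw_one lin_all bilinear_mapD[OF
        coordsD(1)[OF f]]
        one_act \<gamma> sB_simps)
  show "f U \<one> = counit L U"
    by (rule smash.lmap_eqI[OF b(1) smash.counit_lmap _ U])
      (simp add: smash.one_E coordsD(3)[OF f] smash.counit_E lin_all act_one \<gamma> sB_simps sw_eps
        sw_sB_pull
        del: B.scale_scale)
qed

theorem invertible_normalised_2cocycle: "invertible_normalised_2cocycle sB L \<zeta>"
proof -
  let ?\<eta> = "conv_inverse L \<zeta>"
  have "is_conv_inverse L ?\<eta> \<zeta>" using conv_inverse by (auto simp: is_conv_inverse_def)
  then have inv: "conv_invertible L \<zeta>" "conv_invertible L ?\<eta>"
    using conv_inverse by (auto simp: conv_invertible_def)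
  note \<eta> = coords_conv_inverse
  have "normalised_left_2cocycle L \<zeta>"
    unfolding normalised_left_2cocycle_def
    using coords_one[OF \<zeta> \<sigma>_one_right \<sigma>_one_left]
    by (auto simp: inv \<zeta>_sum[OF smash.bilmapD(2)[OF \<zeta>_bil]] left_cocycle
      \<zeta>_sum[where k = "\<lambda>Z. \<zeta> Z _", OF smash.bilmapD(1)[OF \<zeta>_bil]])
  moreover have "normalised_right_2cocycle L ?\<eta>"
    unfolding normalised_right_2cocycle_def
    using coords_one[OF \<eta> \<sigma>i_one]
    by (auto simp: inv \<eta>_sum[OF smash.bilmapD(2)[OF coordsD(2)[OF \<eta>]]] right_cocycle[OF \<eta>]
      \<eta>_sum[where k = "\<lambda>Z. ?\<eta> Z _", OF smash.bilmapD(1)[OF coordsD(2)[OF \<eta>]]])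
  ultimately show ?thesis
    unfolding invertible_normalised_2cocycle_def using smash.left_bialgebroid by blast
qed

abbreviation "TW \<equiv> cocycle_twist L \<zeta>"

lemma TW_simps:
  "carrier TW = carrier L" "\<zero>\<^bsub>TW\<^esub> = \<zero>\<^bsub>L\<^esub>" "\<one>\<^bsub>TW\<^esub> = \<one>\<^bsub>L\<^esub>" "src TW = src L" "tgt TW = tgt L"
  "comult TW = comult L" "counit TW = counit L" "add TW = add L" "module.smult TW = module.smult L"
  "lmap TW s f \<longleftrightarrow> lmap L s f" "bilmap TW s \<Psi> \<longleftrightarrow> bilmap L s \<Psi>" "lsum TW = lsum L"
  by (simp_all add: cocycle_twist_def lmap_def bilmap_def lsum_def fun_eq_iff)

lemma TW_mult:
  "U \<otimes>\<^bsub>TW\<^esub> V = lsum L [src L (\<zeta> U1 V1) \<otimes> tgt L (conv_inverse L \<zeta> U3 V3) \<otimes> U2 \<otimes> V2.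
      (U1, U2, U3) \<leftarrow> comult3 (comult L) U, (V1, V2, V3) \<leftarrow> comult3 (comult L) V]"
  by (simp add: cocycle_twist_def)

lemma comult3_mem:
  "(A, B, C) \<in> set (comult3 (comult L) U) \<Longrightarrow> U \<in> carrier L \<Longrightarrow>
    A \<in> carrier L \<and> B \<in> carrier L \<and> C \<in> carrier L"
  by (auto simp: comult3_def dest!: smash.comult_mem)

lemma TW_mult_closed: "U \<in> carrier L \<Longrightarrow> V \<in> carrier L \<Longrightarrow> U \<otimes>\<^bsub>TW\<^esub> V \<in> carrier L"
  unfolding TW_mult
  by (rule smash.lsum_closed)
    (auto intro!: smash.mult_closed smash.src_closed smash.tgt_closed dest: comult3_mem)

text \<open>The twisted product regrouped: \<zeta> takes the first legs, and what remains is a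
  \<open>right_prod\<close>, so that its coordinate formula applies to the inner part.\<close>

definition twist_prod where
  "twist_prod f U V = smash.cs2 (\<lambda>U1 R V1 Q.
    right_prod (conv_inverse L \<zeta>) (\<lambda>Z. f (src L (\<zeta> U1 V1) \<otimes> Z)) R Q) U V"

lemma TW_mult_test:
  assumes f: "lmap L kmul f" and UV: "U \<in> carrier L" "V \<in> carrier L"
  shows "f (U \<otimes>\<^bsub>TW\<^esub> V) = twist_prod f U V"
proof -
  let ?\<eta> = "conv_inverse L \<zeta>"
  let ?F = "\<lambda>U1 U2 U3 V1 V2 V3. f (src L (\<zeta> U1 V1) \<otimes> tgt L (?\<eta> U3 V3) \<otimes> U2 \<otimes> V2)"
  have swap: "smash.cs (\<lambda>U2 U3. smash.cs (\<lambda>V1 Q. K U2 U3 V1 Q) V) R =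
      smash.cs (\<lambda>V1 Q. smash.cs (\<lambda>U2 U3. K U2 U3 V1 Q) R) V" for K :: "_ \<Rightarrow> _ \<Rightarrow> _ \<Rightarrow> _ \<Rightarrow>
        _ :: ab_group_add" and R V
    unfolding smash.cs_def case_prod_unfold by (rule sum_list_swap)
  have "f (U \<otimes>\<^bsub>TW\<^esub> V) = smash.cs (\<lambda>U1 R. smash.cs (\<lambda>U2 U3. smash.cs (\<lambda>V1 Q. smash.cs (\<lambda>V2 V3.
      ?F U1 U2 U3 V1 V2 V3) Q) V) R) U"
    unfolding TW_mult
    by (subst smash.lmap_lsum[OF f])
      (use UV in \<open>auto intro!: smash.mult_closed smash.src_closed smash.tgt_closed dest: comult3_mem\<close>,
       simp add: smash.cs_def comult3_def sum_list_concat_map case_prod_unfold o_def)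
  also have "\<dots> = smash.cs2 (\<lambda>U1 R V1 Q. smash.cs2 (\<lambda>U2 U3 V2 V3. ?F U1 U2 U3 V1 V2 V3) R Q) U V"
    unfolding smash.cs2_def by (rule smash.cs_cong[OF UV(1)]) (rule swap)
  also have "\<dots> = twist_prod f U V"
    unfolding twist_prod_def right_prod_def
    by (intro smash.cs2_cong UV) (simp_all add: smash.mult_assoc smash.mult_closed
      smash.src_closed smash.tgt_closed)
  finally show ?thesis .
qed

lemma twist_prod_quad:
  assumes f: "lmap L kmul f"
  shows "smash.quad kmul (\<lambda>U1 R V1 Q. right_prod (conv_inverse L \<zeta>) (\<lambda>Z. f (src L (\<zeta> U1 V1) \<otimes> Z)) R Q)"
  unfolding smash.quad_def
proof (intro ballI conjI)
  note \<eta> = coordsD(2)[OF coords_conv_inverse]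
  fix A B C assume *: "A \<in> carrier L" "B \<in> carrier L" "C \<in> carrier L"
  note rb = right_prod_bilmap[OF \<eta> smash.mult_lmap(2)[OF f smash.src_closed] vs_kmul]
  show "lmap L kmul (\<lambda>Z. right_prod (conv_inverse L \<zeta>) (\<lambda>Z. f (src L (\<zeta> A B) \<otimes> Z)) Z C)"
    "lmap L kmul (\<lambda>Z. right_prod (conv_inverse L \<zeta>) (\<lambda>Z. f (src L (\<zeta> A C) \<otimes> Z)) B Z)"
    by (rule smash.bilmapD[OF rb] *)+
  show "lmap L kmul (\<lambda>Y. right_prod (conv_inverse L \<zeta>) (\<lambda>Z. f (src L (\<zeta> Y B) \<otimes> Z)) A C)"
    "lmap L kmul (\<lambda>Y. right_prod (conv_inverse L \<zeta>) (\<lambda>Z. f (src L (\<zeta> A Y) \<otimes> Z)) B C)"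
    unfolding right_prod_def
    by (intro smash.cs2_param vs_kmul * lmap_comp[OF smash.bilmapD(1)[OF \<zeta>_bil]]
        lmap_comp[OF smash.bilmapD(2)[OF \<zeta>_bil]] smash.lin_src f smash.mult_closed
          smash.tgt_closed; assumption)+
qed

text \<open>On the first legs \<zeta> contributes the coefficient \<open>lam\<close> on the left,
  and its inverse contributes \<open>rho\<close> on the right; the H-parts multiply as before. This
  is the product formula for \<sigma>.\<close>

lemma twist_prod_E:
  assumes f: "lmap L kmul f"
  shows "twist_prod f (E b h x) (E c g y) =
      sw kmul 2 h (\<lambda>h1 r. sw kmul 2 r (\<lambda>h2 h3. sw kmul 3 g (\<lambda>g1 q. sw kmul 3 q (\<lambda>g2 g3.
        f (E (b * lam h1 c g1) (h2 * g2) (rho h3 y g3 * x))))))"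
  by (simp add: twist_prod_def smash.cs2_E[OF twist_prod_quad[OF f] vs_kmul] \<zeta>_left smash.src_mult_E
    right_prod_E(2)[OF coords_conv_inverse smash.mult_lmap(2)[OF f smash.src_closed] vs_kmul,
      where n = 2 and m = 3]
    sw_swap)

theorem presented_twist: "presented H sB act \<sigma> \<sigma>i TW E"
proof (intro presented.intro presented_coring.intro presented_module.intro presented_axioms.intro
    presented_coring_axioms.intro presented_module_axioms.intro)
  show "crossed H sB (\<triangleright>) \<sigma> \<sigma>i" by unfold_locales
  show "k_module TW"
    using smash.L_module
    unfolding k_module_def Module.module_def module_axioms_def abelian_group_def abelian_monoid_def
      abelian_group_axioms_def
    by (simp add: TW_simps)
  fix f U V assume f: "lmap TW kmul f" and UV: "U \<in> carrier TW" "V \<in> carrier TW"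
  have f': "lmap L kmul f" using f by (simp add: TW_simps)
  have b: "bilmap L kmul (twist_prod f)"
    using smash.cs2_bilmap[OF twist_prod_quad[OF f'] vs_kmul] by (simp add: twist_prod_def[abs_def])
  show "lmap TW kmul (\<lambda>U. f (U \<otimes>\<^bsub>TW\<^esub> V))"
    using smash.bilmapD(1)[OF b] UV TW_mult_test[OF f'] by (simp add: TW_simps lmap_def
      smash.LM.a_closed)
  show "lmap TW kmul (\<lambda>V. f (U \<otimes>\<^bsub>TW\<^esub> V))"
    using smash.bilmapD(2)[OF b] UV TW_mult_test[OF f'] by (simp add: TW_simps lmap_def
      smash.LM.a_closed)
next
  fix f b h x c g y assume "lmap TW kmul f"
  then have f: "lmap L kmul f" by (simp add: TW_simps)
  show "f (E b h x \<otimes>\<^bsub>TW\<^esub> E c g y) =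
      sw kmul 2 h (\<lambda>h1 r. sw kmul 2 r (\<lambda>h2 h3. sw kmul 3 g (\<lambda>g1 q. sw kmul 3 q (\<lambda>g2 g3.
        f (E (b * lam h1 c g1) (h2 * g2) (rho h3 y g3 * x))))))"
    unfolding TW_mult_test[OF f smash.E_closed smash.E_closed] by (rule twist_prod_E[OF f])
qed (simp_all add: TW_simps TW_mult_closed smash.E_closed smash.L_sep smash.E_test smash.E_span
  smash.E_lift
  smash.src_E smash.tgt_E smash.comult_L_closed smash.comult_lmap smash.comult_E smash.counit_lmap
    smash.counit_E
  smash.one_E)

end

section \<open>The cocycle of the theorem and the map \<phi>\<close>

context crossed
begin

interpretation T: crossed H sB act triv triv by (rule crossed_trivial)

abbreviation "SM \<equiv> Be_smash H sB act"

lemma presented_smash: "presented H sB act triv triv SM T.EB"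
  unfolding Be_smash_def by (rule T.presented_Be_cross)

lemma T_mu: "T.mu h x = S h \<triangleright> x"
  by (simp add: T.mu_def T.invS_def trivial_cocycle_def counit_S sB_simps sw_eps lin_cross sw_sB_pull
    del: B.scale_scale)

interpretation twisting H sB act \<sigma> \<sigma>i SM T.EB
  by (intro twisting.intro presented_smash) unfold_locales

text \<open>Stated for every bilinear \<gamma> in order to cover \<sigma>^-1 as well, which supplies
  the convolution inverse. For the trivial cocycle the second factor of B^e is S(h2)
  \<triangleright> x, so the actions of h4 and h3 g2 in the formula meet antipodes and
  cancel.\<close>

lemma coords_sigma_tilde:
  assumes \<gamma>: "bil \<gamma>"
  shows "coords \<gamma> (sigma_tilde H act \<gamma>)"
proof -
  note lins = lin_all bilinear_mapD[OF \<gamma>]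
  define form where "form = (\<lambda>b b' h c c' g. sw sB 2 h (\<lambda>h1 r. sw sB 2 r (\<lambda>h2 r. sw sB 2 r (\<lambda>h3 h4.
    sw sB 3 g (\<lambda>g1 g2. b * (h1 \<triangleright> c) * \<gamma> h2 g1 * ((h3 * g2) \<triangleright> c') * (h4 \<triangleright> b'))))))"
  have form: "tform sB (\<lambda>c c' g. form b b' h c c' g)" "tform sB (\<lambda>b b' h. ev (\<lambda>c c' g. form b b' h
    c c' g) V)"
    "tform sB (\<lambda>b b' h. form b b' h c c' g)"
    for b b' h c c' g and V :: "('b \<times> 'b \<times> 'h) list set"
    by (simp_all add: trilinear_map_def form_def lin_ev vs_sB vs_hs lins)
  have ST: "sigma_tilde H act \<gamma> U V = ev (\<lambda>b b' h. ev (\<lambda>c c' g. form b b' h c c' g) V) U" for U V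
    unfolding sigma_tilde_def ev_def form_def comult4_sw[of _ _ sB 2] sw_def[of sB 3, symmetric] ..
  have ST': "sigma_tilde H act \<gamma> U V = ev (\<lambda>c c' g. ev (\<lambda>b b' h. form b b' h c c' g) U) V" for U V
    unfolding ST ev_def case_prod_unfold by (rule sum_list_swap)
  have form': "tform sB (\<lambda>c c' g. ev (\<lambda>b b' h. form b b' h c c' g) U)" for U :: "('b \<times> 'b \<times> 'h)
    list set"
    by (simp add: trilinear_map_def form_def lin_ev vs_sB vs_hs lins)
  have "lmap SM sB (\<lambda>U. sigma_tilde H act \<gamma> U V)" "lmap SM sB (\<lambda>U. sigma_tilde H act \<gamma> V U)" for V
    unfolding Be_smash_def
    unfolding ST by (rule T.lmap_ev[OF form(2) vs_sB], fold ST, unfold ST',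
      rule T.lmap_ev[OF form' vs_sB])
  then have "bilmap SM sB (sigma_tilde H act \<gamma>)"
    by (simp add: bilmap_def)
  moreover have "sigma_tilde H act \<gamma> (T.EB b h x) (T.EB c g y) =
    sw sB 2 h (\<lambda>h1 r. sw sB 2 r (\<lambda>h2 h3. b * ((h1 \<triangleright> c) * (\<gamma> h2 g * ((h3 \<triangleright> y) * x)))))" (is "?L =
      ?R") for b h x c g y
  proof -
    have "?L = sw sB 2 h (\<lambda>p q. sw sB 3 g (\<lambda>p' q'. form b (S q \<triangleright> x) p c (S q' \<triangleright> y) p'))"
      unfolding ST T.ev_EB[OF form(2)]
      by (simp add: T.ev_EB[OF form(1)] T_mu sw_label[of sB 2 g _ 3])
    also have "\<dots> = sw sB 2 h (\<lambda>h1 r. sw sB 2 r (\<lambda>h2 r. sw sB 2 r (\<lambda>h3 r. sw sB 2 r (\<lambda>h4 h5.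
        sw sB 3 g (\<lambda>g1 r. sw sB 3 r (\<lambda>g2 g3.
        b * ((h1 \<triangleright> c) * (\<gamma> h2 g1 * (((h3 * (g2 * S g3)) \<triangleright> y) * ((h4 * S h5) \<triangleright> x))))))))))"
      by (simp add: form_def lins sw_norm sw_skip act_mult)
    also have "\<dots> = sw sB 2 h (\<lambda>h1 r. sw sB 2 r (\<lambda>h2 h3. sw sB 3 g (\<lambda>g1 r. sw sB 3 r (\<lambda>g2 g3.
        b * ((h1 \<triangleright> c) * (\<gamma> h2 g1 * (((h3 * (g2 * S g3)) \<triangleright> y) * x)))))))"
      by (subst sw_cancel(4)[where K = "\<lambda>h3 a. sw sB 3 g (\<lambda>g1 r. sw sB 3 r (\<lambda>g2 g3.
          b * ((_ \<triangleright> c) * (\<gamma> _ g1 * (((h3 * (g2 * S g3)) \<triangleright> y) * (a \<triangleright> x))))))"])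
        (simp_all add: lins one_act)
    also have "\<dots> = ?R"
      by (subst sw_cancel(4)[where K = "\<lambda>g1 a. b * ((_ \<triangleright> c) * (\<gamma> _ g1 * (((_ * a) \<triangleright> y) * x)))"])
        (simp_all add: lins)
    finally show ?thesis .
  qed
  ultimately show ?thesis using \<gamma> by (simp add: coords_def)
qed

interpretation twisted H sB act \<sigma> \<sigma>i SM T.EB "sigma_tilde H act \<sigma>" "sigma_tilde H act \<sigma>i"
  by unfold_locales (rule coords_sigma_tilde \<sigma>_bilinear \<sigma>i_bilinear)+

text \<open>\<phi> carries b \<otimes> (S(h2) \<triangleright> x) # h1 to b \<otimes> (S(h3)
  \<triangleright> x) invS(h2) # h1; this form of \<open>mu\<close> identifies the image with the
  coordinates for \<sigma>. It follows from \<open>mu_act\<close>, since the legs in h2 S(h3)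
  cancel.\<close>

lemma mu_alt: "mu h x = sw sB 2 h (\<lambda>h1 h2. (S h2 \<triangleright> x) * invS h1)"
proof -
  have "sw sB 2 h (\<lambda>h1 h2. (S h2 \<triangleright> x) * invS h1) =
      sw sB 2 h (\<lambda>h1 r. sw sB 2 r (\<lambda>h2 h3. mu h1 ((h2 * S h3) \<triangleright> x)))"
    by (simp add: mu_act[symmetric] act_mult lin_all sw_norm)
  also have "\<dots> = mu h x"
    by (subst sw_cancel(4)[where K = "\<lambda>h1 a. mu h1 (a \<triangleright> x)"]) (simp_all add: lin_all one_act)
  finally show ?thesis by simp
qed

theorem sigma_tilde_twist:
  "invertible_normalised_2cocycle sB SM (sigma_tilde H act \<sigma>)"
  "bialgebroid_iso sB (cocycle_twist SM (sigma_tilde H act \<sigma>)) BH (phi_map H sB \<sigma>i)"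
proof -
  show "invertible_normalised_2cocycle sB SM (sigma_tilde H act \<sigma>)"
    by (rule invertible_normalised_2cocycle)
  let ?\<phi> = "phi_map H sB \<sigma>i"
  \<comment> \<open>The legs inside \<sigma>^-1(S h2, h3) combine to \<open>invS\<close>, so under a
    functional \<phi> is the evaluation of a trilinear form.\<close>
  have phi: "f (?\<phi> U) = ev (\<lambda>b b' h. sw kmul 2 h (\<lambda>h1 r. f (tc [(b, b' * invS r, h1)]))) U"
    and tf: "tform kmul (\<lambda>b b' h. sw kmul 2 h (\<lambda>h1 r. f (tc [(b, b' * invS r, h1)])))"
    if f: "lmap BH kmul f" for f U
  proof -
    note tf = trilinear_mapD[OF tform_lmap[OF f vs_kmul]]
    have "sw kmul 2 h (\<lambda>h1 r. f (tc [(b, b' * invS r, h1)])) =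
        (\<Sum>(h1, h2, h3)\<leftarrow>comult3 (hcomult H) h. f (tc [(b, b' * \<sigma>i (S h2) h3, h1)]))" for b b' h
      unfolding comult3_sw[of _ _ kmul 2]
      by (simp add: invS_def sw_sB_pull sw_pull[OF tf(2)[OF lin_id[OF vs_sB]]])
    then show "f (?\<phi> U) = ev (\<lambda>b b' h. sw kmul 2 h (\<lambda>h1 r. f (tc [(b, b' * invS r, h1)]))) U"
      unfolding phi_map_def ev_def
      by (subst tc_sum[OF f]) (simp add: sum_list_concat_map case_prod_unfold o_def)
    show "tform kmul (\<lambda>b b' h. sw kmul 2 h (\<lambda>h1 r. f (tc [(b, b' * invS r, h1)])))"
      by (simp add: trilinear_map_def tf lin_all)
  qed
  have closed: "?\<phi> U \<in> carrier BH" for U by (simp add: phi_map_def BH_simps)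
  show "bialgebroid_iso sB (cocycle_twist SM (sigma_tilde H act \<sigma>)) BH ?\<phi>"
  proof (rule presented_iso[OF presented_twist presented_Be_cross closed])
    fix f assume f: "lmap BH kmul f"
    show "lmap (cocycle_twist SM (sigma_tilde H act \<sigma>)) kmul (\<lambda>U. f (?\<phi> U))"
      unfolding phi[OF f] TW_simps unfolding Be_smash_def by (rule T.lmap_ev[OF tf[OF f] vs_kmul])
  next
    fix b h x
    show "?\<phi> (T.EB b h x) = EB b h x"
    proof (rule BH_sep)
      fix f assume f: "lmap BH kmul f"
      note tf' = tform_lmap[OF f vs_kmul]
      show "f (?\<phi> (T.EB b h x)) = f (EB b h x)"
        by (simp add: phi[OF f] T.ev_EB[OF tf[OF f]] lmap_eq_ev[OF f EB_closed] ev_EB[OF tf'] T_mu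
          mu_alt
          sw_pull[OF trilinear_mapD(2)[OF tf' lin_id[OF vs_sB]]] trilinear_mapD[OF tf'] lin_all sw_norm)
    qed (simp_all add: closed EB_closed)
  qed
qed

end

theorem theorem3p13:
  fixes H :: "('k::field, 'h::{ring, monoid_mult}) hopf"
    and sB :: "'k \<Rightarrow> 'b::{ring, monoid_mult} \<Rightarrow> 'b"
    and act :: "'h \<Rightarrow> 'b \<Rightarrow> 'b"
    and \<sigma> \<sigma>i :: "'h \<Rightarrow> 'h \<Rightarrow> 'b"
  assumes "hopf_algebra H"
    and "k_algebra sB"
    and "cocycle_cross_product H sB act \<sigma> \<sigma>i"
    and "associative_type act"
  shows "invertible_normalised_2cocycle sB (Be_smash H sB act) (sigma_tilde H act \<sigma>) \<and>
    bialgebroid_iso sB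
      (cocycle_twist (Be_smash H sB act) (sigma_tilde H act \<sigma>))
      (Be_cross H sB act \<sigma> \<sigma>i)
      (phi_map H sB \<sigma>i)"
proof -
  interpret crossed H sB act \<sigma> \<sigma>i
    using assms by (intro crossed.intro crossed_axioms.intro)
  show ?thesis using sigma_tilde_twist by blast
qed

end
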